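(* There is $\kappa_0>0$ such that the following holds for all $\kappa\ge\kappa_0$. Let $H=(-\Delta)^2+V$ on $L^2(\mathbb{R}^3)$ with $V$ real-valued and $\langle x\rangle^\kappa V\in L^2(\mathbb{R}^3)$, let $p$ be the largest integer satisfying $\kappa>2p+5$, and assume that $0$ is a regular point for $H$. Then there exist $\mu_0>0$, bounded operators $M'_1,\dots,M'_{p-1}$ on $L^2(\mathbb{R}^3)$, and a family $\mathfrak{R}(\mu)$ of operators on $L^2(\mathbb{R}^3)$, uniformly bounded in operator norm, such that for every $\mu$ in the first quadrant of the complex plane ($\mathrm{Re}\,\mu>0$, $\mathrm{Im}\,\mu>0$) with $|\mu|\le\mu_0$, $$w\,(H-\mu^4)^{-1}\,w=U-Qm_0^{-1}Q+\sum_{j=1}^{p-1}M'_j\,\mu^j+\mu^p\,\mathfrak{R}(\mu)$$ in $\mathcal{B}(L^2(\mathbb{R}^3),L^2(\mathbb{R}^3))$.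
   Context: Notation: $\langle x\rangle=(1+|x|^2)^{1/2}$; $v=|V|^{1/2}$; $U(x)=1$ if $V(x)\ge0$ and $U(x)=-1$ if $V(x)<0$; $w=Uv$ (all acting as multiplication operators); $\alpha=\|v\|_{L^2}^2$; $P=\alpha^{-1}\langle v,\cdot\rangle v$; $Q=1-P$; $G_0$ is the integral operator with kernel $-\frac1{8\pi}|x-y|$; $M_0=U+vG_0v$; $m_0=QM_0Q$ regarded as an operator on $QL^2(\mathbb{R}^3)$. Standing assumption of the paper: $V(x)=O(|x|^{-\beta})$ for large $|x|$ with some $\beta>0$. Zero is a regular point of $H$ (in dimension 3) if $m_0=Q(U+vG_0v)Q$ is invertible on $QL^2(\mathbb{R}^3)$; $m_0^{-1}$ denotes this inverse on $QL^2(\mathbb{R}^3)$. *)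

theory Defs
  imports "HOL-Analysis.Analysis"
begin

type_synonym r3 = "real ^ 3"

definition sq_int :: "(r3 \<Rightarrow> complex) \<Rightarrow> bool" where
  "sq_int f \<longleftrightarrow> f \<in> borel_measurable borel \<and> integrable lborel (\<lambda>x. (norm (f x))\<^sup>2)"

definition l2_rel :: "(r3 \<Rightarrow> complex) \<Rightarrow> (r3 \<Rightarrow> complex) \<Rightarrow> bool" where
  "l2_rel f g \<longleftrightarrow> sq_int f \<and> sq_int g \<and> (AE x in lborel. f x = g x)"

lemma sq_int_zero: "sq_int (\<lambda>_. 0)"
  by (simp add: sq_int_def)

lemma sq_int_mult_integrable:
  assumes "sq_int f" "sq_int g"
  shows "integrable lborel (\<lambda>x. cnj (f x) * g x)"
proof (rule Bochner_Integration.integrable_bound)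
  show "integrable lborel (\<lambda>x. (norm (f x))\<^sup>2 + (norm (g x))\<^sup>2)"
    using assms by (auto simp: sq_int_def)
  have "(\<lambda>z. cnj z) \<in> borel_measurable borel"
    by (intro borel_measurable_continuous_onI continuous_intros)
  then have "(\<lambda>x. cnj (f x)) \<in> borel_measurable borel"
    using assms measurable_compose[of f borel borel cnj borel] by (auto simp: sq_int_def)
  then show "(\<lambda>x. cnj (f x) * g x) \<in> borel_measurable lborel"
    using assms by (auto simp: sq_int_def)
  have "a * b \<le> a\<^sup>2 + b\<^sup>2" for a b :: real
    using sum_squares_bound[of a b] sum_squares_ge_zero[of "a - b / 2" 0] zero_le_power2[of "a + b"]
    by (auto simp: power2_eq_square algebra_simps)
  then show "AE x in lborel. norm (cnj (f x) * g x) \<le> norm ((norm (f x))\<^sup>2 + (norm (g x))\<^sup>2)"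
    by (auto simp: norm_mult)
qed

lemma sq_int_add:
  assumes "sq_int f" "sq_int g"
  shows "sq_int (\<lambda>x. f x + g x)"
proof -
  have "integrable lborel (\<lambda>x. (norm (f x + g x))\<^sup>2)"
  proof (rule Bochner_Integration.integrable_bound)
    show "integrable lborel (\<lambda>x. 2 * (norm (f x))\<^sup>2 + 2 * (norm (g x))\<^sup>2)"
      using assms by (auto simp: sq_int_def)
    show "(\<lambda>x. (norm (f x + g x))\<^sup>2) \<in> borel_measurable lborel"
      using assms by (auto simp: sq_int_def)
    have "(norm (a + b))\<^sup>2 \<le> 2 * (norm a)\<^sup>2 + 2 * (norm b)\<^sup>2" for a b :: complex
    proof -
      have "(norm (a + b))\<^sup>2 \<le> (norm a + norm b)\<^sup>2"
        by (intro power_mono norm_triangle_ineq) auto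
      also have "\<dots> \<le> 2 * (norm a)\<^sup>2 + 2 * (norm b)\<^sup>2"
        using sum_squares_bound[of "norm a" "norm b"] by (simp add: power2_sum)
      finally show ?thesis .
    qed
    then show "AE x in lborel. norm ((norm (f x + g x))\<^sup>2)
        \<le> norm (2 * (norm (f x))\<^sup>2 + 2 * (norm (g x))\<^sup>2)"
      by auto
  qed
  then show ?thesis
    using assms by (auto simp: sq_int_def)
qed

lemma sq_int_cmult:
  assumes "sq_int f"
  shows "sq_int (\<lambda>x. c * f x)"
  using assms by (auto simp: sq_int_def norm_mult power_mult_distrib)

lemma sq_int_uminus: "sq_int f \<Longrightarrow> sq_int (\<lambda>x. - f x)"
  using sq_int_cmult[of f "-1"] by simp

lemma sq_int_diff: "sq_int f \<Longrightarrow> sq_int g \<Longrightarrow> sq_int (\<lambda>x. f x - g x)"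
  using sq_int_add[of f "\<lambda>x. - g x"] sq_int_uminus[of g] by simp

quotient_type l2 = "r3 \<Rightarrow> complex" / partial: l2_rel
proof (rule part_equivpI)
  show "\<exists>f. l2_rel f f"
    using sq_int_zero by (auto simp: l2_rel_def)
  show "symp l2_rel"
    by (auto simp: symp_def l2_rel_def)
  show "transp l2_rel"
    unfolding transp_def l2_rel_def by auto
qed

definition to_l2 :: "(r3 \<Rightarrow> complex) \<Rightarrow> l2" where
  "to_l2 h = (if sq_int h then abs_l2 h else abs_l2 (\<lambda>_. 0))"

lift_definition cscale :: "complex \<Rightarrow> l2 \<Rightarrow> l2" (infixr \<open>*\<^sub>C\<close> 75) is "\<lambda>c f x. c * f x"
  unfolding l2_rel_def by (auto intro: sq_int_cmult)

lift_definition cinner :: "l2 \<Rightarrow> l2 \<Rightarrow> complex" is "\<lambda>f g. \<integral>x. cnj (f x) * g x \<partial>lborel"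
  subgoal premises prems for f f' g g'
  proof -
    have ae: "AE x in lborel. cnj (f x) * g x = cnj (f' x) * g' x"
      using prems unfolding l2_rel_def by (auto elim!: AE_mp)
    show ?thesis
      using prems ae unfolding l2_rel_def
      by (intro integral_cong_AE borel_measurable_integrable sq_int_mult_integrable) auto
  qed
  done

instantiation l2 :: real_inner
begin

lift_definition zero_l2 :: l2 is "\<lambda>_. 0"
  unfolding l2_rel_def by (auto intro: sq_int_zero)

lift_definition plus_l2 :: "l2 \<Rightarrow> l2 \<Rightarrow> l2" is "\<lambda>f g x. f x + g x"
  unfolding l2_rel_def by (auto intro: sq_int_add)

lift_definition minus_l2 :: "l2 \<Rightarrow> l2 \<Rightarrow> l2" is "\<lambda>f g x. f x - g x"
  unfolding l2_rel_def by (auto intro: sq_int_diff)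

lift_definition uminus_l2 :: "l2 \<Rightarrow> l2" is "\<lambda>f x. - f x"
  unfolding l2_rel_def by (auto intro: sq_int_uminus)

definition scaleR_l2 :: "real \<Rightarrow> l2 \<Rightarrow> l2" where
  "scaleR_l2 r f = complex_of_real r *\<^sub>C f"

definition inner_l2 :: "l2 \<Rightarrow> l2 \<Rightarrow> real" where
  "inner_l2 f g = Re (cinner f g)"

definition norm_l2 :: "l2 \<Rightarrow> real" where
  "norm_l2 f = sqrt (inner f f)"

definition dist_l2 :: "l2 \<Rightarrow> l2 \<Rightarrow> real" where
  "dist_l2 f g = norm (f - g)"

definition sgn_l2 :: "l2 \<Rightarrow> l2" where
  "sgn_l2 f = scaleR (inverse (norm f)) f"

definition uniformity_l2 :: "(l2 \<times> l2) filter" where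
  "uniformity_l2 = (INF e\<in>{0<..}. principal {(x, y). dist x y < e})"

definition open_l2 :: "l2 set \<Rightarrow> bool" where
  "open_l2 S \<longleftrightarrow> (\<forall>x\<in>S. \<forall>\<^sub>F (x', y) in uniformity. x' = x \<longrightarrow> y \<in> S)"

lemma cinner_add_left: "cinner (f + g) h = cinner f h + cinner g h"
  by transfer
    (simp add: l2_rel_def distrib_right Bochner_Integration.integral_add sq_int_mult_integrable)

lemma cinner_scale_left: "cinner (c *\<^sub>C f) g = cnj c * cinner f g"
  by transfer (simp add: mult.assoc)

lemma cinner_commute: "cinner f g = cnj (cinner g f)"
proof (transfer, goal_cases)
  case (1 f g)
  have "cnj (\<integral>x. cnj (g x) * f x \<partial>lborel) = (\<integral>x. cnj (cnj (g x) * f x) \<partial>lborel)"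
    by (rule integral_bounded_linear'[OF bounded_linear_cnj bounded_linear_cnj, symmetric]) simp
  then show ?case
    by (simp add: mult.commute)
qed

lemma inner_self_l2: "inner (f :: l2) f \<ge> 0 \<and> (inner f f = 0 \<longleftrightarrow> f = 0)"
  unfolding inner_l2_def
proof (transfer, goal_cases)
  case (1 f)
  then have sq: "sq_int f" by (simp add: l2_rel_def)
  have eq: "cnj (f x) * f x = complex_of_real ((norm (f x))\<^sup>2)" for x
    by (metis complex_norm_square mult.commute)
  have int: "integrable lborel (\<lambda>x. (norm (f x))\<^sup>2)"
    using sq by (simp add: sq_int_def)
  have "Re (\<integral>x. cnj (f x) * f x \<partial>lborel) = (\<integral>x. (norm (f x))\<^sup>2 \<partial>lborel)"
    unfolding eq by (simp del: of_real_power)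
  moreover have "(\<integral>x. (norm (f x))\<^sup>2 \<partial>lborel) = 0 \<longleftrightarrow> (AE x in lborel. (norm (f x))\<^sup>2 = 0)"
    by (rule integral_nonneg_eq_0_iff_AE[OF int]) auto
  moreover have "l2_rel f (\<lambda>_. 0) \<longleftrightarrow> (AE x in lborel. (norm (f x))\<^sup>2 = 0)"
    using sq sq_int_zero by (simp add: l2_rel_def)
  moreover have "(\<integral>x. (norm (f x))\<^sup>2 \<partial>lborel) \<ge> 0"
    by simp
  ultimately show ?case by simp
qed

instance
proof
  fix f g h :: l2 and r s :: real
  show "f + g + h = f + (g + h)"
    by transfer (auto simp: l2_rel_def add.assoc intro: sq_int_add)
  show "f + g = g + f"
    by transfer (auto simp: l2_rel_def add.commute intro: sq_int_add)
  show "0 + f = f"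
    by transfer (auto simp: l2_rel_def)
  show "- f + f = 0"
    by transfer (auto simp: l2_rel_def sq_int_zero)
  show "f - g = f + - g"
    by transfer (auto simp: l2_rel_def intro: sq_int_diff)
  show "r *\<^sub>R (f + g) = r *\<^sub>R f + r *\<^sub>R g"
    unfolding scaleR_l2_def
    by transfer (auto simp: l2_rel_def distrib_left intro!: sq_int_add sq_int_cmult)
  show "(r + s) *\<^sub>R f = r *\<^sub>R f + s *\<^sub>R f"
    unfolding scaleR_l2_def
    by transfer (auto simp: l2_rel_def distrib_right intro!: sq_int_add sq_int_cmult)
  show "r *\<^sub>R s *\<^sub>R f = (r * s) *\<^sub>R f"
    unfolding scaleR_l2_def
    by transfer (auto simp: l2_rel_def mult.assoc intro!: sq_int_cmult)
  show "1 *\<^sub>R f = f"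
    unfolding scaleR_l2_def by transfer (auto simp: l2_rel_def)
  show "dist f g = norm (f - g)"
    by (rule dist_l2_def)
  show "sgn f = scaleR (inverse (norm f)) f"
    by (rule sgn_l2_def)
  show "(uniformity :: (l2 \<times> l2) filter) = (INF e\<in>{0<..}. principal {(x, y). dist x y < e})"
    by (rule uniformity_l2_def)
  show "open U \<longleftrightarrow> (\<forall>x\<in>U. \<forall>\<^sub>F (x', y) in uniformity. x' = x \<longrightarrow> y \<in> U)" for U :: "l2 set"
    by (rule open_l2_def)
  show "inner f g = inner g f"
    unfolding inner_l2_def by (metis cinner_commute complex_cnj cnj.sel(1))
  show "inner (f + g) h = inner f h + inner g h"
    by (simp add: inner_l2_def cinner_add_left)
  show "inner (r *\<^sub>R f) g = r * inner f g"
    by (simp add: inner_l2_def scaleR_l2_def cinner_scale_left)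
  show "0 \<le> inner f f" "inner f f = 0 \<longleftrightarrow> f = 0"
    using inner_self_l2[of f] by auto
  show "norm f = sqrt (inner f f)"
    by (rule norm_l2_def)
qed

end

definition bounded_op :: "(l2 \<Rightarrow> l2) \<Rightarrow> bool" where
  "bounded_op T \<longleftrightarrow> bounded_linear T \<and> (\<forall>c f. T (c *\<^sub>C f) = c *\<^sub>C T f)"

text \<open>
  Possibly unbounded operators are represented by their graphs. The inverse is then the converse
  relation and a product of operators, on its natural domain, is relational composition.
\<close>

type_synonym l2_graph = "(l2 \<times> l2) set"

definition graph_of :: "(l2 \<Rightarrow> l2) \<Rightarrow> l2_graph" where
  "graph_of T = {(f, T f) |f. True}"

definition op_sum :: "l2_graph \<Rightarrow> l2_graph \<Rightarrow> l2_graph" where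
  "op_sum A B = {(f, g + h) |f g h. (f, g) \<in> A \<and> (f, h) \<in> B}"

definition op_shift :: "l2_graph \<Rightarrow> complex \<Rightarrow> l2_graph" where
  "op_shift A z = {(f, g - z *\<^sub>C f) |f g. (f, g) \<in> A}"

definition op_resolvent :: "l2_graph \<Rightarrow> complex \<Rightarrow> l2_graph" where
  "op_resolvent A z = (op_shift A z)\<inverse>"

definition resolvent_set :: "l2_graph \<Rightarrow> complex set" where
  "resolvent_set A = {z. \<exists>R. bounded_op R \<and> op_resolvent A z = graph_of R}"

definition mult_op :: "(r3 \<Rightarrow> real) \<Rightarrow> l2_graph" where
  "mult_op a = {(f, to_l2 (\<lambda>x. complex_of_real (a x) * rep_l2 f x)) |f.
     sq_int (\<lambda>x. complex_of_real (a x) * rep_l2 f x)}"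

definition partial_deriv :: "3 \<Rightarrow> (r3 \<Rightarrow> complex) \<Rightarrow> r3 \<Rightarrow> complex" where
  "partial_deriv i f x = frechet_derivative f (at x) (axis i 1)"

fun C_k :: "nat \<Rightarrow> (r3 \<Rightarrow> complex) \<Rightarrow> bool" where
  "C_k 0 f \<longleftrightarrow> continuous_on UNIV f"
| "C_k (Suc k) f \<longleftrightarrow> (\<forall>x. f differentiable (at x)) \<and> (\<forall>i. C_k k (partial_deriv i f))"

definition test_function :: "(r3 \<Rightarrow> complex) \<Rightarrow> bool" where
  "test_function \<phi> \<longleftrightarrow> (\<forall>k. C_k k \<phi>) \<and> bounded {x. \<phi> x \<noteq> 0}"

definition laplacian :: "(r3 \<Rightarrow> complex) \<Rightarrow> r3 \<Rightarrow> complex" where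
  "laplacian f x = (\<Sum>i\<in>UNIV. partial_deriv i (partial_deriv i f) x)"

text \<open>
  The self-adjoint operator \<open>(-\<Delta>)\<^sup>2\<close>: the distributional operator on its maximal domain of all
  \<open>f\<close> in the Hilbert space with \<open>\<Delta>\<^sup>2 f\<close> again in the Hilbert space (this domain is the Sobolev
  space of order four).
\<close>

definition bilaplacian_op :: l2_graph where
  "bilaplacian_op = {(f, g). \<forall>\<phi>. test_function \<phi> \<longrightarrow>
     (\<integral>x. rep_l2 f x * laplacian (laplacian \<phi>) x \<partial>lborel) = (\<integral>x. rep_l2 g x * \<phi> x \<partial>lborel)}"

definition H_op :: "(r3 \<Rightarrow> real) \<Rightarrow> l2_graph" where
  "H_op V = op_sum bilaplacian_op (mult_op V)"

definition japanese :: "r3 \<Rightarrow> real" where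
  "japanese x = (1 + (norm x)\<^sup>2) powr (1 / 2)"

definition v_fun :: "(r3 \<Rightarrow> real) \<Rightarrow> r3 \<Rightarrow> real" where
  "v_fun V x = \<bar>V x\<bar> powr (1 / 2)"

definition U_fun :: "(r3 \<Rightarrow> real) \<Rightarrow> r3 \<Rightarrow> real" where
  "U_fun V x = (if V x \<ge> 0 then 1 else - 1)"

definition w_fun :: "(r3 \<Rightarrow> real) \<Rightarrow> r3 \<Rightarrow> real" where
  "w_fun V x = U_fun V x * v_fun V x"

definition U_op :: "(r3 \<Rightarrow> real) \<Rightarrow> l2 \<Rightarrow> l2" where
  "U_op V f = to_l2 (\<lambda>x. complex_of_real (U_fun V x) * rep_l2 f x)"

definition v_l2 :: "(r3 \<Rightarrow> real) \<Rightarrow> l2" where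
  "v_l2 V = to_l2 (\<lambda>x. complex_of_real (v_fun V x))"

definition alpha :: "(r3 \<Rightarrow> real) \<Rightarrow> real" where
  "alpha V = (norm (v_l2 V))\<^sup>2"

text \<open>If \<open>V = 0\<close> almost everywhere, then \<open>\<alpha> = 0\<close>, and the convention \<open>1 / 0 = 0\<close> gives \<open>P = 0\<close>.\<close>

definition P_op :: "(r3 \<Rightarrow> real) \<Rightarrow> l2 \<Rightarrow> l2" where
  "P_op V f = (complex_of_real (1 / alpha V) * cinner (v_l2 V) f) *\<^sub>C v_l2 V"

definition Q_op :: "(r3 \<Rightarrow> real) \<Rightarrow> l2 \<Rightarrow> l2" where
  "Q_op V f = f - P_op V f"

text \<open>
  \<open>G\<^sub>0\<close> does not act in the Hilbert space, so it is an integral operator on functions; only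
  \<open>v G\<^sub>0 v\<close> is an operator on the Hilbert space.
\<close>

definition G0 :: "(r3 \<Rightarrow> complex) \<Rightarrow> r3 \<Rightarrow> complex" where
  "G0 f x = (\<integral>y. complex_of_real (- (1 / (8 * pi)) * norm (x - y)) * f y \<partial>lborel)"

definition vG0v_op :: "(r3 \<Rightarrow> real) \<Rightarrow> l2 \<Rightarrow> l2" where
  "vG0v_op V f = to_l2 (\<lambda>x. complex_of_real (v_fun V x) *
     G0 (\<lambda>y. complex_of_real (v_fun V y) * rep_l2 f y) x)"

definition M0_op :: "(r3 \<Rightarrow> real) \<Rightarrow> l2 \<Rightarrow> l2" where
  "M0_op V f = U_op V f + vG0v_op V f"

definition QL2 :: "(r3 \<Rightarrow> real) \<Rightarrow> l2 set" where
  "QL2 V = range (Q_op V)"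

definition m0_op :: "(r3 \<Rightarrow> real) \<Rightarrow> l2 \<Rightarrow> l2" where
  "m0_op V f = Q_op V (M0_op V (Q_op V f))"

definition m0_inv :: "(r3 \<Rightarrow> real) \<Rightarrow> l2 \<Rightarrow> l2" where
  "m0_inv V = inv_into (QL2 V) (m0_op V)"

definition zero_regular :: "(r3 \<Rightarrow> real) \<Rightarrow> bool" where
  "zero_regular V \<longleftrightarrow> bij_betw (m0_op V) (QL2 V) (QL2 V) \<and>
     (\<exists>C. \<forall>f\<in>QL2 V. norm (m0_inv V f) \<le> C * norm f)"

text \<open>\<open>V(x) = O(|x|\<^sup>-\<^sup>\<beta>)\<close> for large \<open>|x|\<close>; as \<open>V\<close> matters only up to null sets, almost everywhere.\<close>

definition decays :: "(r3 \<Rightarrow> real) \<Rightarrow> bool" where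
  "decays V \<longleftrightarrow> (\<exists>\<beta>>0. \<exists>C r. AE x in lborel. norm x \<ge> r \<longrightarrow> \<bar>V x\<bar> \<le> C * norm x powr (- \<beta>))"

text \<open>
  The factors \<open>w\<close> are in general unbounded, so that the product \<open>w A w\<close> of operators is a priori
  only defined on its natural domain. \<open>w A w\<close> is the operator \<open>B\<close> on the whole space if \<open>B\<close> is
  bounded and is the closure of that product; this includes density of the natural domain.
\<close>

definition sandwich_eq :: "(r3 \<Rightarrow> real) \<Rightarrow> l2_graph \<Rightarrow> (l2 \<Rightarrow> l2) \<Rightarrow> bool" where
  "sandwich_eq w A B \<longleftrightarrow> bounded_op B \<and> closure (mult_op w O A O mult_op w) = graph_of B"

end

theory Submission
  imports Defs
begin

text \<open>
  For \<open>\<mu>\<close> in the first quadrant, \<open>((-\<Delta>)\<^sup>2 - \<mu>\<^sup>4)\<^sup>-\<^sup>1\<close> is convolution with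
  \<open>(exp (i \<mu> r) - exp (- \<mu> r)) / (8 \<pi> \<mu>\<^sup>2 r)\<close>, a difference of two Yukawa kernels. That it is a
  fundamental solution follows from Green's formula for a regularised radial variable; that it is the
  inverse follows by testing a homogeneous solution against cut-off convolutions.

  Put \<open>M(\<mu>) = U + v R\<^sub>0(\<mu>\<^sup>4) v\<close>. The second resolvent identity gives
  \<open>w (H - \<mu>\<^sup>4)\<^sup>-\<^sup>1 w = U - M(\<mu>)\<^sup>-\<^sup>1\<close> as soon as \<open>M(\<mu>)\<close> is invertible. Expanding the kernel in \<open>\<mu>\<close>,
  \<open>M(\<mu>) = (c / \<mu>) P + M\<^sub>0 + \<mu> M\<^sub>1 + \<dots>\<close>, where the remainder of order \<open>\<mu>\<^sup>p\<close> is bounded by \<open>|x - y|\<^sup>p\<^sup>+\<^sup>1\<close>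
  and hence by the moments of \<open>v\<close>. Then \<open>M(\<mu>) (Q + \<mu> P) = (c P + M\<^sub>0 Q) + O(\<mu>)\<close>, and its leading
  part is block triangular with diagonal blocks \<open>c\<close> and \<open>m\<^sub>0\<close>, so it is invertible exactly because
  zero is a regular point. A Neumann series inverts the whole operator, expansions to finite order
  are stable under this inversion, and \<open>M(\<mu>)\<^sup>-\<^sup>1 = Q m\<^sub>0\<^sup>-\<^sup>1 Q + O(\<mu>)\<close>.
\<close>

subsection \<open>The Hilbert space\<close>

text \<open>\<open>V\<close> is merely square integrable, hence an unbounded factor, and it is
  controlled without quadratic forms. The rows of the free resolvent kernel have uniformly bounded
  L2 norms, so the free resolvent maps into essentially bounded functions, and multiplying these by
  \<open>V\<close> leads back into L2. Thus (H - \<mu>^4) f = q becomes f = R0 (q - V f), an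
  equation governed by bounded operators. The first quadrant is used twice: both exponentials of the
  kernel decay, and their Taylor remainders are bounded by plain powers, with constants that do not
  depend on \<mu>. The orders are counted as follows. The coefficient of \<mu>^m in the kernel is a
  multiple of |x - y|^(m+1), and so is the bound for the remainder after division by \<mu>^m. A
  remainder \<mu>^p therefore costs p + 1 powers of the weight on each factor v; this moment of v
  follows from \<kappa> > 2p + 5 by the inequality ab \<le> a^2 + b^2. Only the Q block shows in the
  constant term, because the left factor Q + \<mu>P of the inverse delays the P component by one
  power of \<mu>.\<close>

lemma l2_rel_rep: "l2_rel (rep_l2 f) (rep_l2 f)"
  using Quotient3_l2 by (rule Quotient3_rep_reflp)

lemma sq_int_rep [simp, intro]: "sq_int (rep_l2 f)"
  using l2_rel_rep[of f] by (simp add: l2_rel_def)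

lemma abs_rep_l2: "abs_l2 (rep_l2 f) = f"
  using Quotient3_l2 by (rule Quotient3_abs_rep)

lemma abs_l2_eq_iff: "sq_int f \<Longrightarrow> sq_int g \<Longrightarrow> abs_l2 f = abs_l2 g \<longleftrightarrow> (AE x in lborel. f x = g x)"
  using Quotient3_rel[OF Quotient3_l2, of f g] by (auto simp: l2_rel_def)

lemma to_l2_eq_iff: "sq_int f \<Longrightarrow> sq_int g \<Longrightarrow> to_l2 f = to_l2 g \<longleftrightarrow> (AE x in lborel. f x = g x)"
  by (simp add: to_l2_def abs_l2_eq_iff)

lemma to_l2_rep [simp]: "to_l2 (rep_l2 f) = f"
  by (simp add: to_l2_def abs_rep_l2)

lemma rep_to_l2: "sq_int h \<Longrightarrow> AE x in lborel. rep_l2 (to_l2 h) x = h x"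
  by (metis sq_int_rep to_l2_eq_iff to_l2_rep)

lemma l2_eqI: "AE x in lborel. rep_l2 f x = rep_l2 g x \<Longrightarrow> f = g"
  by (metis sq_int_rep to_l2_eq_iff to_l2_rep)

lemma sq_int_measurable: "sq_int f \<Longrightarrow> f \<in> borel_measurable borel"
  by (simp add: sq_int_def)

lemma rep_measurable [measurable, simp]: "rep_l2 f \<in> borel_measurable borel"
  using sq_int_rep by (rule sq_int_measurable)

lemma to_l2_add: "sq_int f \<Longrightarrow> sq_int g \<Longrightarrow> to_l2 (\<lambda>x. f x + g x) = to_l2 f + to_l2 g"
  by (simp add: to_l2_def sq_int_add plus_l2.abs_eq l2_rel_def)

lemma to_l2_diff: "sq_int f \<Longrightarrow> sq_int g \<Longrightarrow> to_l2 (\<lambda>x. f x - g x) = to_l2 f - to_l2 g"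
  by (simp add: to_l2_def sq_int_diff minus_l2.abs_eq l2_rel_def)

lemma to_l2_cscale: "sq_int f \<Longrightarrow> to_l2 (\<lambda>x. c * f x) = c *\<^sub>C to_l2 f"
  by (simp add: to_l2_def sq_int_cmult cscale.abs_eq l2_rel_def)

lemma to_l2_zero: "to_l2 (\<lambda>x. 0) = 0"
  by (simp add: to_l2_def zero_l2_def sq_int_zero)

lemma rep_add: "AE x in lborel. rep_l2 (f + g) x = rep_l2 f x + rep_l2 g x"
  using rep_to_l2[OF sq_int_add[OF sq_int_rep[of f] sq_int_rep[of g]]] by (simp add: to_l2_add)

lemma rep_diff: "AE x in lborel. rep_l2 (f - g) x = rep_l2 f x - rep_l2 g x"
  using rep_to_l2[OF sq_int_diff[OF sq_int_rep[of f] sq_int_rep[of g]]] by (simp add: to_l2_diff)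

lemma rep_cscale: "AE x in lborel. rep_l2 (c *\<^sub>C f) x = c * rep_l2 f x"
  using rep_to_l2[OF sq_int_cmult[OF sq_int_rep[of f], of c]] by (simp add: to_l2_cscale)

lemma rep_zero: "AE x in lborel. rep_l2 0 x = 0"
  using rep_to_l2[OF sq_int_zero] by (simp add: to_l2_zero)

lemma cinner_to_l2:
  assumes "sq_int f" "sq_int g"
  shows "cinner (to_l2 f) (to_l2 g) = (\<integral>x. cnj (f x) * g x \<partial>lborel)"
  using assms by (simp add: to_l2_def cinner.abs_eq l2_rel_def)

lemma norm_to_l2:
  assumes "sq_int f"
  shows "(norm (to_l2 f))\<^sup>2 = (\<integral>x. (norm (f x))\<^sup>2 \<partial>lborel)"
proof -
  have eq: "cnj (f x) * f x = complex_of_real ((norm (f x))\<^sup>2)" for x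
    by (metis complex_norm_square mult.commute)
  have "(norm (to_l2 f))\<^sup>2 = Re (cinner (to_l2 f) (to_l2 f))"
    using inner_self_l2[of "to_l2 f"] by (simp add: norm_l2_def inner_l2_def)
  also have "\<dots> = (\<integral>x. (norm (f x))\<^sup>2 \<partial>lborel)"
    unfolding cinner_to_l2[OF assms assms] eq by (simp del: of_real_power)
  finally show ?thesis .
qed

lemma nn_norm_to_l2:
  assumes "sq_int f"
  shows "(\<integral>\<^sup>+x. ennreal ((norm (f x))\<^sup>2) \<partial>lborel) = ennreal ((norm (to_l2 f))\<^sup>2)"
  using assms unfolding norm_to_l2[OF assms]
  by (intro nn_integral_eq_integral) (auto simp: sq_int_def)

lemma sq_intI:
  assumes [measurable]: "f \<in> borel_measurable borel"
    and "(\<integral>\<^sup>+x. ennreal ((norm (f x))\<^sup>2) \<partial>lborel) < \<infinity>"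
  shows "sq_int f"
  unfolding sq_int_def
proof (intro conjI integrableI_bounded)
  show "(\<lambda>x. (norm (f x))\<^sup>2) \<in> borel_measurable lborel" by measurable
qed (use assms in auto)

lemma sq_int_bound:
  assumes "sq_int g" and [measurable]: "f \<in> borel_measurable borel"
    and "AE x in lborel. norm (f x) \<le> norm (g x)"
  shows "sq_int f"
proof -
  have "integrable lborel (\<lambda>x. (norm (f x))\<^sup>2)"
  proof (rule Bochner_Integration.integrable_bound)
    show "integrable lborel (\<lambda>x. (norm (g x))\<^sup>2)"
      using assms by (simp add: sq_int_def)
    show "AE x in lborel. norm ((norm (f x))\<^sup>2) \<le> norm ((norm (g x))\<^sup>2)"
      using assms(3) by eventually_elim (simp add: power_mono)
  qed measurable
  then show ?thesis by (simp add: sq_int_def)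
qed

lemma norm_to_l2_le:
  assumes "sq_int f" "(\<integral>\<^sup>+x. ennreal ((norm (f x))\<^sup>2) \<partial>lborel) \<le> ennreal (B\<^sup>2)" "0 \<le> B"
  shows "norm (to_l2 f) \<le> B"
  using assms(2,3) unfolding nn_norm_to_l2[OF assms(1)]
  by (simp add: ennreal_le_iff power_mono_iff)

lemma cscale_add_right: "c *\<^sub>C (f + g) = c *\<^sub>C f + c *\<^sub>C g"
  by transfer (auto simp: l2_rel_def distrib_left intro!: sq_int_add sq_int_cmult)

lemma cscale_diff_right: "c *\<^sub>C (f - g) = c *\<^sub>C f - c *\<^sub>C g"
  by transfer (auto simp: l2_rel_def right_diff_distrib intro!: sq_int_diff sq_int_cmult)

lemma cscale_add_left: "(c + d) *\<^sub>C f = c *\<^sub>C f + d *\<^sub>C f"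
  by transfer (auto simp: l2_rel_def distrib_right intro!: sq_int_add sq_int_cmult)

lemma cscale_cscale [simp]: "c *\<^sub>C d *\<^sub>C f = (c * d) *\<^sub>C f"
  by transfer (auto simp: l2_rel_def mult.assoc intro!: sq_int_cmult)

lemma cscale_one [simp]: "1 *\<^sub>C f = f"
  by transfer (auto simp: l2_rel_def)

lemma cscale_zero_left [simp]: "0 *\<^sub>C f = 0"
  by transfer (auto simp: l2_rel_def sq_int_zero)

lemma cscale_zero_right [simp]: "c *\<^sub>C 0 = 0"
  using cscale_diff_right[of c 0 0] by simp

lemma norm_cscale: "norm (c *\<^sub>C f) = norm c * norm f"
proof -
  have "(norm (c *\<^sub>C f))\<^sup>2 = (norm c * norm f)\<^sup>2"
    using norm_to_l2[OF sq_int_cmult[OF sq_int_rep], of c f] norm_to_l2[OF sq_int_rep, of f]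
    by (simp add: to_l2_cscale norm_mult power_mult_distrib)
  then show ?thesis by (simp add: power2_eq_iff_nonneg)
qed

lemma cinner_add_right: "cinner h (f + g) = cinner h f + cinner h g"
  by (metis cinner_add_left cinner_commute complex_cnj_add)

lemma cinner_scale_right: "cinner g (c *\<^sub>C f) = c * cinner g f"
  by (metis cinner_commute cinner_scale_left complex_cnj_cnj complex_cnj_mult)

lemma cinner_self: "cinner f f = complex_of_real ((norm f)\<^sup>2)"
proof (rule complex_eqI)
  show "Re (cinner f f) = Re (complex_of_real ((norm f)\<^sup>2))"
    using inner_self_l2[of f] by (simp add: norm_l2_def inner_l2_def)
  show "Im (cinner f f) = Im (complex_of_real ((norm f)\<^sup>2))"
    using arg_cong[OF cinner_commute[of f f], of Im] by simp
qed

lemma norm_cinner_le: "norm (cinner f g) \<le> norm f * norm g"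
proof (cases "cinner f g = 0")
  case False
  \<comment> \<open>Rotating \<open>g\<close> by this phase makes the inner product real and
    nonnegative, so the Cauchy-Schwarz inequality for the real form \<open>inner\<close> bounds its
    full modulus.\<close>
  define s where "s = cnj (sgn (cinner f g))"
  have s1: "norm s = 1" using False by (simp add: s_def norm_sgn)
  have "cnj (cinner f g) * cinner f g = complex_of_real ((norm (cinner f g))\<^sup>2)"
    by (metis complex_norm_square mult.commute)
  then have "cinner f (s *\<^sub>C g) = complex_of_real (norm (cinner f g))"
    using False unfolding s_def cinner_scale_right sgn_eq
    by (simp add: power2_eq_square)
  then have "norm (cinner f g) = inner f (s *\<^sub>C g)"
    by (simp add: inner_l2_def)
  also have "\<dots> \<le> norm f * norm (s *\<^sub>C g)"
    by (rule norm_cauchy_schwarz)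
  finally show ?thesis by (simp add: norm_cscale s1)
qed auto

lemma bounded_opI:
  assumes "\<And>f g. T (f + g) = T f + T g" "\<And>c f. T (c *\<^sub>C f) = c *\<^sub>C T f"
    "\<And>f. norm (T f) \<le> K * norm f"
  shows "bounded_op T"
  unfolding bounded_op_def
  by (intro conjI bounded_linear_intro[where K=K])
    (use assms in \<open>auto simp: scaleR_l2_def mult.commute\<close>)

lemma bounded_op_linear: "bounded_op T \<Longrightarrow> bounded_linear T"
  by (simp add: bounded_op_def)

lemma bounded_op_add: "bounded_op T \<Longrightarrow> T (f + g) = T f + T g"
  by (simp add: bounded_op_def linear_simps)

lemma bounded_op_diff: "bounded_op T \<Longrightarrow> T (f - g) = T f - T g"
  by (simp add: bounded_op_def linear_simps)

lemma bounded_op_cscale: "bounded_op T \<Longrightarrow> T (c *\<^sub>C f) = c *\<^sub>C T f"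
  by (simp add: bounded_op_def)

lemma bounded_op_norm: "bounded_op T \<Longrightarrow> norm (T f) \<le> onorm T * norm f"
  by (simp add: bounded_op_def onorm)

lemma bounded_op_id: "bounded_op (\<lambda>f. f)"
  by (rule bounded_opI[where K=1]) auto

lemma bounded_op_const_zero: "bounded_op (\<lambda>f. 0)"
  by (rule bounded_opI[where K=0]) auto

lemma bounded_op_plus: "bounded_op S \<Longrightarrow> bounded_op T \<Longrightarrow> bounded_op (\<lambda>f. S f + T f)"
  by (simp add: bounded_op_def bounded_linear_add cscale_add_right)

lemma bounded_op_minus: "bounded_op S \<Longrightarrow> bounded_op T \<Longrightarrow> bounded_op (\<lambda>f. S f - T f)"
  by (simp add: bounded_op_def bounded_linear_sub cscale_diff_right)

lemma bounded_op_comp: "bounded_op S \<Longrightarrow> bounded_op T \<Longrightarrow> bounded_op (\<lambda>f. S (T f))"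
  by (simp add: bounded_op_def bounded_linear_compose)

lemma bounded_op_scale:
  assumes "bounded_op T" shows "bounded_op (\<lambda>f. c *\<^sub>C T f)"
proof (rule bounded_opI[where K="norm c * onorm T"])
  show "norm (c *\<^sub>C T f) \<le> norm c * onorm T * norm f" for f
    using bounded_op_norm[OF assms, of f] by (simp add: norm_cscale mult_left_mono mult.assoc)
qed (use assms in \<open>auto simp: bounded_op_add bounded_op_cscale cscale_add_right mult.commute\<close>)

lemma onorm_cscale_le: "bounded_op T \<Longrightarrow> onorm (\<lambda>f. c *\<^sub>C T f) \<le> norm c * onorm T"
  by (intro onorm_bound)
    (auto simp: norm_cscale mult_left_mono mult.assoc bounded_op_norm onorm_pos_le bounded_op_linear)

section \<open>Completeness of the Hilbert space (Riesz-Fischer)\<close>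

lemma summable_geometric_sqrt:
  fixes d :: "nat \<Rightarrow> real"
  assumes "\<And>n. 0 \<le> d n" "summable (\<lambda>n. 4 ^ n * (d n)\<^sup>2)"
  shows "summable d"
proof -
  obtain C where C: "\<And>n. 4 ^ n * (d n)\<^sup>2 \<le> C"
  proof -
    have "Bseq (\<lambda>n. 4 ^ n * (d n)\<^sup>2)"
      using assms(2) summable_LIMSEQ_zero convergent_def convergent_imp_Bseq by blast
    then obtain C where "\<forall>n. norm (4 ^ n * (d n)\<^sup>2) \<le> C" unfolding Bseq_def by auto
    then show ?thesis using that[of C] by (auto simp: abs_le_iff)
  qed
  have "d n \<le> sqrt C * (1/2) ^ n" for n
  proof -
    have "(2 ^ n * d n)\<^sup>2 \<le> C"
      using C[of n] power_mult[of "2::real" n 2] power_mult[of "2::real" 2 n]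
      by (simp add: power_mult_distrib mult.commute)
    then have "2 ^ n * d n \<le> sqrt C" by (rule real_le_rsqrt)
    then show ?thesis by (simp add: field_simps power_divide)
  qed
  moreover have "summable (\<lambda>n. sqrt C * (1/2) ^ n)"
    by (intro summable_mult summable_geometric) simp
  ultimately show ?thesis
    using assms(1) by (intro summable_comparison_test'[of "\<lambda>n. sqrt C * (1/2) ^ n" 0 d]) auto
qed

text \<open>The increments d_n have squared norms at most 16^(-n). Even after multiplication by 4^n
  their squares sum to an integrable function, so almost everywhere d_n decays like 2^(-n) and the
  representatives converge pointwise. Fatou's lemma carries the rate over to the limit.\<close>

lemma fast_cauchy_l2_limit:
  assumes fast: "\<And>n m. m \<ge> n \<Longrightarrow> norm (X m - X n) \<le> (1/4) ^ n"
  shows "\<exists>L :: l2. \<forall>n. norm (X n - L) \<le> (1/4) ^ n"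
proof -
  define F where "F n = rep_l2 (X n)" for n
  have [measurable]: "F n \<in> borel_measurable borel" for n by (simp add: F_def)
  have diff: "(\<integral>\<^sup>+x. ennreal ((norm (F m x - F n x))\<^sup>2) \<partial>lborel) \<le> ennreal (((1/4) ^ n)\<^sup>2)"
    if "m \<ge> n" for m n
  proof -
    have "(\<integral>\<^sup>+x. ennreal ((norm (F m x - F n x))\<^sup>2) \<partial>lborel) = ennreal ((norm (X m - X n))\<^sup>2)"
      using nn_norm_to_l2[OF sq_int_diff[OF sq_int_rep[of "X m"] sq_int_rep[of "X n"]]]
      by (simp add: F_def to_l2_diff)
    then show ?thesis using fast[OF that] by (simp add: ennreal_leI power_mono)
  qed
  define d where "d n x = norm (F (Suc n) x - F n x)" for n x
  have [measurable]: "d n \<in> borel_measurable borel" for n unfolding d_def by measurable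
  have "(\<integral>\<^sup>+x. (\<Sum>n. ennreal (4 ^ n * (d n x)\<^sup>2)) \<partial>lborel)
      = (\<Sum>n. \<integral>\<^sup>+x. ennreal (4 ^ n * (d n x)\<^sup>2) \<partial>lborel)"
    by (intro nn_integral_suminf) measurable
  also have "\<dots> \<le> (\<Sum>n. ennreal ((1/4) ^ n))"
  proof (rule suminf_le)
    show "(\<integral>\<^sup>+x. ennreal (4 ^ n * (d n x)\<^sup>2) \<partial>lborel) \<le> ennreal ((1/4) ^ n)" for n
    proof -
      have "(\<integral>\<^sup>+x. ennreal (4 ^ n * (d n x)\<^sup>2) \<partial>lborel)
          = ennreal (4 ^ n) * (\<integral>\<^sup>+x. ennreal ((d n x)\<^sup>2) \<partial>lborel)"
        by (simp add: ennreal_mult nn_integral_cmult)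
      also have "\<dots> \<le> ennreal (4 ^ n) * ennreal (((1/4) ^ n)\<^sup>2)"
        using diff[of n "Suc n"] by (intro mult_left_mono) (auto simp: d_def)
      also have "\<dots> = ennreal ((1/4) ^ n)"
        by (simp add: ennreal_mult[symmetric] power2_eq_square field_simps power_divide)
      finally show ?thesis .
    qed
  qed auto
  also have "\<dots> = ennreal (\<Sum>n. (1/4::real) ^ n)"
    by (intro suminf_ennreal2) auto
  finally have "(\<integral>\<^sup>+x. (\<Sum>n. ennreal (4 ^ n * (d n x)\<^sup>2)) \<partial>lborel) < \<infinity>"
    by (simp add: order.strict_trans1)
  then have "AE x in lborel. (\<Sum>n. ennreal (4 ^ n * (d n x)\<^sup>2)) \<noteq> \<infinity>"
    by (intro nn_integral_noteq_infinite) auto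
  then have conv: "AE x in lborel. convergent (\<lambda>n. F n x)"
  proof eventually_elim
    case (elim x)
    then have "summable (\<lambda>n. 4 ^ n * (d n x)\<^sup>2)"
      by (intro summable_suminf_not_top) simp_all
    then have "summable (\<lambda>n. d n x)"
      by (rule summable_geometric_sqrt[rotated]) (simp add: d_def)
    then have "summable (\<lambda>n. F (Suc n) x - F n x)"
      unfolding d_def by (rule summable_norm_cancel)
    then show ?case
      using summable_iff_convergent[of "\<lambda>n. F (Suc n) x - F n x"]
        convergent_diff_const_right_iff[of "\<lambda>n. F n x" "F 0 x"]
      by (simp add: sum_lessThan_telescope[of "\<lambda>i. F i x"])
  qed
  define G where "G x = lim (\<lambda>n. F n x)" for x
  have [measurable]: "G \<in> borel_measurable borel"
    unfolding G_def by measurable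
  have lim: "AE x in lborel. (\<lambda>n. F n x) \<longlonglongrightarrow> G x"
    using conv by eventually_elim (simp add: G_def convergent_LIMSEQ_iff)
  have G: "(\<integral>\<^sup>+x. ennreal ((norm (G x - F n x))\<^sup>2) \<partial>lborel) \<le> ennreal (((1/4) ^ n)\<^sup>2)" for n
  proof -
    have "(\<integral>\<^sup>+x. ennreal ((norm (G x - F n x))\<^sup>2) \<partial>lborel)
        = (\<integral>\<^sup>+x. liminf (\<lambda>m. ennreal ((norm (F m x - F n x))\<^sup>2)) \<partial>lborel)"
      using lim
      by (intro nn_integral_cong_AE, eventually_elim)
        (intro lim_imp_Liminf[symmetric] tendsto_intros sequentially_bot, auto)
    also have "\<dots> \<le> liminf (\<lambda>m. \<integral>\<^sup>+x. ennreal ((norm (F m x - F n x))\<^sup>2) \<partial>lborel)"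
      by (intro nn_integral_liminf) measurable
    also have "\<dots> \<le> ennreal (((1/4) ^ n)\<^sup>2)"
      by (intro Liminf_le) (auto intro!: eventually_sequentiallyI[of n] diff)
    finally show ?thesis .
  qed
  have sqd: "sq_int (\<lambda>x. G x - F n x)" for n
    using G[of n] by (intro sq_intI) (auto simp: order.strict_trans1)
  have "sq_int G"
    using sq_int_add[OF sqd[of 0] sq_int_rep[of "X 0"]] by (simp add: F_def)
  have "norm (X n - to_l2 G) \<le> (1/4) ^ n" for n
    using norm_to_l2_le[OF sqd[of n] G[of n]] to_l2_diff[OF \<open>sq_int G\<close> sq_int_rep[of "X n"]]
    by (simp add: F_def norm_minus_commute)
  then show ?thesis by blast
qed

instance l2 :: complete_space
proof
  fix X :: "nat \<Rightarrow> l2"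
  assume "Cauchy X"
  then have "\<exists>M. \<forall>m\<ge>M. \<forall>n\<ge>M. norm (X m - X n) < (1/4) ^ k" for k
    unfolding Cauchy_def dist_norm by simp
  then obtain N where N: "\<And>k m n. m \<ge> N k \<Longrightarrow> n \<ge> N k \<Longrightarrow> norm (X m - X n) < (1/4) ^ k"
    by metis
  \<comment> \<open>The running maximum makes the chosen indices monotone while keeping them above
    \<open>N k\<close>.\<close>
  define r where "r k = Max (N ` {..k})" for k
  have rN: "N k \<le> r k" for k by (auto simp: r_def)
  have rmono: "r k \<le> r m" if "k \<le> m" for k m
    unfolding r_def using that by (intro Max_mono) auto
  have "norm (X (r m) - X (r k)) \<le> (1/4) ^ k" if "m \<ge> k" for m k
    using N[of k "r m" "r k"] rN[of k] rmono[OF that] by linarith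
  then obtain L where L: "\<And>n. norm (X (r n) - L) \<le> (1/4) ^ n"
    using fast_cauchy_l2_limit[of "\<lambda>k. X (r k)"] by blast
  have "X \<longlonglongrightarrow> L"
  proof (rule LIMSEQ_I)
    fix e :: real assume "e > 0"
    obtain k where k: "(1/4) ^ k < e / 2"
      using real_arch_pow_inv[of "e/2" "1/4"] \<open>e > 0\<close> by auto
    have "norm (X n - L) < e" if "n \<ge> r k" for n
    proof -
      have "norm (X n - L) \<le> norm (X n - X (r k)) + norm (X (r k) - L)"
        by (rule norm_diff_triangle_le) auto
      then show ?thesis using N[of k n "r k"] L[of k] that rN[of k] k by linarith
    qed
    then show "\<exists>no. \<forall>n\<ge>no. norm (X n - L) < e" by blast
  qed
  then show "convergent X" by (auto simp: convergent_def)
qed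

section \<open>Bounded inverses\<close>

lemma bounded_op_inverse:
  assumes "bounded_op T" and eq: "\<And>f. T (S f) = f" and inj: "\<And>f. T f = 0 \<Longrightarrow> f = 0"
    and "\<And>f. norm (S f) \<le> K * norm f"
  shows "bounded_op S"
proof -
  have inj': "f = g" if "T f = T g" for f g
    using inj[of "f - g"] that by (simp add: bounded_op_diff[OF assms(1)])
  show ?thesis
  proof (rule bounded_opI[where K=K])
    show "S (f + g) = S f + S g" for f g
      by (rule inj') (simp add: eq bounded_op_add[OF assms(1)])
    show "S (c *\<^sub>C f) = c *\<^sub>C S f" for c f
      by (rule inj') (simp add: eq bounded_op_cscale[OF assms(1)])
  qed (rule assms)
qed

text \<open>The fixed point of the contraction f -> g - A f replaces the geometric series;
  completeness enters here. The bound 2 is the reciprocal of 1 - 1/2.\<close>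

lemma neumann:
  assumes A: "bounded_op A" and "onorm A \<le> 1/2"
  obtains S where "bounded_op S" "onorm S \<le> 2" "\<And>f. S f + A (S f) = f" "\<And>f. S (f + A f) = f"
proof -
  have half: "norm (A f) \<le> 1/2 * norm f" for f
    using bounded_op_norm[OF A, of f] mult_right_mono[OF assms(2), of "norm f"] by simp
  have lip: "dist (g - A f) (g - A h) \<le> 1/2 * dist f h" for f g h
    using half[of "f - h"] by (simp add: dist_norm norm_minus_commute bounded_op_diff[OF A])
  have "\<exists>!f. g - A f = f" for g
    by (rule banach_fix_type[of "1/2"]) (use lip in auto)
  then obtain S where S: "\<And>g. g - A (S g) = S g" by metis
  then have S': "S f + A (S f) = f" for f by (metis diff_add_cancel)
  have inv_bound: "norm f \<le> 2 * norm (f + A f)" for f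
    using norm_diff_ineq[of f "A f"] half[of f] by simp
  have inj: "f = 0" if "f + A f = 0" for f
    using inv_bound[of f] that by simp
  have S'_bound: "norm (S f) \<le> 2 * norm f" for f
    using inv_bound[of "S f"] by (simp add: S')
  have "bounded_op (\<lambda>f. f + A f)" by (intro bounded_op_plus bounded_op_id A)
  then have "bounded_op S"
    by (rule bounded_op_inverse[where K=2]) (auto simp: S' S'_bound dest: inj)
  moreover have "onorm S \<le> 2"
    by (intro onorm_bound) (auto simp: S'_bound)
  moreover have "S (f + A f) = f" for f
  proof -
    let ?d = "S (f + A f) - f"
    have "?d + A ?d = 0" using S'[of "f + A f"] by (simp add: bounded_op_diff[OF A] algebra_simps)
    then show ?thesis using inv_bound[of ?d] by simp
  qed
  ultimately show ?thesis using that S' by blast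
qed

subsection \<open>Kernel operators\<close>

text \<open>The estimate concerns |K| acting on nonnegative functions and is stronger than
  boundedness of the operator. It yields absolute convergence of the defining integral almost
  everywhere and the integrability that Fubini requires in \<open>kernel_duality\<close>.\<close>

definition kernel_bounded :: "(r3 \<Rightarrow> r3 \<Rightarrow> complex) \<Rightarrow> real \<Rightarrow> bool" where
  "kernel_bounded K C \<longleftrightarrow> 0 \<le> C \<and> case_prod K \<in> borel_measurable (lborel \<Otimes>\<^sub>M lborel) \<and>
     (\<forall>f \<in> borel_measurable lborel.
        (\<integral>\<^sup>+x. (\<integral>\<^sup>+y. ennreal (norm (K x y)) * f y \<partial>lborel)\<^sup>2 \<partial>lborel)
          \<le> ennreal (C\<^sup>2) * (\<integral>\<^sup>+y. (f y)\<^sup>2 \<partial>lborel))"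

definition kernel_op :: "(r3 \<Rightarrow> r3 \<Rightarrow> complex) \<Rightarrow> l2 \<Rightarrow> l2" where
  "kernel_op K f = to_l2 (\<lambda>x. \<integral>y. K x y * rep_l2 f y \<partial>lborel)"

text \<open>Cauchy-Schwarz in \<open>y\<close> splits |K| f into a and b f, and Tonelli then
  integrates b^2 over \<open>x\<close> first. With a = b = sqrt |K| this is the classical Schur
  test; with \<open>a\<close> a function of \<open>y\<close> alone and \<open>b\<close> a function
  of \<open>x\<close> alone it covers kernels dominated by a product of two square integrable
  weights. Both uses occur below.\<close>

lemma schur_test:
  fixes a b :: "r3 \<Rightarrow> r3 \<Rightarrow> real"
  assumes "case_prod K \<in> borel_measurable (lborel \<Otimes>\<^sub>M lborel)"
    and a: "case_prod a \<in> borel_measurable (lborel \<Otimes>\<^sub>M lborel)"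
    and b: "case_prod b \<in> borel_measurable (lborel \<Otimes>\<^sub>M lborel)"
    and nonneg: "\<And>x y. 0 \<le> a x y" "\<And>x y. 0 \<le> b x y" "0 \<le> A" "0 \<le> B"
    and K: "\<And>x y. norm (K x y) \<le> a x y * b x y"
    and A: "\<And>x. (\<integral>\<^sup>+y. ennreal ((a x y)\<^sup>2) \<partial>lborel) \<le> ennreal (A\<^sup>2)"
    and B: "\<And>y. (\<integral>\<^sup>+x. ennreal ((b x y)\<^sup>2) \<partial>lborel) \<le> ennreal (B\<^sup>2)"
  shows "kernel_bounded K (A * B)"
  unfolding kernel_bounded_def
proof (intro conjI ballI)
  fix f :: "r3 \<Rightarrow> ennreal" assume [measurable]: "f \<in> borel_measurable lborel"
  note [measurable] = a b
  have 1: "(\<integral>\<^sup>+y. ennreal (norm (K x y)) * f y \<partial>lborel)\<^sup>2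
      \<le> ennreal (A\<^sup>2) * (\<integral>\<^sup>+y. ennreal ((b x y)\<^sup>2) * (f y)\<^sup>2 \<partial>lborel)" for x
  proof -
    have "(\<integral>\<^sup>+y. ennreal (norm (K x y)) * f y \<partial>lborel)
        \<le> (\<integral>\<^sup>+y. ennreal (a x y) * (ennreal (b x y) * f y) \<partial>lborel)"
    proof (rule nn_integral_mono)
      show "ennreal (norm (K x y)) * f y \<le> ennreal (a x y) * (ennreal (b x y) * f y)" for y
        using mult_right_mono[OF ennreal_leI[OF K[of x y]], of "f y"]
        by (simp add: ennreal_mult nonneg mult.assoc)
    qed
    then have "(\<integral>\<^sup>+y. ennreal (norm (K x y)) * f y \<partial>lborel)\<^sup>2
        \<le> (\<integral>\<^sup>+y. ennreal (a x y) * (ennreal (b x y) * f y) \<partial>lborel)\<^sup>2"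
      by (intro power_mono) auto
    also have "\<dots> \<le> (\<integral>\<^sup>+y. (ennreal (a x y))\<^sup>2 \<partial>lborel) * (\<integral>\<^sup>+y. (ennreal (b x y) * f y)\<^sup>2 \<partial>lborel)"
      by (rule Cauchy_Schwarz_nn_integral) measurable
    also have "\<dots> \<le> ennreal (A\<^sup>2) * (\<integral>\<^sup>+y. ennreal ((b x y)\<^sup>2) * (f y)\<^sup>2 \<partial>lborel)"
      using A[of x] by (intro mult_mono) (simp_all add: power_mult_distrib ennreal_power nonneg)
    finally show ?thesis .
  qed
  have "(\<integral>\<^sup>+x. (\<integral>\<^sup>+y. ennreal (norm (K x y)) * f y \<partial>lborel)\<^sup>2 \<partial>lborel)
      \<le> (\<integral>\<^sup>+x. ennreal (A\<^sup>2) * (\<integral>\<^sup>+y. ennreal ((b x y)\<^sup>2) * (f y)\<^sup>2 \<partial>lborel) \<partial>lborel)"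
    by (intro nn_integral_mono 1)
  also have "\<dots> = ennreal (A\<^sup>2) * (\<integral>\<^sup>+x. (\<integral>\<^sup>+y. ennreal ((b x y)\<^sup>2) * (f y)\<^sup>2 \<partial>lborel) \<partial>lborel)"
    by (intro nn_integral_cmult) measurable
  also have "(\<integral>\<^sup>+x. (\<integral>\<^sup>+y. ennreal ((b x y)\<^sup>2) * (f y)\<^sup>2 \<partial>lborel) \<partial>lborel)
      = (\<integral>\<^sup>+y. (\<integral>\<^sup>+x. ennreal ((b x y)\<^sup>2) * (f y)\<^sup>2 \<partial>lborel) \<partial>lborel)"
    by (rule lborel_pair.Fubini'[symmetric]) measurable
  also have "\<dots> = (\<integral>\<^sup>+y. (\<integral>\<^sup>+x. ennreal ((b x y)\<^sup>2) \<partial>lborel) * (f y)\<^sup>2 \<partial>lborel)"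
    by (intro nn_integral_cong nn_integral_multc) measurable
  also have "\<dots> \<le> (\<integral>\<^sup>+y. ennreal (B\<^sup>2) * (f y)\<^sup>2 \<partial>lborel)"
    by (intro nn_integral_mono mult_right_mono B) auto
  also have "\<dots> = ennreal (B\<^sup>2) * (\<integral>\<^sup>+y. (f y)\<^sup>2 \<partial>lborel)"
    by (intro nn_integral_cmult) measurable
  finally have "(\<integral>\<^sup>+x. (\<integral>\<^sup>+y. ennreal (norm (K x y)) * f y \<partial>lborel)\<^sup>2 \<partial>lborel)
      \<le> ennreal (A\<^sup>2) * (ennreal (B\<^sup>2) * (\<integral>\<^sup>+y. (f y)\<^sup>2 \<partial>lborel))"
    by (simp add: mult_left_mono)
  then show "(\<integral>\<^sup>+x. (\<integral>\<^sup>+y. ennreal (norm (K x y)) * f y \<partial>lborel)\<^sup>2 \<partial>lborel)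
      \<le> ennreal ((A * B)\<^sup>2) * (\<integral>\<^sup>+y. (f y)\<^sup>2 \<partial>lborel)"
    by (simp add: power_mult_distrib ennreal_mult mult.assoc)
qed (use assms in auto)

context
  fixes K C
  assumes KC: "kernel_bounded K C"
begin

lemma kernel_measurable: "case_prod K \<in> borel_measurable (lborel \<Otimes>\<^sub>M lborel)"
  using KC by (simp add: kernel_bounded_def)

lemma kernel_abs_bound:
  assumes "sq_int f"
  shows "(\<integral>\<^sup>+x. (\<integral>\<^sup>+y. ennreal (norm (K x y * f y)) \<partial>lborel)\<^sup>2 \<partial>lborel)
    \<le> ennreal ((C * norm (to_l2 f))\<^sup>2)"
proof -
  have [measurable]: "f \<in> borel_measurable lborel" using sq_int_measurable[OF assms] by simp
  have "(\<integral>\<^sup>+x. (\<integral>\<^sup>+y. ennreal (norm (K x y)) * ennreal (norm (f y)) \<partial>lborel)\<^sup>2 \<partial>lborel)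
          \<le> ennreal (C\<^sup>2) * (\<integral>\<^sup>+y. (ennreal (norm (f y)))\<^sup>2 \<partial>lborel)"
    using KC by (auto simp: kernel_bounded_def)
  also have "\<dots> = ennreal ((C * norm (to_l2 f))\<^sup>2)"
    by (simp add: ennreal_power nn_norm_to_l2 assms power_mult_distrib ennreal_mult)
  finally show ?thesis by (simp add: norm_mult ennreal_mult)
qed

lemma kernel_abs_finite:
  assumes "sq_int f"
  shows "AE x in lborel. (\<integral>\<^sup>+y. ennreal (norm (K x y * f y)) \<partial>lborel) < \<infinity>"
proof -
  note [measurable] = kernel_measurable
  have [measurable]: "f \<in> borel_measurable lborel" using sq_int_measurable[OF assms] by simp
  have "AE x in lborel. (\<integral>\<^sup>+y. ennreal (norm (K x y * f y)) \<partial>lborel)\<^sup>2 \<noteq> \<infinity>"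
    using kernel_abs_bound[OF assms]
    by (intro nn_integral_noteq_infinite) (auto simp: top_unique)
  then show ?thesis
    by eventually_elim (auto simp: power2_eq_square less_top ennreal_mult_eq_top_iff)
qed

lemma kernel_integrable:
  assumes "sq_int f"
  shows "AE x in lborel. integrable lborel (\<lambda>y. K x y * f y)"
proof -
  note [measurable] = kernel_measurable
  have [measurable]: "f \<in> borel_measurable lborel" using sq_int_measurable[OF assms] by simp
  show ?thesis
    using kernel_abs_finite[OF assms] by eventually_elim (auto intro!: integrableI_bounded)
qed

lemma kernel_fun_bound:
  assumes "sq_int f"
  shows "(\<integral>\<^sup>+x. ennreal ((norm (\<integral>y. K x y * f y \<partial>lborel))\<^sup>2) \<partial>lborel)
    \<le> ennreal ((C * norm (to_l2 f))\<^sup>2)"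
proof -
  \<comment> \<open>For a non-integrable \<open>h\<close> the Bochner integral has the default value
    0, so the inequality survives.\<close>
  have nb: "ennreal (norm (\<integral>y. h y \<partial>lborel)) \<le> (\<integral>\<^sup>+y. ennreal (norm (h y)) \<partial>lborel)" for h :: "r3 \<Rightarrow> complex"
    by (cases "integrable lborel h") (auto simp: integral_norm_bound_ennreal not_integrable_integral_eq)
  have "(\<integral>\<^sup>+x. ennreal ((norm (\<integral>y. K x y * f y \<partial>lborel))\<^sup>2) \<partial>lborel)
      \<le> (\<integral>\<^sup>+x. (\<integral>\<^sup>+y. ennreal (norm (K x y * f y)) \<partial>lborel)\<^sup>2 \<partial>lborel)"
    by (intro nn_integral_mono)
      (simp add: ennreal_power[symmetric] power_mono nb)
  also note kernel_abs_bound[OF assms]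
  finally show ?thesis .
qed

lemma kernel_fun_measurable:
  assumes "f \<in> borel_measurable borel"
  shows "(\<lambda>x. \<integral>y. K x y * f y \<partial>lborel) \<in> borel_measurable borel"
proof -
  note [measurable] = kernel_measurable
  have [measurable]: "f \<in> borel_measurable lborel" using assms by simp
  have "(\<lambda>x. \<integral>y. K x y * f y \<partial>lborel) \<in> borel_measurable lborel" by measurable
  then show ?thesis by simp
qed

lemma kernel_fun_sq_int: "sq_int f \<Longrightarrow> sq_int (\<lambda>x. \<integral>y. K x y * f y \<partial>lborel)"
  using kernel_fun_bound[of f]
  by (intro sq_intI kernel_fun_measurable) (auto simp: sq_int_measurable order.strict_trans1)

lemma kernel_op_to_l2: "sq_int f \<Longrightarrow> kernel_op K (to_l2 f) = to_l2 (\<lambda>x. \<integral>y. K x y * f y \<partial>lborel)"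
proof -
  assume f: "sq_int f"
  have "(\<integral>y. K x y * rep_l2 (to_l2 f) y \<partial>lborel) = (\<integral>y. K x y * f y \<partial>lborel)" for x
  proof (rule integral_cong_AE)
    note [measurable] = kernel_measurable
  have [measurable]: "f \<in> borel_measurable lborel" using sq_int_measurable[OF f] by simp
    have [measurable]: "rep_l2 g \<in> borel_measurable lborel" for g by simp
    show "(\<lambda>y. K x y * f y) \<in> borel_measurable lborel" by measurable
    show "(\<lambda>y. K x y * rep_l2 (to_l2 f) y) \<in> borel_measurable lborel" by measurable
    show "AE y in lborel. K x y * rep_l2 (to_l2 f) y = K x y * f y"
      using rep_to_l2[OF f] by eventually_elim simp
  qed
  then show ?thesis by (simp add: kernel_op_def)
qed

lemma rep_kernel_op: "AE x in lborel. rep_l2 (kernel_op K f) x = (\<integral>y. K x y * rep_l2 f y \<partial>lborel)"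
  unfolding kernel_op_def by (intro rep_to_l2 kernel_fun_sq_int) simp

lemma norm_kernel_op: "norm (kernel_op K f) \<le> C * norm f"
  unfolding kernel_op_def
  using KC kernel_fun_bound[OF sq_int_rep[of f]]
  by (intro norm_to_l2_le kernel_fun_sq_int) (auto simp: kernel_bounded_def)

lemma bounded_op_kernel: "bounded_op (kernel_op K)"
proof (rule bounded_opI[where K=C])
  show "kernel_op K (f + g) = kernel_op K f + kernel_op K g" for f g
  proof -
    have "kernel_op K (f + g) = to_l2 (\<lambda>x. \<integral>y. K x y * (rep_l2 f y + rep_l2 g y) \<partial>lborel)"
      using kernel_op_to_l2[OF sq_int_add[OF sq_int_rep[of f] sq_int_rep[of g]]]
      by (simp add: to_l2_add)
    also have "\<dots> = to_l2 (\<lambda>x. (\<integral>y. K x y * rep_l2 f y \<partial>lborel) + (\<integral>y. K x y * rep_l2 g y \<partial>lborel))"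
    proof (subst to_l2_eq_iff)
      show "AE x in lborel. (\<integral>y. K x y * (rep_l2 f y + rep_l2 g y) \<partial>lborel)
          = (\<integral>y. K x y * rep_l2 f y \<partial>lborel) + (\<integral>y. K x y * rep_l2 g y \<partial>lborel)"
        using kernel_integrable[OF sq_int_rep[of f]] kernel_integrable[OF sq_int_rep[of g]]
        by eventually_elim (simp add: distrib_left)
    qed (auto intro!: kernel_fun_sq_int sq_int_add)
    also have "\<dots> = kernel_op K f + kernel_op K g"
      unfolding kernel_op_def by (intro to_l2_add kernel_fun_sq_int) auto
    finally show ?thesis .
  qed
  show "kernel_op K (c *\<^sub>C f) = c *\<^sub>C kernel_op K f" for c f
  proof -
    have "kernel_op K (c *\<^sub>C f) = to_l2 (\<lambda>x. \<integral>y. K x y * (c * rep_l2 f y) \<partial>lborel)"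
      using kernel_op_to_l2[OF sq_int_cmult[OF sq_int_rep[of f]]] by (simp add: to_l2_cscale)
    also have "\<dots> = to_l2 (\<lambda>x. c * (\<integral>y. K x y * rep_l2 f y \<partial>lborel))"
      by (simp add: mult.left_commute)
    also have "\<dots> = c *\<^sub>C kernel_op K f"
      unfolding kernel_op_def by (intro to_l2_cscale kernel_fun_sq_int) auto
    finally show ?thesis .
  qed
qed (rule norm_kernel_op)

lemma onorm_kernel_op: "onorm (kernel_op K) \<le> C"
  using KC norm_kernel_op by (intro onorm_bound) (auto simp: kernel_bounded_def)

text \<open>The pairing is bilinear, without conjugation, to match the one in
  \<open>bilaplacian_op\<close>. Fubini applies because Cauchy-Schwarz against
  \<open>kernel_abs_bound\<close> makes the double integral absolutely convergent.\<close>

lemma kernel_duality: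
  assumes f: "sq_int f" and g: "sq_int g"
  shows "(\<integral>x. g x * (\<integral>y. K x y * f y \<partial>lborel) \<partial>lborel)
    = (\<integral>y. f y * (\<integral>x. K x y * g x \<partial>lborel) \<partial>lborel)"
proof -
  note [measurable] = kernel_measurable
  have [measurable]: "f \<in> borel_measurable lborel" "g \<in> borel_measurable lborel"
    using f g by (auto simp: sq_int_measurable)
  define h where "h x y = g x * (K x y * f y)" for x y
  have [measurable]: "case_prod h \<in> borel_measurable (lborel \<Otimes>\<^sub>M lborel)"
    unfolding h_def by measurable
  have "(\<integral>\<^sup>+x. ennreal (norm (g x)) * (\<integral>\<^sup>+y. ennreal (norm (K x y * f y)) \<partial>lborel) \<partial>lborel)\<^sup>2
      \<le> (\<integral>\<^sup>+x. (ennreal (norm (g x)))\<^sup>2 \<partial>lborel) *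
        (\<integral>\<^sup>+x. (\<integral>\<^sup>+y. ennreal (norm (K x y * f y)) \<partial>lborel)\<^sup>2 \<partial>lborel)"
    by (rule Cauchy_Schwarz_nn_integral) measurable
  also have "\<dots> \<le> ennreal ((norm (to_l2 g))\<^sup>2) * ennreal ((C * norm (to_l2 f))\<^sup>2)"
    using kernel_abs_bound[OF f]
    by (intro mult_mono) (auto simp: ennreal_power nn_norm_to_l2 g)
  also have "\<dots> < \<infinity>"
    by (simp add: ennreal_mult[symmetric])
  finally have "(\<integral>\<^sup>+x. ennreal (norm (g x)) * (\<integral>\<^sup>+y. ennreal (norm (K x y * f y)) \<partial>lborel) \<partial>lborel) < \<infinity>"
    by (auto simp: power2_eq_square ennreal_mult_less_top less_top)
  also have "(\<integral>\<^sup>+x. ennreal (norm (g x)) * (\<integral>\<^sup>+y. ennreal (norm (K x y * f y)) \<partial>lborel) \<partial>lborel)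
      = (\<integral>\<^sup>+x. (\<integral>\<^sup>+y. ennreal (norm (h x y)) \<partial>lborel) \<partial>lborel)"
    unfolding h_def
    by (intro nn_integral_cong) (simp add: norm_mult ennreal_mult nn_integral_cmult)
  also have "\<dots> = (\<integral>\<^sup>+p. ennreal (norm (case_prod h p)) \<partial>(lborel \<Otimes>\<^sub>M lborel))"
    by (subst lborel.nn_integral_fst[symmetric]) auto
  finally have "integrable (lborel \<Otimes>\<^sub>M lborel) (case_prod h)"
    by (intro integrableI_bounded) auto
  then have "(\<integral>y. (\<integral>x. h x y \<partial>lborel) \<partial>lborel) = (\<integral>x. (\<integral>y. h x y \<partial>lborel) \<partial>lborel)"
    by (rule lborel_pair.Fubini_integral)
  then show ?thesis unfolding h_def by (simp add: mult_ac flip: integral_mult_right_zero)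
qed

end

lemma kernel_op_lincomb:
  assumes K: "kernel_bounded K C" and L: "kernel_bounded L D"
  shows "kernel_op (\<lambda>x y. c * K x y + d * L x y) f = c *\<^sub>C kernel_op K f + d *\<^sub>C kernel_op L f"
proof -
  let ?K = "\<lambda>x. \<integral>y. K x y * rep_l2 f y \<partial>lborel" and ?L = "\<lambda>x. \<integral>y. L x y * rep_l2 f y \<partial>lborel"
  note KL = kernel_fun_sq_int[OF K sq_int_rep[of f]] kernel_fun_sq_int[OF L sq_int_rep[of f]]
  have AE: "AE x in lborel. (\<integral>y. (c * K x y + d * L x y) * rep_l2 f y \<partial>lborel) = c * ?K x + d * ?L x"
    using kernel_integrable[OF K sq_int_rep[of f]] kernel_integrable[OF L sq_int_rep[of f]]
    by eventually_elim (simp add: distrib_right mult.assoc)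
  note [measurable] = kernel_measurable[OF K] kernel_measurable[OF L]
  have [measurable]: "rep_l2 f \<in> borel_measurable lborel" by simp
  have "(\<lambda>x. \<integral>y. (c * K x y + d * L x y) * rep_l2 f y \<partial>lborel) \<in> borel_measurable lborel"
    by measurable
  then have "sq_int (\<lambda>x. \<integral>y. (c * K x y + d * L x y) * rep_l2 f y \<partial>lborel)"
    using AE by (intro sq_int_bound[OF sq_int_add[OF sq_int_cmult sq_int_cmult, OF KL]]) auto
  then have "kernel_op (\<lambda>x y. c * K x y + d * L x y) f = to_l2 (\<lambda>x. c * ?K x + d * ?L x)"
    unfolding kernel_op_def using AE KL by (subst to_l2_eq_iff) (auto intro!: sq_int_add sq_int_cmult)
  also have "\<dots> = c *\<^sub>C kernel_op K f + d *\<^sub>C kernel_op L f"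
    using KL by (simp add: kernel_op_def to_l2_add to_l2_cscale sq_int_cmult)
  finally show ?thesis .
qed

subsection \<open>Affine changes of variables\<close>

lemma integral_affine_r3:
  fixes f :: "r3 \<Rightarrow> 'a::{banach, second_countable_topology}"
  assumes [measurable]: "f \<in> borel_measurable borel" and "c \<noteq> 0"
  shows "(\<integral>x. f x \<partial>lborel) = \<bar>c\<bar> ^ 3 *\<^sub>R (\<integral>x. f (t + c *\<^sub>R x) \<partial>lborel)"
  by (subst lborel_affine[OF \<open>c \<noteq> 0\<close>, of t])
    (simp add: integral_density integral_distr)

lemma integral_translate_r3:
  fixes f :: "r3 \<Rightarrow> 'a::{banach, second_countable_topology}"
  assumes "f \<in> borel_measurable borel"
  shows "(\<integral>x. f (t + x) \<partial>lborel) = (\<integral>x. f x \<partial>lborel)"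
  using integral_affine_r3[OF assms, of 1 t] by simp

lemma integral_reflect_r3:
  fixes f :: "r3 \<Rightarrow> 'a::{banach, second_countable_topology}"
  assumes "f \<in> borel_measurable borel"
  shows "(\<integral>x. f (t - x) \<partial>lborel) = (\<integral>x. f x \<partial>lborel)"
  using integral_affine_r3[OF assms, of "-1" t] by simp

lemma nn_integral_affine_r3:
  fixes f :: "r3 \<Rightarrow> ennreal"
  assumes [measurable]: "f \<in> borel_measurable borel" and "c \<noteq> 0"
  shows "(\<integral>\<^sup>+x. f x \<partial>lborel) = ennreal (\<bar>c\<bar> ^ 3) * (\<integral>\<^sup>+x. f (t + c *\<^sub>R x) \<partial>lborel)"
  by (subst lborel_affine[OF \<open>c \<noteq> 0\<close>, of t])
    (simp add: nn_integral_density nn_integral_distr nn_integral_cmult)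

lemma nn_integral_reflect_r3:
  fixes f :: "r3 \<Rightarrow> ennreal"
  assumes "f \<in> borel_measurable borel"
  shows "(\<integral>\<^sup>+x. f (t - x) \<partial>lborel) = (\<integral>\<^sup>+x. f x \<partial>lborel)"
  using nn_integral_affine_r3[OF assms, of "-1" t] by simp

lemma nn_integral_translate_r3:
  fixes f :: "r3 \<Rightarrow> ennreal"
  assumes "f \<in> borel_measurable borel"
  shows "(\<integral>\<^sup>+x. f (x - t) \<partial>lborel) = (\<integral>\<^sup>+x. f x \<partial>lborel)"
  using nn_integral_affine_r3[OF assms, of 1 "-t"] by (simp add: add.commute)

subsection \<open>Smooth functions\<close>

lemma partial_derivI: "(f has_derivative f') (at x) \<Longrightarrow> partial_deriv i f x = f' (axis i 1)"
  unfolding partial_deriv_def by (metis frechet_derivative_at)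

lemma partial_deriv_add:
  assumes "f differentiable at x" "g differentiable at x"
  shows "partial_deriv i (\<lambda>x. f x + g x) x = partial_deriv i f x + partial_deriv i g x"
  using partial_derivI[OF has_derivative_add[OF assms[unfolded frechet_derivative_works]]]
  by (simp add: partial_deriv_def)

lemma partial_deriv_mult:
  assumes "f differentiable at x" "g differentiable at x"
  shows "partial_deriv i (\<lambda>x. f x * g x) x = f x * partial_deriv i g x + partial_deriv i f x * g x"
  using partial_derivI[OF has_derivative_mult[OF assms[unfolded frechet_derivative_works]]]
  by (simp add: partial_deriv_def)

lemma partial_deriv_const: "partial_deriv i (\<lambda>x. c) x = 0"
  by (rule partial_derivI[of _ "\<lambda>_. 0", simplified]) simp

lemma partial_deriv_cmult:
  assumes "f differentiable at x"
  shows "partial_deriv i (\<lambda>x. c * f x) x = c * partial_deriv i f x"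
  using partial_deriv_mult[OF _ assms, of "\<lambda>_. c"] by (simp add: partial_deriv_const)

lemma partial_deriv_affine:
  assumes "f differentiable at (a *\<^sub>R x + b)"
  shows "(\<lambda>x. f (a *\<^sub>R x + b)) differentiable at x"
    and "partial_deriv i (\<lambda>x. f (a *\<^sub>R x + b)) x = of_real a * partial_deriv i f (a *\<^sub>R x + b)"
proof -
  let ?f' = "frechet_derivative f (at (a *\<^sub>R x + b))"
  have "((\<lambda>x. a *\<^sub>R x + b) has_derivative (\<lambda>h. a *\<^sub>R h)) (at x)"
    by (auto intro!: derivative_eq_intros)
  from has_derivative_compose[OF this assms[unfolded frechet_derivative_works]]
  have d: "((\<lambda>x. f (a *\<^sub>R x + b)) has_derivative (\<lambda>h. ?f' (a *\<^sub>R h))) (at x)" .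
  then show "(\<lambda>x. f (a *\<^sub>R x + b)) differentiable at x" by (auto simp: differentiable_def)
  have "linear ?f'" using assms by (rule linear_frechet_derivative)
  then show "partial_deriv i (\<lambda>x. f (a *\<^sub>R x + b)) x = of_real a * partial_deriv i f (a *\<^sub>R x + b)"
    using partial_derivI[OF d] by (simp add: partial_deriv_def linear_scale scaleR_conv_of_real[where 'a=complex])
qed

lemma frechet_derivative_partial:
  assumes "f differentiable at x"
  shows "frechet_derivative f (at x) h = (\<Sum>i\<in>UNIV. of_real (h $ i) * partial_deriv i f x)"
proof -
  have lin: "linear (frechet_derivative f (at x))" using assms by (rule linear_frechet_derivative)
  have "frechet_derivative f (at x) h = frechet_derivative f (at x) (\<Sum>i\<in>UNIV. h $ i *\<^sub>R axis i 1)"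
    using basis_expansion[of h] by (simp add: scalar_mult_eq_scaleR)
  also have "\<dots> = (\<Sum>i\<in>UNIV. h $ i *\<^sub>R frechet_derivative f (at x) (axis i 1))"
    by (simp add: linear_sum[OF lin] linear_scale[OF lin])
  finally show ?thesis by (simp add: partial_deriv_def scaleR_conv_of_real[where 'a=complex])
qed

lemma C_k_continuous: "C_k k f \<Longrightarrow> continuous_on UNIV f"
proof (cases k)
  case (Suc m)
  assume "C_k k f"
  then have "isCont f x" for x
    using Suc by (simp add: differentiable_imp_continuous_within)
  then show ?thesis by (simp add: continuous_at_imp_continuous_on)
qed auto

lemma C_k_Suc: "C_k (Suc k) f \<Longrightarrow> C_k k f"
proof (induction k arbitrary: f)
  case 0
  show ?case using C_k_continuous[OF 0] by simp
next
  case (Suc k)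
  then show ?case by (metis C_k.simps(2))
qed

lemma C_k_const: "C_k k (\<lambda>x. c)"
  by (induction k arbitrary: c) (auto simp: partial_deriv_const[abs_def])

lemma C_k_add: "C_k k f \<Longrightarrow> C_k k g \<Longrightarrow> C_k k (\<lambda>x. f x + g x)"
proof (induction k arbitrary: f g)
  case 0
  then show ?case by (auto intro: continuous_on_add)
next
  case (Suc k)
  have "partial_deriv i (\<lambda>x. f x + g x) = (\<lambda>x. partial_deriv i f x + partial_deriv i g x)" for i
    using Suc.prems by (auto simp: partial_deriv_add)
  then show ?case using Suc by auto
qed

lemma C_k_mult: "C_k k f \<Longrightarrow> C_k k g \<Longrightarrow> C_k k (\<lambda>x. f x * g x)"
proof (induction k arbitrary: f g)
  case 0
  then show ?case by (auto intro: continuous_on_mult)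
next
  case (Suc k)
  have "C_k k (partial_deriv i (\<lambda>x. f x * g x))" for i
  proof -
    have "partial_deriv i (\<lambda>x. f x * g x) = (\<lambda>x. f x * partial_deriv i g x + partial_deriv i f x * g x)"
      using Suc.prems by (auto simp: partial_deriv_mult)
    then show ?thesis
      using Suc.prems C_k_Suc[OF Suc.prems(1)] C_k_Suc[OF Suc.prems(2)]
      by (auto intro!: C_k_add Suc.IH)
  qed
  then show ?case using Suc.prems by auto
qed

lemma C_k_affine: "C_k k f \<Longrightarrow> C_k k (\<lambda>x. f (a *\<^sub>R x + b))"
proof (induction k arbitrary: f)
  case 0
  then show ?case by (auto intro!: continuous_on_compose2[of UNIV f] continuous_intros)
next
  case (Suc k)
  have "C_k k (partial_deriv i (\<lambda>x. f (a *\<^sub>R x + b)))" for i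
  proof -
    have "partial_deriv i (\<lambda>x. f (a *\<^sub>R x + b)) = (\<lambda>x. of_real a * partial_deriv i f (a *\<^sub>R x + b))"
      using Suc.prems by (auto simp: partial_deriv_affine)
    then show ?thesis using Suc.prems by (auto intro!: C_k_mult C_k_const Suc.IH)
  qed
  then show ?case using Suc.prems by (auto intro: partial_deriv_affine)
qed

lemma C_k_prod: "finite I \<Longrightarrow> (\<And>i. i \<in> I \<Longrightarrow> C_k k (f i)) \<Longrightarrow> C_k k (\<lambda>x. \<Prod>i\<in>I. f i x)"
  by (induction rule: finite_induct) (auto intro: C_k_const C_k_mult)

lemma C_k_sum: "finite I \<Longrightarrow> (\<And>i. i \<in> I \<Longrightarrow> C_k k (f i)) \<Longrightarrow> C_k k (\<lambda>x. \<Sum>i\<in>I. f i x)"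
  by (induction rule: finite_induct) (auto intro: C_k_const C_k_add)

lemma C_k_coord: "C_k k (\<lambda>x. of_real (x $ i))"
proof (cases k)
  case (Suc m)
  have d: "((\<lambda>x. complex_of_real (x $ i)) has_derivative (\<lambda>h. of_real (h $ i))) (at x)" for x
    by (intro bounded_linear_imp_has_derivative bounded_linear_compose[OF bounded_linear_of_real] bounded_linear_vec_nth)
  have "partial_deriv j (\<lambda>x. complex_of_real (x $ i)) = (\<lambda>x. of_real (axis j 1 $ i))" for j
    using partial_derivI[OF d] by auto
  then show ?thesis using d Suc by (auto simp: C_k_const differentiable_def)
qed (auto intro!: continuous_intros)

text \<open>The outer function comes with the sequence of all its derivatives, so the induction on
  \<open>k\<close> can shift from \<open>H n\<close> to \<open>H (Suc n)\<close> instead of leaving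
  the family.\<close>

lemma C_k_compose_real:
  fixes H :: "nat \<Rightarrow> real \<Rightarrow> real" and Q :: "r3 \<Rightarrow> real"
  assumes H: "\<And>n t. (H n has_real_derivative H (Suc n) t) (at t)"
    and Q: "\<And>k. C_k k (\<lambda>x. of_real (Q x))"
  shows "C_k k (\<lambda>x. of_real (H n (Q x)))"
proof (induction k arbitrary: n)
  case 0
  have "continuous_on UNIV (\<lambda>x. Re (complex_of_real (Q x)))"
    using Q[of 0] by (intro continuous_intros) auto
  moreover have "continuous_on UNIV (H n)"
    using H by (meson DERIV_continuous_on has_field_derivative_at_within)
  ultimately show ?case
    by (auto intro!: continuous_intros continuous_on_compose2[of UNIV "H n"])
next
  case (Suc k)
  have dQ: "((\<lambda>x. complex_of_real (Q x)) has_derivative frechet_derivative (\<lambda>x. of_real (Q x)) (at x)) (at x)" for x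
    using Q[of "Suc 0"] by (simp add: frechet_derivative_works)
  have dQ': "(Q has_derivative (\<lambda>h. Re (frechet_derivative (\<lambda>x. of_real (Q x)) (at x) h))) (at x)" for x
    using has_derivative_Re[OF dQ[of x]] by simp
  \<comment> \<open>\<open>Q\<close> is real-valued, so its complex derivative is real; this
    identifies the real chain rule with the complex partial derivative.\<close>
  have im: "Im (frechet_derivative (\<lambda>x. of_real (Q x)) (at x) h) = 0" for x h
  proof -
    have "((\<lambda>x. 0) has_derivative (\<lambda>h. Im (frechet_derivative (\<lambda>x. of_real (Q x)) (at x) h))) (at x)"
      using has_derivative_Im[OF dQ[of x]] by simp
    from has_derivative_unique[OF this has_derivative_const] show ?thesis by meson
  qed
  have d: "((\<lambda>x. complex_of_real (H n (Q x))) has_derivative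
      (\<lambda>h. of_real (Re (frechet_derivative (\<lambda>x. of_real (Q x)) (at x) h) * H (Suc n) (Q x)))) (at x)" for x
    using has_derivative_compose[OF dQ' H[of n "Q x", unfolded has_field_derivative_def]]
    by (intro has_derivative_of_real) (simp add: mult.commute)
  have "partial_deriv i (\<lambda>x. complex_of_real (H n (Q x)))
      = (\<lambda>x. of_real (H (Suc n) (Q x)) * partial_deriv i (\<lambda>x. of_real (Q x)) x)" for i
    using partial_derivI[OF d] im
    by (auto simp: partial_deriv_def complex_eq_iff)
  then show ?case
    using d Suc.IH Q[of "Suc k"] by (auto simp: differentiable_def intro!: C_k_mult)
qed

definition smooth :: "(r3 \<Rightarrow> complex) \<Rightarrow> bool" where
  "smooth f \<longleftrightarrow> (\<forall>k. C_k k f)"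

lemma smooth_differentiable: "smooth f \<Longrightarrow> f differentiable at x"
  unfolding smooth_def by (metis C_k.simps(2))

lemma smooth_partial: "smooth f \<Longrightarrow> smooth (partial_deriv i f)"
  unfolding smooth_def by (metis C_k.simps(2))

lemma smooth_continuous: "smooth f \<Longrightarrow> continuous_on S f"
  unfolding smooth_def by (metis C_k_continuous continuous_on_subset subset_UNIV)

lemma smooth_measurable: "smooth f \<Longrightarrow> f \<in> borel_measurable borel"
  by (intro borel_measurable_continuous_onI smooth_continuous)

text \<open>Meant for convolutions with test functions: their partial derivatives are again such
  convolutions, so the whole class is shown smooth at once.\<close>

lemma smooth_coinduct:
  assumes "f \<in> S" "\<And>f x. f \<in> S \<Longrightarrow> f differentiable at x" "\<And>f i. f \<in> S \<Longrightarrow> partial_deriv i f \<in> S"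
  shows "smooth f"
proof -
  have "\<forall>f\<in>S. C_k k f" for k
  proof (induction k)
    case 0
    then show ?case
      using assms(2) by (auto intro!: continuous_at_imp_continuous_on differentiable_imp_continuous_within)
  qed (use assms in auto)
  then show ?thesis using assms(1) by (auto simp: smooth_def)
qed

lemma test_function_smooth: "test_function f \<Longrightarrow> smooth f"
  by (simp add: test_function_def smooth_def)

lemma test_functionI: "smooth f \<Longrightarrow> (\<And>x. f x \<noteq> 0 \<Longrightarrow> norm x \<le> B) \<Longrightarrow> test_function f"
  unfolding test_function_def smooth_def bounded_iff by auto

lemma test_function_supportE:
  assumes "test_function f"
  obtains B where "B > 0" "\<And>x. norm x > B \<Longrightarrow> f x = 0"
proof -
  obtain b where b: "\<And>x. f x \<noteq> 0 \<Longrightarrow> norm x \<le> b"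
    using assms by (auto simp: test_function_def bounded_iff)
  show ?thesis using b by (intro that[of "max b 1"]) force+
qed

lemma test_function_partial:
  assumes "test_function f" shows "test_function (partial_deriv i f)"
proof -
  obtain B where B: "B > 0" "\<And>x. norm x > B \<Longrightarrow> f x = 0"
    using test_function_supportE[OF assms] by blast
  have "partial_deriv i f x = 0" if "norm x > B" for x
  proof -
    have "((\<lambda>_. 0) has_derivative (\<lambda>_. 0)) (at x)" by simp
    then have "(f has_derivative (\<lambda>_. 0)) (at x)"
    proof (rule has_derivative_transform_within_open[where s="- cball 0 B"])
      show "open (- cball 0 B :: r3 set)" by (simp add: open_Compl)
    qed (use that B in auto)
    then show ?thesis by (simp add: partial_derivI)
  qed
  then have "norm x \<le> B" if "partial_deriv i f x \<noteq> 0" for x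
    using that not_less by blast
  then show ?thesis
    using smooth_partial[OF test_function_smooth[OF assms]] by (rule test_functionI[rotated])
qed

lemma test_function_add: "test_function f \<Longrightarrow> test_function g \<Longrightarrow> test_function (\<lambda>x. f x + g x)"
  unfolding test_function_def
  by (auto intro!: C_k_add intro: bounded_subset[of "{x. f x \<noteq> 0} \<union> {x. g x \<noteq> 0}"])

lemma test_function_laplacian:
  assumes "test_function f" shows "test_function (laplacian f)"
proof -
  have "test_function (partial_deriv i (partial_deriv i f))" for i
    by (intro test_function_partial assms)
  then show ?thesis
    unfolding laplacian_def[abs_def] sum_3 by (intro test_function_add)
qed

lemma test_function_cmult: "test_function f \<Longrightarrow> test_function (\<lambda>x. c * f x)"
  unfolding test_function_def
  by (auto intro!: C_k_mult C_k_const intro: bounded_subset[of "{x. f x \<noteq> 0}"])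

lemma test_function_mult_smooth: "test_function f \<Longrightarrow> smooth g \<Longrightarrow> test_function (\<lambda>x. f x * g x)"
  unfolding test_function_def smooth_def
  by (auto intro!: C_k_mult intro: bounded_subset[of "{x. f x \<noteq> 0}"])

lemma test_function_affine:
  assumes f: "test_function f" and "a \<noteq> 0" shows "test_function (\<lambda>x. f (a *\<^sub>R x + b))"
proof -
  obtain B where B: "B > 0" "\<And>x. norm x > B \<Longrightarrow> f x = 0"
    using test_function_supportE[OF f] by blast
  show ?thesis
  proof (rule test_functionI[of _ "(B + norm b) / \<bar>a\<bar>"])
    show "smooth (\<lambda>x. f (a *\<^sub>R x + b))"
      using f by (auto simp: test_function_def smooth_def intro: C_k_affine)
    fix x assume "f (a *\<^sub>R x + b) \<noteq> 0"
    then have "norm (a *\<^sub>R x + b) \<le> B" using B(2) by (meson not_less)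
    then have "\<bar>a\<bar> * norm x \<le> B + norm b"
      using norm_diff_ineq[of "a *\<^sub>R x" b] by simp
    then show "norm x \<le> (B + norm b) / \<bar>a\<bar>" using \<open>a \<noteq> 0\<close> by (simp add: field_simps)
  qed
qed

lemma test_function_bounded:
  assumes "test_function f"
  obtains M where "M > 0" "\<And>x. norm (f x) \<le> M"
proof -
  obtain B where B: "B > 0" "\<And>x. norm x > B \<Longrightarrow> f x = 0"
    using test_function_supportE[OF assms] by blast
  have "compact (f ` cball 0 B)"
    using assms by (intro compact_continuous_image smooth_continuous test_function_smooth) auto
  then obtain M where M: "M > 0" "\<And>y. y \<in> f ` cball 0 B \<Longrightarrow> norm y \<le> M"
    using compact_imp_bounded bounded_pos by metis
  have "norm (f x) \<le> M" for x
    using M B(2)[of x] by (cases "norm x > B") auto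
  then show ?thesis using that M by blast
qed

lemma test_function_measurable: "test_function f \<Longrightarrow> f \<in> borel_measurable borel"
  by (intro smooth_measurable test_function_smooth)

lemma continuous_supported_integrable:
  fixes f :: "r3 \<Rightarrow> 'a::{banach, second_countable_topology}"
  assumes "continuous_on UNIV f" "\<And>x. norm x > B \<Longrightarrow> f x = 0"
  shows "integrable lborel f"
proof -
  have "integrable lborel (\<lambda>x. indicator (cball 0 B) x *\<^sub>R f x)"
    using assms(1) by (intro borel_integrable_compact) (auto intro: continuous_on_subset)
  moreover have "(\<lambda>x. indicator (cball 0 B) x *\<^sub>R f x) = f"
    using assms(2) by (auto simp: indicator_def not_le)
  ultimately show ?thesis by simp
qed

lemma test_function_sq_int: assumes "test_function f" shows "sq_int f"
proof -
  obtain B where B: "B > 0" "\<And>x. norm x > B \<Longrightarrow> f x = 0"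
    using test_function_supportE[OF assms] by blast
  have "integrable lborel (\<lambda>x. (norm (f x))\<^sup>2)"
    using B by (intro continuous_supported_integrable[of _ B] continuous_intros smooth_continuous test_function_smooth assms) auto
  then show ?thesis using assms by (simp add: sq_int_def test_function_measurable)
qed

subsection \<open>Bump functions\<close>

text \<open>With u = 1/t, the n-th derivative of exp (-1/t) is p(u) exp (-u) for a polynomial p, and
  differentiating in t turns p into u^2 (p - p').\<close>

primrec bump_poly :: "nat \<Rightarrow> real poly" where
  "bump_poly 0 = 1"
| "bump_poly (Suc n) = [:0, 0, 1:] * (bump_poly n - pderiv (bump_poly n))"

definition bump_deriv :: "nat \<Rightarrow> real \<Rightarrow> real" where
  "bump_deriv n t = (if t > 0 then poly (bump_poly n) (1 / t) * exp (- (1 / t)) else 0)"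

lemma poly_exp_decay: "((\<lambda>u::real. poly p u * exp (- u)) \<longlongrightarrow> 0) at_top"
proof -
  \<comment> \<open>The extra factor u^k makes the induction over the coefficients of
    \<open>p\<close> go through.\<close>
  have "((\<lambda>u::real. u ^ k * poly p u * exp (- u)) \<longlongrightarrow> 0) at_top" for k
  proof (induction p arbitrary: k)
    case (pCons a p)
    have "((\<lambda>u. a * (u ^ k / exp u) + u ^ Suc k * poly p u * exp (- u)) \<longlongrightarrow> a * 0 + 0) at_top"
      by (intro tendsto_intros tendsto_power_div_exp_0 pCons.IH)
    then show ?case by (simp add: exp_minus field_simps)
  qed simp
  from this[of 0] show ?thesis by simp
qed

lemma bump_deriv_works: "(bump_deriv n has_real_derivative bump_deriv (Suc n) t) (at t)"
proof -
  consider "t > 0" | "t < 0" | "t = 0" by linarith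
  then show ?thesis
  proof cases
    case 1
    have "((\<lambda>t. poly (bump_poly n) (1 / t) * exp (- (1 / t))) has_real_derivative bump_deriv (Suc n) t) (at t)"
      using 1 by (auto intro!: derivative_eq_intros simp: bump_deriv_def field_simps power2_eq_square)
    then show ?thesis
      by (rule has_field_derivative_transform_within_open[where S="{0<..}"])
        (use 1 in \<open>auto simp: bump_deriv_def\<close>)
  next
    case 2
    have "((\<lambda>t. 0) has_real_derivative bump_deriv (Suc n) t) (at t)"
      using 2 by (simp add: bump_deriv_def)
    then show ?thesis
      by (rule has_field_derivative_transform_within_open[where S="{..<0}"])
        (use 2 in \<open>auto simp: bump_deriv_def\<close>)
  next
    case 3
    have "((\<lambda>h. bump_deriv n h / h) \<longlongrightarrow> 0) (at 0)"
    proof (rule filterlim_split_at)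
      show "((\<lambda>h. bump_deriv n h / h) \<longlongrightarrow> 0) (at_left 0)"
        by (rule tendsto_eventually) (auto simp: eventually_at_left_field bump_deriv_def intro!: exI[of _ "-1"])
      \<comment> \<open>\<open>pCons 0\<close> contributes the factor 1/h of the difference quotient
        at the origin.\<close>
      have "((\<lambda>h. poly (pCons 0 (bump_poly n)) (inverse h) * exp (- inverse h)) \<longlongrightarrow> 0) (at_right (0::real))"
        by (rule filterlim_compose[OF poly_exp_decay filterlim_inverse_at_top_right])
      then show "((\<lambda>h. bump_deriv n h / h) \<longlongrightarrow> 0) (at_right 0)"
        by (rule Lim_transform_eventually)
          (auto simp: eventually_at_right_field bump_deriv_def field_simps intro!: exI[of _ "1"])
    qed
    then show ?thesis using 3 by (simp add: has_field_derivative_iff bump_deriv_def)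
  qed
qed

text \<open>For \<open>a\<close> below \<open>b\<close> this is positive exactly on the open box. On
  the box each factor is exp (-1/(n s)) with s > 0, which tends to 1 as \<open>n\<close> grows; so
  these are smooth approximations of the indicator.\<close>

definition box_bump :: "r3 \<Rightarrow> r3 \<Rightarrow> real \<Rightarrow> r3 \<Rightarrow> complex" where
  "box_bump a b n x = (\<Prod>i\<in>UNIV. of_real (bump_deriv 0 (n * ((x $ i - a $ i) * (b $ i - x $ i)))))"

lemma bump_0: "bump_deriv 0 t = (if t > 0 then exp (- (1 / t)) else 0)"
  by (simp add: bump_deriv_def)

lemma norm_bump_0_le: "\<bar>bump_deriv 0 t\<bar> \<le> 1"
  by (simp add: bump_0)

lemma box_bump_outside:
  assumes "n > 0" "\<And>i. a $ i < b $ i" "x \<notin> box a b"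
  shows "box_bump a b n x = 0"
proof -
  obtain i where i: "x $ i \<le> a $ i \<or> b $ i \<le> x $ i"
    using assms(3) by (auto simp: mem_box_cart not_less)
  then have "(x $ i - a $ i) * (b $ i - x $ i) \<le> 0"
    using assms(2)[of i] by (auto simp: mult_le_0_iff)
  then have "n * ((x $ i - a $ i) * (b $ i - x $ i)) \<le> 0"
    using assms(1) by (simp add: mult_le_0_iff)
  then have "bump_deriv 0 (n * ((x $ i - a $ i) * (b $ i - x $ i))) = 0"
    by (simp add: bump_0)
  then show ?thesis unfolding box_bump_def by (intro prod_zero) auto
qed

lemma norm_box_bump_le: "norm (box_bump a b n x) \<le> 1"
  unfolding box_bump_def prod_norm[symmetric] by (intro prod_le_1) (simp add: norm_bump_0_le)

lemma box_bump_test_function: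
  assumes "n > 0" "\<And>i. a $ i < b $ i"
  shows "test_function (box_bump a b n)"
proof -
  have "C_k k (\<lambda>x. of_real (n * ((x $ i - a $ i) * (b $ i - x $ i))))" for k i
  proof -
    have "C_k k (\<lambda>x. of_real n * ((of_real (x $ i) + of_real (- a $ i)) * (of_real (b $ i) + (-1) * of_real (x $ i))))"
      by (intro C_k_mult C_k_add C_k_const C_k_coord)
    then show ?thesis by simp
  qed
  then have "C_k k (\<lambda>x. of_real (bump_deriv 0 (n * ((x $ i - a $ i) * (b $ i - x $ i)))))" for k i
    by (rule C_k_compose_real[of bump_deriv, OF bump_deriv_works])
  then have "smooth (box_bump a b n)"
    unfolding smooth_def box_bump_def[abs_def] by (auto intro!: C_k_prod)
  moreover have "bounded {x. box_bump a b n x \<noteq> 0}"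
    by (rule bounded_subset[OF bounded_box[of a b]]) (use box_bump_outside[OF assms] in auto)
  ultimately show ?thesis by (simp add: test_function_def smooth_def)
qed

lemma box_bump_tendsto:
  assumes "\<And>i. a $ i < b $ i"
  shows "(\<lambda>n. box_bump a b (real (Suc n)) x) \<longlonglongrightarrow> indicator (box a b) x"
proof (cases "x \<in> box a b")
  case True
  have "(\<lambda>n. box_bump a b (real (Suc n)) x) \<longlonglongrightarrow> (\<Prod>i\<in>(UNIV::3 set). of_real (exp (- 0)))"
    unfolding box_bump_def
  proof (intro tendsto_prod tendsto_of_real)
    fix i :: 3
    define s where "s = (x $ i - a $ i) * (b $ i - x $ i)"
    have "s > 0" using True by (auto simp: s_def mem_box_cart)
    have "(\<lambda>n. exp (- ((1 / s) * (1 / real (Suc n))))) \<longlonglongrightarrow> exp (- ((1 / s) * 0))"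
      by (intro tendsto_intros LIMSEQ_Suc lim_1_over_n)
    moreover have "bump_deriv 0 (real (Suc n) * s) = exp (- ((1 / s) * (1 / real (Suc n))))" for n
      using \<open>s > 0\<close> by (simp add: bump_0 mult.commute)
    ultimately show "(\<lambda>n. bump_deriv 0 (real (Suc n) * ((x $ i - a $ i) * (b $ i - x $ i)))) \<longlonglongrightarrow> exp (- 0)"
      by (simp add: s_def)
  qed
  then show ?thesis using True by simp
next
  case False
  then show ?thesis using box_bump_outside[OF _ assms False] by simp
qed

section \<open>The fundamental lemma of the calculus of variations\<close>

lemma AE_zero_of_box_integrals:
  fixes g :: "r3 \<Rightarrow> real"
  assumes g: "integrable lborel g" and zero: "\<And>a b. (\<integral>x. indicator (box a b) x * g x \<partial>lborel) = 0"
  shows "AE x in lborel. g x = 0"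
proof -
  have [measurable]: "g \<in> borel_measurable borel" using g by auto
  \<comment> \<open>\<open>ennreal\<close> truncates at 0, so these are the positive and the
    negative part of \<open>g\<close>. Their densities define finite measures that agree on the
    intersection-stable family of boxes, hence everywhere.\<close>
  let ?p = "\<lambda>x. ennreal (g x)" and ?m = "\<lambda>x. ennreal (- g x)"
  have box_eq: "emeasure (density lborel ?p) (box a b) = emeasure (density lborel ?m) (box a b)" for a b
  proof -
    have int: "integrable lborel (\<lambda>x. indicator (box a b) x * g x)"
      using integrable_mult_indicator[OF _ g, of "box a b"] by simp
    have p: "integrable lborel (\<lambda>x. indicator (box a b) x * max 0 (g x))"
      and m: "integrable lborel (\<lambda>x. indicator (box a b) x * max 0 (- g x))"
      using integrable_mult_indicator[of "box a b" lborel "\<lambda>x. max 0 (g x)"]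
        integrable_mult_indicator[of "box a b" lborel "\<lambda>x. max 0 (- g x)"] g
      by auto
    have "(\<integral>x. indicator (box a b) x * max 0 (g x) \<partial>lborel) - (\<integral>x. indicator (box a b) x * max 0 (- g x) \<partial>lborel)
        = (\<integral>x. indicator (box a b) x * max 0 (g x) - indicator (box a b) x * max 0 (- g x) \<partial>lborel)"
      using p m by simp
    also have "\<dots> = (\<integral>x. indicator (box a b) x * g x \<partial>lborel)"
      by (intro Bochner_Integration.integral_cong) (auto simp: indicator_def max_def)
    finally have eq: "(\<integral>x. indicator (box a b) x * max 0 (g x) \<partial>lborel) = (\<integral>x. indicator (box a b) x * max 0 (- g x) \<partial>lborel)"
      using zero[of a b] by simp
    have 1: "emeasure (density lborel (\<lambda>x. ennreal (h x))) (box a b)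
        = ennreal (\<integral>x. indicator (box a b) x * max 0 (h x) \<partial>lborel)"
      if [measurable]: "h \<in> borel_measurable borel"
        and i: "integrable lborel (\<lambda>x. indicator (box a b) x * max 0 (h x))" for h
    proof -
      have "emeasure (density lborel (\<lambda>x. ennreal (h x))) (box a b)
          = (\<integral>\<^sup>+x. ennreal (indicator (box a b) x * max 0 (h x)) \<partial>lborel)"
        by (subst emeasure_density) (auto intro!: nn_integral_cong simp: indicator_def max_def ennreal_neg)
      also have "\<dots> = ennreal (\<integral>x. indicator (box a b) x * max 0 (h x) \<partial>lborel)"
        by (rule nn_integral_eq_integral[OF i]) auto
      finally show ?thesis .
    qed
    show ?thesis using 1[OF _ p] 1[OF _ m] eq by simp
  qed
  have "density lborel ?p = density lborel ?m"
  proof (rule measure_eqI_generator_eq[where E="range (\<lambda>(a, b). box a b)" and \<Omega>=UNIV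
        and A="\<lambda>i::nat. box (- (real i *\<^sub>R One)) (real i *\<^sub>R One)"])
    show "Int_stable (range (\<lambda>(a, b). box a b :: r3 set))"
      by (auto simp: Int_stable_def box_Int_box)
    show "sets (density lborel ?p) = sigma_sets UNIV (range (\<lambda>(a, b). box a b))"
      "sets (density lborel ?m) = sigma_sets UNIV (range (\<lambda>(a, b). box a b))"
      by (simp_all add: borel_eq_box)
    show "(\<Union>i::nat. box (- (real i *\<^sub>R One)) (real i *\<^sub>R One :: r3)) = UNIV"
      by (rule UN_box_eq_UNIV)
    fix i :: nat
    have "emeasure (density lborel ?p) (box (- (real i *\<^sub>R One)) (real i *\<^sub>R One))
        \<le> (\<integral>\<^sup>+x. ennreal (norm (g x)) \<partial>lborel)"
      by (subst emeasure_density)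
        (auto intro!: nn_integral_mono simp: indicator_def ennreal_leI split: if_splits)
    also have "\<dots> < \<infinity>" using g by (simp add: integrable_iff_bounded)
    finally show "emeasure (density lborel ?p) (box (- (real i *\<^sub>R One)) (real i *\<^sub>R One)) \<noteq> \<infinity>"
      by simp
  qed (use box_eq in auto)
  then have "AE x in lborel. ennreal (g x) = ennreal (- g x)"
    by (intro sigma_finite_measure.density_unique[OF lborel.sigma_finite_measure_axioms]) auto
  then show ?thesis
  proof eventually_elim
    case (elim x)
    then show ?case by (cases "g x \<ge> 0") (auto simp: ennreal_neg not_le)
  qed
qed

text \<open>Bump functions carry the hypothesis over to indicators of boxes. Since a square
  integrable \<open>f\<close> may fail to be integrable, \<open>f\<close> is first cut off to a box;
  the intersection of two boxes is again a box, so the vanishing of all box integrals persists for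
  the cut-off function.\<close>

lemma zero_of_test_integrals:
  assumes f: "sq_int f" and zero: "\<And>\<psi>. test_function \<psi> \<Longrightarrow> (\<integral>x. f x * \<psi> x \<partial>lborel) = 0"
  shows "AE x in lborel. f x = 0"
proof -
  have [measurable]: "f \<in> borel_measurable borel" using f by (rule sq_int_measurable)
  have box_int: "integrable lborel (\<lambda>x. f x * indicator (box a b) x)" for a b
  proof -
    have "sq_int (\<lambda>x. indicator (box a b) x)"
    proof (rule sq_intI)
      have "(norm (indicator (box a b) x :: complex))\<^sup>2 = indicator (box a b) x" for x
        by (auto simp: indicator_def)
      then show "(\<integral>\<^sup>+x. ennreal ((norm (indicator (box a b) x :: complex))\<^sup>2) \<partial>lborel) < \<infinity>"
        using emeasure_bounded_finite[OF bounded_box, of a b] by (simp add: ennreal_indicator)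
    qed simp
    from sq_int_mult_integrable[OF this f]
    have "integrable lborel (\<lambda>x. cnj (indicator (box a b) x) * f x)" .
    moreover have "cnj (indicator (box a b) x) * f x = f x * indicator (box a b) x" for x
      by (simp add: indicator_def)
    ultimately show ?thesis by simp
  qed
  have box_zero: "(\<integral>x. f x * indicator (box a b) x \<partial>lborel) = 0" for a b
  proof (cases "\<forall>i. a $ i < b $ i")
    case True
    have "(\<lambda>n. \<integral>x. f x * box_bump a b (real (Suc n)) x \<partial>lborel) \<longlonglongrightarrow> (\<integral>x. f x * indicator (box a b) x \<partial>lborel)"
    proof (rule integral_dominated_convergence[where w="\<lambda>x. norm (f x * indicator (box a b) x)"])
      show "AE x in lborel. (\<lambda>n. f x * box_bump a b (real (Suc n)) x) \<longlonglongrightarrow> f x * indicator (box a b) x"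
        using True by (intro AE_I2 tendsto_intros box_bump_tendsto) auto
      show "AE x in lborel. norm (f x * box_bump a b (real (Suc n)) x) \<le> norm (f x * indicator (box a b) x)" for n
        using True norm_box_bump_le[of a b "real (Suc n)"] box_bump_outside[of "real (Suc n)" a b]
        by (intro AE_I2) (auto simp: indicator_def norm_mult mult_left_le)
      have [measurable]: "box_bump a b (real (Suc n)) \<in> borel_measurable borel" for n
        using True by (intro test_function_measurable box_bump_test_function) auto
      show "(\<lambda>x. f x * box_bump a b (real (Suc n)) x) \<in> borel_measurable lborel" for n
        by measurable
    qed (use box_int[of a b] in auto)
    moreover have "(\<integral>x. f x * box_bump a b (real (Suc n)) x \<partial>lborel) = 0" for n
      using True by (intro zero box_bump_test_function) auto
    ultimately show ?thesis by (simp add: LIMSEQ_const_iff)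
  next
    case False
    then obtain i where "\<not> a $ i < b $ i" by blast
    then have "x \<notin> box a b" for x
      unfolding mem_box_cart by (meson order.strict_trans)
    then have "box a b = {}" by blast
    then show ?thesis by simp
  qed
  have cut: "AE x in lborel. f x * indicator (box a b) x = 0" for a b
  proof -
    have ind: "indicator (box c d) x * (indicator (box a b) x :: real) = indicator (box c d \<inter> box a b) x" for c d x
      by (simp add: indicator_inter_arith)
    have "AE x in lborel. Re (f x * indicator (box a b) x) = 0" "AE x in lborel. Im (f x * indicator (box a b) x) = 0"
    proof (rule_tac [!] AE_zero_of_box_integrals)
      fix c d
      have cd: "(\<integral>x. f x * indicator (box c d \<inter> box a b) x \<partial>lborel) = 0"
        and cdi: "integrable lborel (\<lambda>x. f x * indicator (box c d \<inter> box a b) x)"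
        using box_zero box_int by (simp_all add: box_Int_box)
      have eq: "indicator (box c d) x * Re (f x * indicator (box a b) x) = Re (f x * indicator (box c d \<inter> box a b) x)"
        "indicator (box c d) x * Im (f x * indicator (box a b) x) = Im (f x * indicator (box c d \<inter> box a b) x)" for x
        by (auto simp: indicator_def)
      show "(\<integral>x. indicator (box c d) x * Re (f x * indicator (box a b) x) \<partial>lborel) = 0"
        "(\<integral>x. indicator (box c d) x * Im (f x * indicator (box a b) x) \<partial>lborel) = 0"
        unfolding eq using cd cdi by (simp_all only: integral_Re integral_Im zero_complex.simps)
    qed (intro integrable_Re integrable_Im box_int)+
    then show ?thesis by eventually_elim (simp add: complex_eq_iff)
  qed
  have "AE x in lborel. \<forall>n::nat. f x * indicator (box (- (real n *\<^sub>R One)) (real n *\<^sub>R One)) x = 0"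
    unfolding AE_all_countable by (intro allI cut)
  then show ?thesis
  proof eventually_elim
    case (elim x)
    obtain n :: nat where "x \<in> box (- (real n *\<^sub>R One)) (real n *\<^sub>R One)"
      using UN_box_eq_UNIV by blast
    then show ?case using elim[rule_format, of n] by simp
  qed
qed

subsection \<open>Integration by parts\<close>

text \<open>By translation invariance every difference quotient of \<open>F\<close> along
  \<open>e\<close> has integral 0, and the quotients converge to F' under a common bound. Neither
  Fubini nor an iterated integral enters.\<close>

lemma integral_directional_derivative_zero:
  fixes F F' :: "r3 \<Rightarrow> complex"
  assumes cont: "continuous_on UNIV F" "continuous_on UNIV F'"
    and deriv: "\<And>x. ((\<lambda>t. F (x + t *\<^sub>R e)) has_vector_derivative F' x) (at 0)"
    and supp: "\<And>x. norm x > B \<Longrightarrow> F x = 0" "\<And>x. norm x > B \<Longrightarrow> F' x = 0" and "B > 0"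
  shows "(\<integral>x. F' x \<partial>lborel) = 0"
proof -
  have [measurable]: "F \<in> borel_measurable borel" "F' \<in> borel_measurable borel"
    using cont by (auto intro: borel_measurable_continuous_onI)
  have "compact (F' ` cball 0 B)"
    by (intro compact_continuous_image continuous_on_subset[OF cont(2)]) auto
  then obtain M where M: "M > 0" "\<And>y. y \<in> F' ` cball 0 B \<Longrightarrow> norm y \<le> M"
    using compact_imp_bounded bounded_pos by metis
  have F'_bound: "norm (F' x) \<le> M" for x
    using M supp(2)[of x] by (cases "norm x > B") auto
  have deriv': "((\<lambda>t. F (x + t *\<^sub>R e)) has_vector_derivative F' (x + s *\<^sub>R e)) (at s)" for x s
  proof -
    have "((\<lambda>t. F ((x + s *\<^sub>R e) + t *\<^sub>R e)) has_vector_derivative F' (x + s *\<^sub>R e)) (at (s - s))"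
      using deriv[of "x + s *\<^sub>R e"] by simp
    moreover have "((\<lambda>t. t - s) has_vector_derivative 1) (at s)"
      by (auto intro!: derivative_eq_intros)
    ultimately have "((\<lambda>t. F (x + s *\<^sub>R e + (t - s) *\<^sub>R e)) has_vector_derivative F' (x + s *\<^sub>R e)) (at s)"
      using vector_diff_chain_at[of "\<lambda>t. t - s" 1 s "\<lambda>t. F (x + s *\<^sub>R e + t *\<^sub>R e)"]
      by (simp add: o_def)
    then show ?thesis by (simp add: algebra_simps)
  qed
  have lip: "norm (F (x + t *\<^sub>R e) - F x) \<le> M * t" if "t > 0" for x t
  proof -
    have "norm (F (x + t *\<^sub>R e) - F (x + 0 *\<^sub>R e)) \<le> M * norm (t - 0)"
    proof (rule differentiable_bound[where S="UNIV" and f'="\<lambda>s h. h *\<^sub>R F' (x + s *\<^sub>R e)"])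
      show "((\<lambda>t. F (x + t *\<^sub>R e)) has_derivative (\<lambda>h. h *\<^sub>R F' (x + s *\<^sub>R e))) (at s within UNIV)" for s
        using deriv'[of x s] by (simp add: has_vector_derivative_def)
      show "onorm (\<lambda>h. h *\<^sub>R F' (x + s *\<^sub>R e)) \<le> M" for s
        by (rule onorm_bound) (use M F'_bound in \<open>auto simp: mult.commute[of M] mult_left_mono\<close>)
    qed auto
    then show ?thesis using that by simp
  qed
  \<comment> \<open>Steps of size at most 1 keep the supports of all difference quotients inside the
    ball of radius \<open>B + norm e\<close>.\<close>
  define h where "h n = 1 / real (Suc n)" for n
  have h: "0 < h n" "h n \<le> 1" for n by (auto simp: h_def)
  have h0: "h \<longlonglongrightarrow> 0" unfolding h_def by (intro LIMSEQ_Suc lim_1_over_n)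
  define D where "D n x = (F (x + h n *\<^sub>R e) - F x) /\<^sub>R h n" for n x
  have intF: "integrable lborel F"
    using cont supp by (intro continuous_supported_integrable) auto
  have "(\<integral>x. D n x \<partial>lborel) = 0" for n
  proof -
    have "integrable lborel (\<lambda>x. F (h n *\<^sub>R e + x))"
    proof (rule continuous_supported_integrable[of _ "B + norm e"])
      show "continuous_on UNIV (\<lambda>x. F (h n *\<^sub>R e + x))"
        by (intro continuous_on_compose2[OF cont(1)] continuous_intros) auto
      fix x :: r3 assume x: "norm x > B + norm e"
      have "norm (h n *\<^sub>R e) \<le> norm e" using h[of n] by (simp add: mult_left_le_one_le)
      then show "F (h n *\<^sub>R e + x) = 0"
        using x norm_diff_ineq[of x "h n *\<^sub>R e"] by (intro supp) (simp add: add.commute)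
    qed
    then show ?thesis
      using intF integral_translate_r3[of F "h n *\<^sub>R e"] by (simp add: D_def add.commute)
  qed
  moreover have "(\<lambda>n. \<integral>x. D n x \<partial>lborel) \<longlonglongrightarrow> (\<integral>x. F' x \<partial>lborel)"
  proof (rule integral_dominated_convergence[where w="\<lambda>x. M * indicator (cball 0 (B + norm e)) x"])
    show "integrable lborel (\<lambda>x::r3. M * indicator (cball 0 (B + norm e)) x)"
      by (intro integrable_mult_right integrable_real_indicator) (use emeasure_bounded_finite[OF bounded_cball] in auto)
    show "AE x in lborel. (\<lambda>n. D n x) \<longlonglongrightarrow> F' x"
    proof (rule AE_I2)
      fix x
      have "((\<lambda>t. (F (x + t *\<^sub>R e) - F x - t *\<^sub>R F' x) /\<^sub>R norm t) \<longlongrightarrow> 0) (at 0)"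
        using deriv[of x] unfolding has_vector_derivative_def has_derivative_at_within by simp
      moreover have "filterlim h (at 0) sequentially"
        using h h0 by (auto simp: filterlim_at less_imp_neq[THEN not_sym])
      ultimately have "(\<lambda>n. (F (x + h n *\<^sub>R e) - F x - h n *\<^sub>R F' x) /\<^sub>R norm (h n)) \<longlonglongrightarrow> 0"
        by (rule filterlim_compose)
      moreover have "(F (x + h n *\<^sub>R e) - F x - h n *\<^sub>R F' x) /\<^sub>R norm (h n) = D n x - F' x" for n
        using h[of n] by (simp add: D_def scaleR_diff_right)
      ultimately show "(\<lambda>n. D n x) \<longlonglongrightarrow> F' x"
        by (simp add: LIM_zero_iff)
    qed
    show "AE x in lborel. norm (D n x) \<le> M * indicator (cball 0 (B + norm e)) x" for n
    proof (rule AE_I2)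
      fix x
      have "norm (D n x) \<le> M"
        using lip[of "h n" x] h[of n] by (simp add: D_def pos_divide_le_eq divide_inverse_commute[symmetric])
      moreover have "D n x = 0" if x: "norm x > B + norm e"
      proof -
        have "norm (h n *\<^sub>R e) \<le> norm e" using h[of n] by (simp add: mult_left_le_one_le)
        then have "F (x + h n *\<^sub>R e) = 0"
          using x norm_diff_ineq[of x "h n *\<^sub>R e"] by (intro supp) simp
        moreover have "F x = 0" using x norm_ge_zero[of e] by (intro supp) linarith
        ultimately show ?thesis by (simp add: D_def)
      qed
      ultimately show "norm (D n x) \<le> M * indicator (cball 0 (B + norm e)) x"
        using \<open>M > 0\<close> by (auto simp: indicator_def not_le)
    qed
  qed (auto simp: D_def)
  ultimately show ?thesis by (simp add: LIMSEQ_const_iff)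
qed

lemma smooth_directional:
  assumes "f differentiable at x"
  shows "((\<lambda>t. f (x + t *\<^sub>R axis i 1)) has_vector_derivative partial_deriv i f x) (at 0)"
proof -
  have "((\<lambda>t. x + t *\<^sub>R axis i 1) has_derivative (\<lambda>t. t *\<^sub>R axis i 1)) (at 0)"
    by (auto intro!: derivative_eq_intros)
  from has_derivative_compose[OF this, of f "frechet_derivative f (at x)"]
  have "((\<lambda>t. f (x + t *\<^sub>R axis i 1)) has_derivative (\<lambda>t. frechet_derivative f (at x) (t *\<^sub>R axis i 1))) (at 0)"
    using assms by (simp add: frechet_derivative_works)
  then show ?thesis
    using linear_scale[OF linear_frechet_derivative[OF assms]]
    by (simp add: has_vector_derivative_def partial_deriv_def)
qed

text \<open>The factor \<open>u\<close> has to be differentiable along a single axis only, which is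
  exactly what the chain rule for radial functions supplies.\<close>

lemma integration_by_parts:
  assumes u: "continuous_on UNIV u" "continuous_on UNIV u'"
    and du: "\<And>x. ((\<lambda>t. u (x + t *\<^sub>R axis i 1)) has_vector_derivative u' x) (at 0)"
    and w: "test_function w"
  shows "(\<integral>x. u x * partial_deriv i w x \<partial>lborel) = - (\<integral>x. u' x * w x \<partial>lborel)"
proof -
  have w': "test_function (partial_deriv i w)" using w by (rule test_function_partial)
  obtain B where B: "B > 0" "\<And>x. norm x > B \<Longrightarrow> w x = 0"
    using test_function_supportE[OF w] by blast
  obtain B' where B': "B' > 0" "\<And>x. norm x > B' \<Longrightarrow> partial_deriv i w x = 0"
    using test_function_supportE[OF w'] by blast
  have cw: "continuous_on UNIV w" "continuous_on UNIV (partial_deriv i w)"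
    using w w' by (auto intro: smooth_continuous test_function_smooth)
  have int: "integrable lborel (\<lambda>x. u x * partial_deriv i w x)" "integrable lborel (\<lambda>x. u' x * w x)"
    using B B' by (auto intro!: continuous_supported_integrable[of _ "max B B'"] continuous_on_mult u cw)
  have "(\<integral>x. u x * partial_deriv i w x + u' x * w x \<partial>lborel) = 0"
  proof (rule integral_directional_derivative_zero[where F="\<lambda>x. u x * w x" and e="axis i 1" and B="max B B'"])
    show "((\<lambda>t. u (x + t *\<^sub>R axis i 1) * w (x + t *\<^sub>R axis i 1)) has_vector_derivative
        u x * partial_deriv i w x + u' x * w x) (at 0)" for x
      using has_vector_derivative_mult[OF du[of x] smooth_directional[of w x i]]
        smooth_differentiable[OF test_function_smooth[OF w]] by simp
  qed (use B B' in \<open>auto intro!: continuous_intros u cw\<close>)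
  then show ?thesis using int by (simp add: add_eq_0_iff)
qed

subsection \<open>Radial integrals\<close>

text \<open>Polar coordinates without angles: the two measures agree on half lines, by the volume of
  a ball on one side and the primitive (4/3) \<pi> r^3 on the other, and half lines generate the
  Borel sets.\<close>

lemma distr_norm_r3:
  "distr lborel borel (norm :: r3 \<Rightarrow> real) = density lborel (\<lambda>r. ennreal (4 * pi * r\<^sup>2) * indicator {0..} r)"
    (is "?D = ?N")
proof (rule measure_eqI_generator_eq[where E="range (\<lambda>a::real. {..a})" and \<Omega>=UNIV and A="\<lambda>i::nat. {..real i}"])
  have D: "emeasure ?D {..a} = (if a \<ge> 0 then ennreal (4 / 3 * pi * a ^ 3) else 0)" for a
  proof -
    have "emeasure ?D {..a} = emeasure lborel (norm -` {..a} :: r3 set)"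
      by (simp add: emeasure_distr)
    also have "norm -` {..a} = (if a \<ge> 0 then cball 0 a else {} :: r3 set)"
      by (auto simp: mem_cball_0 dest: order_trans[OF norm_ge_zero])
    finally show ?thesis by (simp add: emeasure_cball unit_ball_vol_3)
  qed
  have N: "emeasure ?N {..a} = (if a \<ge> 0 then ennreal (4 / 3 * pi * a ^ 3) else 0)" for a
  proof (cases "a \<ge> 0")
    case True
    have "emeasure ?N {..a} = (\<integral>\<^sup>+r. ennreal (4 * pi * r\<^sup>2) * indicator {0..a} r \<partial>lborel)"
      by (subst emeasure_density) (auto intro!: nn_integral_cong simp: indicator_def)
    also have "\<dots> = ennreal (4 / 3 * pi * a ^ 3 - 4 / 3 * pi * 0 ^ 3)"
      by (rule nn_integral_FTC_Icc) (use True in \<open>auto intro!: derivative_eq_intros simp: power2_eq_square\<close>)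
    finally show ?thesis using True by simp
  next
    case False
    have z: "(indicator {0..} r * indicator {..a} r :: ennreal) = 0" for r
      using False by (auto simp: indicator_def)
    have "emeasure ?N {..a} = (\<integral>\<^sup>+r. (ennreal (4 * pi * r\<^sup>2) * indicator {0..} r) * indicator {..a} r \<partial>lborel)"
      by (subst emeasure_density) auto
    also have "\<dots> = 0"
      unfolding mult.assoc z by simp
    finally have "emeasure ?N {..a} = 0" .
    then show ?thesis using False by simp
  qed
  show "X \<in> range (\<lambda>a::real. {..a}) \<Longrightarrow> emeasure ?D X = emeasure ?N X" for X
    using D N by auto
  show "Int_stable (range (\<lambda>a::real. {..a}))"
    by (auto simp: Int_stable_def)
  show "sets ?D = sigma_sets UNIV (range (\<lambda>a::real. {..a}))" "sets ?N = sigma_sets UNIV (range (\<lambda>a::real. {..a}))"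
    by (simp_all add: borel_eq_atMost)
  show "(\<Union>i::nat. {..real i}) = UNIV"
    using real_arch_simple by auto
  show "emeasure ?D {..real i} \<noteq> \<infinity>" for i :: nat
    using D[of "real i"] by simp
qed auto

lemma nn_integral_radial:
  assumes [measurable]: "g \<in> borel_measurable borel"
  shows "(\<integral>\<^sup>+x. g (norm (x::r3)) \<partial>lborel) = (\<integral>\<^sup>+r. ennreal (4 * pi * r\<^sup>2) * g r * indicator {0..} r \<partial>lborel)"
proof -
  have "(\<integral>\<^sup>+x. g (norm (x::r3)) \<partial>lborel) = (\<integral>\<^sup>+r. g r \<partial>distr lborel borel (norm :: r3 \<Rightarrow> real))"
    by (simp add: nn_integral_distr)
  also have "\<dots> = (\<integral>\<^sup>+r. ennreal (4 * pi * r\<^sup>2) * g r * indicator {0..} r \<partial>lborel)"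
    unfolding distr_norm_r3 by (simp add: nn_integral_density mult_ac)
  finally show ?thesis .
qed

definition sig :: "r3 \<Rightarrow> real" where
  "sig x = sqrt (1 + (norm x)\<^sup>2)"

lemma sig_ge_1: "1 \<le> sig x" by (simp add: sig_def)

lemma sig_pos: "0 < sig x" using sig_ge_1[of x] by linarith

lemma norm_le_sig: "norm x \<le> sig x"
  unfolding sig_def by (rule real_le_rsqrt) simp

lemma sig_measurable [measurable]: "sig \<in> borel_measurable borel"
  unfolding sig_def[abs_def] by measurable

lemma integrable_sig_4: "integrable lborel (\<lambda>x. 1 / sig x ^ 4)"
proof (rule integrableI_bounded)
  have s4: "sig x ^ 4 = (1 + (norm x)\<^sup>2)\<^sup>2" for x
    unfolding sig_def by (metis add_nonneg_nonneg mult_2 numeral_Bit0 power_mult real_sqrt_pow2 zero_le_one zero_le_power2)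
  have "(\<integral>\<^sup>+x. ennreal (norm (1 / sig x ^ 4)) \<partial>lborel)
      = (\<integral>\<^sup>+x. ennreal (1 / (1 + (norm (x::r3))\<^sup>2)\<^sup>2) \<partial>lborel)"
    by (simp add: s4)
  also have "\<dots> = (\<integral>\<^sup>+r. ennreal (4 * pi * r\<^sup>2) * ennreal (1 / (1 + r\<^sup>2)\<^sup>2) * indicator {0..} r \<partial>lborel)"
    by (rule nn_integral_radial[of "\<lambda>r. ennreal (1 / (1 + r\<^sup>2)\<^sup>2)"]) measurable
  \<comment> \<open>The comparison function 1/(1 + r^2) has the bounded primitive arctan.\<close>
  also have "\<dots> \<le> (\<integral>\<^sup>+r. ennreal (4 * pi * (1 / (1 + r\<^sup>2))) * indicator {0..} r \<partial>lborel)"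
  proof (intro nn_integral_mono mult_right_mono)
    fix r :: real
    have "r\<^sup>2 * (1 / (1 + r\<^sup>2)\<^sup>2) \<le> 1 / (1 + r\<^sup>2)"
      by (simp add: power2_eq_square[of "1 + _"] add_pos_nonneg divide_simps)
    then have "(4 * pi) * (r\<^sup>2 * (1 / (1 + r\<^sup>2)\<^sup>2)) \<le> (4 * pi) * (1 / (1 + r\<^sup>2))"
      by (intro mult_left_mono) auto
    then show "ennreal (4 * pi * r\<^sup>2) * ennreal (1 / (1 + r\<^sup>2)\<^sup>2) \<le> ennreal (4 * pi * (1 / (1 + r\<^sup>2)))"
      by (simp add: ennreal_mult[symmetric] mult.assoc del: times_divide_eq_right)
  qed auto
  also have "\<dots> = ennreal (4 * pi * (pi / 2) - 4 * pi * arctan 0)"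
  proof (rule nn_integral_FTC_atLeast)
    show "((\<lambda>r. 4 * pi * arctan r) has_real_derivative 4 * pi * (1 / (1 + r\<^sup>2))) (at r)" for r
      by (auto intro!: derivative_eq_intros simp: divide_inverse)
    show "((\<lambda>r. 4 * pi * arctan r) \<longlongrightarrow> 4 * pi * (pi / 2)) at_top"
      by (intro tendsto_intros tendsto_arctan_at_top)
  qed auto
  also have "\<dots> < \<infinity>" by simp
  finally show "(\<integral>\<^sup>+x. ennreal (norm (1 / sig x ^ 4)) \<partial>lborel) < \<infinity>" .
qed measurable

text \<open>The exact value is wanted: it normalises the approximate identity in
  \<open>yukawa_rhs_limit\<close> to total mass 1. With s = sqrt (1 + r^2), the radial integrand 4
  \<pi> r^2 / s^5 has the primitive (4/3) \<pi> (r/s)^3, since (r/s)' = 1/s^3.\<close>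

lemma nn_integral_sig_5: "(\<integral>\<^sup>+x. ennreal (1 / sig x ^ 5) \<partial>lborel) = ennreal (4 / 3 * pi)"
proof -
  define s where "s r = sqrt (1 + r\<^sup>2)" for r :: real
  have s: "s r > 0" "s r ^ 2 = 1 + r\<^sup>2" for r by (auto simp: s_def add_pos_nonneg)
  have ds: "(s has_real_derivative r / s r) (at r)" for r
  proof -
    have "0 < 1 + r\<^sup>2" by (simp add: add_pos_nonneg)
    then show ?thesis
      unfolding s_def[abs_def] by (auto intro!: derivative_eq_intros simp: divide_simps)
  qed
  have "(\<integral>\<^sup>+x. ennreal (1 / sig x ^ 5) \<partial>lborel) = (\<integral>\<^sup>+x. ennreal (1 / s (norm (x::r3)) ^ 5) \<partial>lborel)"
    by (simp add: sig_def s_def)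
  also have "\<dots> = (\<integral>\<^sup>+r. ennreal (4 * pi * r\<^sup>2) * ennreal (1 / s r ^ 5) * indicator {0..} r \<partial>lborel)"
    unfolding s_def by (rule nn_integral_radial[of "\<lambda>r. ennreal (1 / sqrt (1 + r\<^sup>2) ^ 5)"]) measurable
  also have "\<dots> = (\<integral>\<^sup>+r. ennreal (4 * pi * r\<^sup>2 / s r ^ 5) * indicator {0..} r \<partial>lborel)"
    using s(1) by (intro nn_integral_cong) (simp add: ennreal_mult[symmetric] less_imp_le)
  also have "\<dots> = ennreal (4 / 3 * pi * 1 ^ 3 - 4 / 3 * pi * (0 / s 0) ^ 3)"
  proof (rule nn_integral_FTC_atLeast)
    show "(\<lambda>r. 4 * pi * r\<^sup>2 / s r ^ 5) \<in> borel_measurable borel"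
      unfolding s_def by measurable
    show "((\<lambda>r. 4 / 3 * pi * (r / s r) ^ 3) has_real_derivative 4 * pi * r\<^sup>2 / s r ^ 5) (at r)" for r
    proof -
      have "((\<lambda>r. r / s r) has_real_derivative (s r - r * (r / s r)) / (s r * s r)) (at r)"
        using s(1)[of r] by (auto intro!: derivative_eq_intros ds)
      moreover have "(s r - r * (r / s r)) / (s r * s r) = 1 / s r ^ 3"
      proof -
        have "s r - r * (r / s r) = (s r ^ 2 - r\<^sup>2) / s r"
          using s(1)[of r] by (simp add: field_simps power2_eq_square)
        also have "\<dots> = 1 / s r" by (simp add: s(2))
        finally show ?thesis using s(1)[of r] by (simp add: field_simps power3_eq_cube)
      qed
      ultimately have "((\<lambda>r. r / s r) has_real_derivative 1 / s r ^ 3) (at r)" by simp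
      from DERIV_power[OF this, of 3]
      have "((\<lambda>r. (r / s r) ^ 3) has_real_derivative 3 * ((r / s r)\<^sup>2 * (1 / s r ^ 3))) (at r)"
        by (simp add: mult_ac)
      from DERIV_cmult[OF this, of "4 / 3 * pi"]
      show ?thesis
        using s(1)[of r] by (simp add: power_divide mult_ac flip: power_add)
    qed
    have "((\<lambda>r::real. 1 / sqrt (1 + (inverse r)\<^sup>2)) \<longlongrightarrow> 1 / sqrt (1 + 0\<^sup>2)) at_top"
      by (intro tendsto_intros tendsto_inverse_0_at_top filterlim_ident) auto
    moreover have "1 / sqrt (1 + (inverse r)\<^sup>2) = r / s r" if "r > 0" for r
    proof -
      have "s r = r * sqrt (1 + (inverse r)\<^sup>2)"
        unfolding s_def using that
        by (intro real_sqrt_unique) (auto simp: power_mult_distrib field_simps add_pos_nonneg)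
      then show ?thesis using that by simp
    qed
    then have "\<forall>\<^sub>F r in at_top. 1 / sqrt (1 + (inverse r)\<^sup>2) = r / s r"
      by (intro eventually_mono[OF eventually_gt_at_top[of 0]])
    ultimately have "((\<lambda>r. r / s r) \<longlongrightarrow> 1 / sqrt (1 + 0\<^sup>2)) at_top"
      by (rule Lim_transform_eventually)
    then have "((\<lambda>r. r / s r) \<longlongrightarrow> 1) at_top" by simp
    then show "((\<lambda>r. 4 / 3 * pi * (r / s r) ^ 3) \<longlongrightarrow> 4 / 3 * pi * 1 ^ 3) at_top"
      by (intro tendsto_intros)
  qed (use s in \<open>auto simp: less_imp_le\<close>)
  finally show ?thesis by simp
qed

lemma integrable_sig_5: "integrable lborel (\<lambda>x. 1 / sig x ^ 5)"
  by (rule integrableI_nonneg) (auto simp: nn_integral_sig_5 sig_pos less_imp_le)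

lemma integral_sig_5: "(\<integral>x. 1 / sig x ^ 5 \<partial>lborel) = 4 / 3 * pi"
  using integral_eq_nn_integral[of "\<lambda>x. 1 / sig x ^ 5" lborel]
  by (simp add: nn_integral_sig_5 sig_pos less_imp_le)

lemma integrable_inverse_norm: "integrable lborel (\<lambda>x::r3. indicator (cball 0 R) x / norm x)"
proof (rule integrableI_nonneg)
  have "(\<integral>\<^sup>+x. ennreal (indicator (cball 0 R) x / norm (x::r3)) \<partial>lborel)
      = (\<integral>\<^sup>+x. ennreal (indicator {..R} (norm (x::r3)) / norm (x::r3)) \<partial>lborel)"
    by (intro nn_integral_cong) (auto simp: indicator_def)
  also have "\<dots> = (\<integral>\<^sup>+r. ennreal (4 * pi * r\<^sup>2) * ennreal (indicator {..R} r / r) * indicator {0..} r \<partial>lborel)"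
    by (rule nn_integral_radial[of "\<lambda>r. ennreal (indicator {..R} r / r)"]) measurable
  also have "\<dots> \<le> (\<integral>\<^sup>+r. ennreal (4 * pi * \<bar>R\<bar>) * indicator {0..\<bar>R\<bar>} r \<partial>lborel)"
  proof (intro nn_integral_mono)
    fix r :: real
    have "ennreal (4 * pi * r\<^sup>2) * ennreal (1 / r) \<le> ennreal (4 * pi * \<bar>R\<bar>)" if "0 \<le> r" "r \<le> R"
      using that by (cases "r = 0") (auto simp: ennreal_mult[symmetric] power2_eq_square intro!: ennreal_leI)
    then show "ennreal (4 * pi * r\<^sup>2) * ennreal (indicator {..R} r / r) * indicator {0..} r
        \<le> ennreal (4 * pi * \<bar>R\<bar>) * indicator {0..\<bar>R\<bar>} r"
      by (auto simp: indicator_def)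
  qed
  also have "\<dots> < \<infinity>"
    by (simp add: nn_integral_cmult_indicator ennreal_mult_less_top)
  finally show "(\<integral>\<^sup>+x. ennreal (indicator (cball 0 R) x / norm (x::r3)) \<partial>lborel) < \<infinity>" .
qed (measurable, auto)

subsection \<open>The Yukawa kernel\<close>

definition yuk :: "complex \<Rightarrow> real \<Rightarrow> complex" where
  "yuk \<kappa> t = exp (- (\<kappa> * of_real t)) / (4 * of_real pi * of_real t)"

text \<open>\<open>yuk1 = yuk' / t\<close> and \<open>yuk2 = yuk1' / t\<close>: the iterated radial derivatives \<open>(1 / t) d/dt\<close> of \<open>yuk\<close>.\<close>

definition yuk1 :: "complex \<Rightarrow> real \<Rightarrow> complex" where
  "yuk1 \<kappa> t = - (\<kappa> / of_real t ^ 2 + 1 / of_real t ^ 3) * exp (- (\<kappa> * of_real t)) / (4 * of_real pi)"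

definition yuk2 :: "complex \<Rightarrow> real \<Rightarrow> complex" where
  "yuk2 \<kappa> t = (\<kappa>\<^sup>2 / of_real t ^ 3 + 3 * \<kappa> / of_real t ^ 4 + 3 / of_real t ^ 5)
     * exp (- (\<kappa> * of_real t)) / (4 * of_real pi)"

lemma yuk_deriv:
  assumes "t > 0"
  shows "(yuk \<kappa> has_vector_derivative of_real t * yuk1 \<kappa> t) (at t)"
proof -
  have "((\<lambda>z. exp (- (\<kappa> * z)) / (4 * of_real pi * z)) has_field_derivative of_real t * yuk1 \<kappa> t) (at (of_real t))"
    using assms by (auto intro!: derivative_eq_intros simp: yuk1_def field_simps eval_nat_numeral)
  from has_vector_derivative_real_field[OF this]
  show ?thesis by (simp add: yuk_def[abs_def])
qed

lemma yuk1_deriv: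
  assumes "t > 0"
  shows "(yuk1 \<kappa> has_vector_derivative of_real t * yuk2 \<kappa> t) (at t)"
proof -
  have "((\<lambda>z. - (\<kappa> / z ^ 2 + 1 / z ^ 3) * exp (- (\<kappa> * z)) / (4 * of_real pi)) has_field_derivative
      of_real t * yuk2 \<kappa> t) (at (of_real t))"
    using assms by (auto intro!: derivative_eq_intros simp: yuk2_def) (simp add: field_simps eval_nat_numeral)
  from has_vector_derivative_real_field[OF this]
  show ?thesis by (simp add: yuk1_def[abs_def])
qed

text \<open>A radial function whose iterated derivatives (1/t) d/dt are g1 and g2 has Laplacian 3 g1
  + t^2 g2 in dimension three. So this is the Helmholtz equation away from the origin.\<close>

lemma yuk_ode:
  assumes "t > 0"
  shows "3 * yuk1 \<kappa> t + of_real t ^ 2 * yuk2 \<kappa> t = \<kappa>\<^sup>2 * yuk \<kappa> t"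
  using assms by (simp add: yuk_def yuk1_def yuk2_def field_simps eval_nat_numeral)

text \<open>
  Replacing \<open>|x|\<close> by \<open>s = sqrt (|x|\<^sup>2 + \<epsilon>\<^sup>2)\<close> makes the Yukawa kernel smooth, at the cost of the error
  \<open>\<epsilon>\<^sup>2 yuk2 \<kappa> s\<close> in the Helmholtz equation; this error is an approximate identity as \<open>\<epsilon> \<rightarrow> 0\<close>.
\<close>

definition reg_norm :: "real \<Rightarrow> r3 \<Rightarrow> real" where
  "reg_norm \<epsilon> x = sqrt ((norm x)\<^sup>2 + \<epsilon>\<^sup>2)"

context
  fixes \<epsilon> :: real
  assumes eps: "\<epsilon> > 0"
begin

lemma reg_norm_pos: "reg_norm \<epsilon> x > 0"
  using eps by (simp add: reg_norm_def add_nonneg_pos)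

lemma reg_norm_sq: "reg_norm \<epsilon> x ^ 2 = (norm x)\<^sup>2 + \<epsilon>\<^sup>2"
  by (simp add: reg_norm_def)

lemma reg_norm_continuous [continuous_intros]: "continuous_on S (reg_norm \<epsilon>)"
  unfolding reg_norm_def[abs_def] by (intro continuous_intros)

lemma reg_norm_directional:
  "((\<lambda>t. reg_norm \<epsilon> (x + t *\<^sub>R axis i 1)) has_vector_derivative x $ i / reg_norm \<epsilon> x) (at 0)"
proof -
  have n: "(norm (x + t *\<^sub>R axis i 1))\<^sup>2 = (norm x)\<^sup>2 + 2 * t * x $ i + t\<^sup>2" for t
    unfolding power2_norm_eq_inner
    by (simp add: inner_add_left inner_add_right inner_axis inner_axis' inner_commute[of "axis i 1" x] power2_eq_square algebra_simps)
  have pos: "(norm x)\<^sup>2 + \<epsilon>\<^sup>2 > 0" using eps by (simp add: add_nonneg_pos)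
  have "((\<lambda>t. sqrt ((norm x)\<^sup>2 + 2 * t * x $ i + t\<^sup>2 + \<epsilon>\<^sup>2)) has_real_derivative x $ i / reg_norm \<epsilon> x) (at 0)"
    using pos by (auto intro!: derivative_eq_intros simp: reg_norm_def divide_simps)
  then show ?thesis
    by (simp add: reg_norm_def n has_real_derivative_iff_has_vector_derivative)
qed

lemma radial_directional:
  assumes "\<And>t. t > 0 \<Longrightarrow> (g has_vector_derivative of_real t * g' t) (at t)"
  shows "((\<lambda>t. g (reg_norm \<epsilon> (x + t *\<^sub>R axis i 1))) has_vector_derivative
    of_real (x $ i) * (g' (reg_norm \<epsilon> x) :: complex)) (at 0)"
proof -
  have "(g has_vector_derivative of_real (reg_norm \<epsilon> x) * g' (reg_norm \<epsilon> x)) (at (reg_norm \<epsilon> (x + 0 *\<^sub>R axis i 1)))"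
    using assms[OF reg_norm_pos[of x]] by simp
  from vector_diff_chain_at[OF reg_norm_directional this]
  show ?thesis using reg_norm_pos[of x] by (simp add: o_def scaleR_conv_of_real)
qed

lemma yuk_reg_continuous:
  "continuous_on UNIV (\<lambda>x. yuk \<kappa> (reg_norm \<epsilon> x))"
  "continuous_on UNIV (\<lambda>x. yuk1 \<kappa> (reg_norm \<epsilon> x))"
  "continuous_on UNIV (\<lambda>x. yuk2 \<kappa> (reg_norm \<epsilon> x))"
  using reg_norm_pos[THEN less_imp_neq]
  unfolding yuk_def yuk1_def yuk2_def
  by (auto intro!: continuous_intros)

lemma yuk_reg_green:
  assumes \<phi>: "test_function \<phi>"
  shows "(\<integral>x. yuk \<kappa> (reg_norm \<epsilon> x) * (laplacian \<phi> x - \<kappa>\<^sup>2 * \<phi> x) \<partial>lborel)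
    = - (\<integral>x. of_real (\<epsilon>\<^sup>2) * yuk2 \<kappa> (reg_norm \<epsilon> x) * \<phi> x \<partial>lborel)"
proof -
  let ?s = "reg_norm \<epsilon>"
  have \<phi>1: "test_function (partial_deriv i \<phi>)" for i by (intro test_function_partial \<phi>)
  have \<phi>2: "test_function (partial_deriv i (partial_deriv i \<phi>))" for i by (intro test_function_partial \<phi>)
  note c = yuk_reg_continuous
  have cx: "continuous_on UNIV (\<lambda>x::r3. complex_of_real (x $ i))" for i by (intro continuous_intros)
  have int: "integrable lborel (\<lambda>x. h x * \<psi> x)" if h: "continuous_on UNIV h" and \<psi>: "test_function \<psi>" for h \<psi>
  proof -
    obtain B where B: "B > 0" "\<And>x. norm x > B \<Longrightarrow> \<psi> x = 0"
      using test_function_supportE[OF \<psi>] by blast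
    then show ?thesis
      using continuous_on_mult[OF h smooth_continuous[OF test_function_smooth[OF \<psi>]]]
      by (intro continuous_supported_integrable[of _ B]) auto
  qed
  define y2 where "y2 i x = yuk1 \<kappa> (?s x) + of_real (x $ i) * (of_real (x $ i) * yuk2 \<kappa> (?s x))" for i x
  have y2: "continuous_on UNIV (y2 i)" for i
    unfolding y2_def by (intro continuous_intros c cx)
  have step: "(\<integral>x. yuk \<kappa> (?s x) * partial_deriv i (partial_deriv i \<phi>) x \<partial>lborel) = (\<integral>x. y2 i x * \<phi> x \<partial>lborel)" for i
  proof -
    have "(\<integral>x. yuk \<kappa> (?s x) * partial_deriv i (partial_deriv i \<phi>) x \<partial>lborel)
        = - (\<integral>x. (of_real (x $ i) * yuk1 \<kappa> (?s x)) * partial_deriv i \<phi> x \<partial>lborel)"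
      by (intro integration_by_parts \<phi>1 c radial_directional yuk_deriv continuous_intros)
    also have "(\<integral>x. (of_real (x $ i) * yuk1 \<kappa> (?s x)) * partial_deriv i \<phi> x \<partial>lborel) = - (\<integral>x. y2 i x * \<phi> x \<partial>lborel)"
    proof (intro integration_by_parts \<phi> c y2 continuous_intros)
      fix x
      have "((\<lambda>t. x $ i + t) has_real_derivative 1) (at 0)"
        by (auto intro!: derivative_eq_intros)
      from has_vector_derivative_of_real[OF this]
      have a: "((\<lambda>t. complex_of_real ((x + t *\<^sub>R axis i 1) $ i)) has_vector_derivative 1) (at 0)"
        by (simp add: axis_def)
      have b: "((\<lambda>t. yuk1 \<kappa> (?s (x + t *\<^sub>R axis i 1))) has_vector_derivative of_real (x $ i) * yuk2 \<kappa> (?s x)) (at 0)"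
        by (intro radial_directional yuk1_deriv)
      show "((\<lambda>t. of_real ((x + t *\<^sub>R axis i 1) $ i) * yuk1 \<kappa> (?s (x + t *\<^sub>R axis i 1))) has_vector_derivative y2 i x) (at 0)"
        using has_vector_derivative_mult[OF a b] by (simp add: y2_def axis_def algebra_simps)
    qed
    finally show ?thesis by simp
  qed
  have y2_sum: "(\<Sum>i\<in>UNIV. y2 i x) = \<kappa>\<^sup>2 * yuk \<kappa> (?s x) - of_real (\<epsilon>\<^sup>2) * yuk2 \<kappa> (?s x)" for x
  proof -
    \<comment> \<open>The Laplacian produces |x|^2 where \<open>yuk_ode\<close> wants s^2; the
      difference \<epsilon>^2 is the source of the error term.\<close>
    have n: "(\<Sum>i\<in>UNIV. complex_of_real (x $ i) * of_real (x $ i)) = of_real (?s x ^ 2) - of_real (\<epsilon>\<^sup>2)"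
      unfolding reg_norm_sq power2_norm_eq_inner inner_vec_def by simp
    have "(\<Sum>i\<in>UNIV. y2 i x) = 3 * yuk1 \<kappa> (?s x) + (\<Sum>i\<in>UNIV. complex_of_real (x $ i) * of_real (x $ i)) * yuk2 \<kappa> (?s x)"
      by (simp add: y2_def sum.distrib sum_distrib_right mult.assoc)
    then show ?thesis
      using yuk_ode[OF reg_norm_pos[of x], of \<kappa>] unfolding n by (simp add: algebra_simps)
  qed
  have "(\<integral>x. yuk \<kappa> (?s x) * (laplacian \<phi> x - \<kappa>\<^sup>2 * \<phi> x) \<partial>lborel)
      = (\<integral>x. (\<Sum>i\<in>UNIV. yuk \<kappa> (?s x) * partial_deriv i (partial_deriv i \<phi>) x) - \<kappa>\<^sup>2 * (yuk \<kappa> (?s x) * \<phi> x) \<partial>lborel)"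
    by (simp add: laplacian_def right_diff_distrib sum_distrib_left mult_ac)
  also have "\<dots> = (\<Sum>i\<in>UNIV. \<integral>x. y2 i x * \<phi> x \<partial>lborel) - (\<integral>x. \<kappa>\<^sup>2 * (yuk \<kappa> (?s x) * \<phi> x) \<partial>lborel)"
    using int[OF c(1) \<phi>2] int[OF c(1) \<phi>]
    by (subst Bochner_Integration.integral_diff) (auto simp: step)
  also have "(\<Sum>i\<in>UNIV. \<integral>x. y2 i x * \<phi> x \<partial>lborel) = (\<integral>x. (\<Sum>i\<in>UNIV. y2 i x * \<phi> x) \<partial>lborel)"
    using int[OF y2 \<phi>] by simp
  also have "(\<lambda>x. \<Sum>i\<in>UNIV. y2 i x * \<phi> x)
      = (\<lambda>x. \<kappa>\<^sup>2 * (yuk \<kappa> (?s x) * \<phi> x) - of_real (\<epsilon>\<^sup>2) * yuk2 \<kappa> (?s x) * \<phi> x)"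
    unfolding sum_distrib_right[symmetric] y2_sum by (simp add: algebra_simps)
  also have "(\<integral>x. \<kappa>\<^sup>2 * (yuk \<kappa> (?s x) * \<phi> x) - of_real (\<epsilon>\<^sup>2) * yuk2 \<kappa> (?s x) * \<phi> x \<partial>lborel)
      = (\<integral>x. \<kappa>\<^sup>2 * (yuk \<kappa> (?s x) * \<phi> x) \<partial>lborel) - (\<integral>x. of_real (\<epsilon>\<^sup>2) * yuk2 \<kappa> (?s x) * \<phi> x \<partial>lborel)"
    using int[OF c(1) \<phi>] int[OF c(3) \<phi>] by (intro Bochner_Integration.integral_diff) (auto simp: mult.assoc)
  finally show ?thesis by simp
qed

lemma reg_norm_scale: "reg_norm \<epsilon> (\<epsilon> *\<^sub>R y) = \<epsilon> * sig y"
proof -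
  have "(norm (\<epsilon> *\<^sub>R y))\<^sup>2 + \<epsilon>\<^sup>2 = \<epsilon>\<^sup>2 * (1 + (norm y)\<^sup>2)"
    by (simp add: power_mult_distrib algebra_simps)
  then show ?thesis using eps by (simp add: reg_norm_def sig_def real_sqrt_mult)
qed

text \<open>Under x = \<epsilon> y the regularised norm becomes \<epsilon> times
  \<open>sig y\<close>. The last of the three terms of \<open>yuk2\<close> turns scale free and
  survives the limit; the other two keep the factors \<epsilon>^2 and \<epsilon>.\<close>

lemma yuk_reg_rescale:
  assumes \<phi>: "test_function \<phi>"
  shows "(\<integral>x. of_real (\<epsilon>\<^sup>2) * yuk2 \<kappa> (reg_norm \<epsilon> x) * \<phi> x \<partial>lborel)
    = (\<integral>y. (\<kappa>\<^sup>2 * of_real (\<epsilon>\<^sup>2 / sig y ^ 3) + 3 * \<kappa> * of_real (\<epsilon> / sig y ^ 4) + of_real (3 / sig y ^ 5))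
        * exp (- (\<kappa> * of_real (\<epsilon> * sig y))) / (4 * of_real pi) * \<phi> (\<epsilon> *\<^sub>R y) \<partial>lborel)"
proof -
  have "(\<lambda>x. of_real (\<epsilon>\<^sup>2) * yuk2 \<kappa> (reg_norm \<epsilon> x) * \<phi> x) \<in> borel_measurable borel"
    by (intro borel_measurable_continuous_onI continuous_intros yuk_reg_continuous smooth_continuous test_function_smooth \<phi>)
  from integral_affine_r3[OF this, of \<epsilon> 0]
  have "(\<integral>x. of_real (\<epsilon>\<^sup>2) * yuk2 \<kappa> (reg_norm \<epsilon> x) * \<phi> x \<partial>lborel)
      = (\<integral>y. \<epsilon> ^ 3 *\<^sub>R (of_real (\<epsilon>\<^sup>2) * yuk2 \<kappa> (\<epsilon> * sig y) * \<phi> (\<epsilon> *\<^sub>R y)) \<partial>lborel)"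
    using eps by (simp add: reg_norm_scale)
  also have "(\<lambda>y. \<epsilon> ^ 3 *\<^sub>R (of_real (\<epsilon>\<^sup>2) * yuk2 \<kappa> (\<epsilon> * sig y) * \<phi> (\<epsilon> *\<^sub>R y)))
    = (\<lambda>y. (\<kappa>\<^sup>2 * of_real (\<epsilon>\<^sup>2 / sig y ^ 3) + 3 * \<kappa> * of_real (\<epsilon> / sig y ^ 4) + of_real (3 / sig y ^ 5))
        * exp (- (\<kappa> * of_real (\<epsilon> * sig y))) / (4 * of_real pi) * \<phi> (\<epsilon> *\<^sub>R y))"
  proof
    fix y
    have "complex_of_real \<epsilon> ^ 3 * of_real (\<epsilon>\<^sup>2) * (\<kappa>\<^sup>2 / of_real (\<epsilon> * sig y) ^ 3 + 3 * \<kappa> / of_real (\<epsilon> * sig y) ^ 4 + 3 / of_real (\<epsilon> * sig y) ^ 5)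
        = \<kappa>\<^sup>2 * of_real (\<epsilon>\<^sup>2 / sig y ^ 3) + 3 * \<kappa> * of_real (\<epsilon> / sig y ^ 4) + of_real (3 / sig y ^ 5)"
      using eps sig_pos[of y] by (simp add: field_simps eval_nat_numeral)
    then show "\<epsilon> ^ 3 *\<^sub>R (of_real (\<epsilon>\<^sup>2) * yuk2 \<kappa> (\<epsilon> * sig y) * \<phi> (\<epsilon> *\<^sub>R y))
      = (\<kappa>\<^sup>2 * of_real (\<epsilon>\<^sup>2 / sig y ^ 3) + 3 * \<kappa> * of_real (\<epsilon> / sig y ^ 4) + of_real (3 / sig y ^ 5))
        * exp (- (\<kappa> * of_real (\<epsilon> * sig y))) / (4 * of_real pi) * \<phi> (\<epsilon> *\<^sub>R y)"
      unfolding yuk2_def scaleR_conv_of_real by (simp add: mult.assoc[symmetric])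
  qed
  finally show ?thesis .
qed

end

section \<open>Removing the regularisation\<close>

lemma AE_nonzero_r3: "AE x in lborel. x \<noteq> (0::r3)"
  by (rule AE_lborel_singleton)

lemma yuk_bound: "Re \<kappa> \<ge> 0 \<Longrightarrow> t > 0 \<Longrightarrow> norm (yuk \<kappa> t) \<le> 1 / (4 * pi * t)"
  by (simp add: yuk_def norm_divide norm_mult divide_right_mono)

lemma yukawa_lhs_limit:
  assumes \<psi>: "test_function \<psi>" and \<kappa>: "Re \<kappa> \<ge> 0" and e: "\<And>n. e n > 0" "e \<longlonglongrightarrow> 0"
  shows "(\<lambda>n. \<integral>x. yuk \<kappa> (reg_norm (e n) x) * \<psi> x \<partial>lborel) \<longlonglongrightarrow> (\<integral>x. yuk \<kappa> (norm x) * \<psi> x \<partial>lborel)"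
proof -
  obtain B where B: "B > 0" "\<And>x. norm x > B \<Longrightarrow> \<psi> x = 0"
    using test_function_supportE[OF \<psi>] by blast
  obtain M where M: "M > 0" "\<And>x. norm (\<psi> x) \<le> M" using test_function_bounded[OF \<psi>] by blast
  have [measurable]: "\<psi> \<in> borel_measurable borel" using \<psi> by (rule test_function_measurable)
  show ?thesis
  proof (rule integral_dominated_convergence[where w="\<lambda>x. M / (4 * pi) * (indicator (cball 0 B) x / norm x)"])
    show "integrable lborel (\<lambda>x::r3. M / (4 * pi) * (indicator (cball 0 B) x / norm x))"
      by (intro integrable_mult_right integrable_inverse_norm)
    show "AE x in lborel. (\<lambda>n. yuk \<kappa> (reg_norm (e n) x) * \<psi> x) \<longlonglongrightarrow> yuk \<kappa> (norm x) * \<psi> x"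
      using AE_nonzero_r3
    proof eventually_elim
      case (elim x)
      have "(\<lambda>n. reg_norm (e n) x) \<longlonglongrightarrow> sqrt ((norm x)\<^sup>2 + 0\<^sup>2)"
        unfolding reg_norm_def by (intro tendsto_intros e)
      then have "(\<lambda>n. reg_norm (e n) x) \<longlonglongrightarrow> norm x" by simp
      then show ?case
        unfolding yuk_def using elim by (intro tendsto_intros) auto
    qed
    show "AE x in lborel. norm (yuk \<kappa> (reg_norm (e n) x) * \<psi> x) \<le> M / (4 * pi) * (indicator (cball 0 B) x / norm x)" for n
      using AE_nonzero_r3
    proof eventually_elim
      case (elim x)
      have "norm x \<le> reg_norm (e n) x"
        unfolding reg_norm_def by (rule real_le_rsqrt) simp
      then have "norm (yuk \<kappa> (reg_norm (e n) x)) \<le> 1 / (4 * pi * norm x)"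
        using yuk_bound[OF \<kappa> reg_norm_pos[OF e(1)[of n]], of x] elim
        by (elim order_trans) (intro divide_left_mono mult_left_mono mult_pos_pos, auto simp: reg_norm_pos e)
      then have "norm (yuk \<kappa> (reg_norm (e n) x)) * norm (\<psi> x) \<le> 1 / (4 * pi * norm x) * M"
        using M(2)[of x] by (intro mult_mono) auto
      then show ?case
        using B(2)[of x] by (cases "norm x > B") (auto simp: norm_mult indicator_def mult.commute)
    qed
    have "continuous_on UNIV (\<lambda>x. yuk \<kappa> (reg_norm (e n) x) * \<psi> x)" for n
      by (intro continuous_intros yuk_reg_continuous e smooth_continuous test_function_smooth \<psi>)
    then show "(\<lambda>x. yuk \<kappa> (reg_norm (e n) x) * \<psi> x) \<in> borel_measurable lborel" for n
      by (simp add: borel_measurable_continuous_onI)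
    show "(\<lambda>x. yuk \<kappa> (norm x) * \<psi> x) \<in> borel_measurable lborel"
      unfolding yuk_def by measurable
  qed
qed

lemma yukawa_rhs_limit:
  assumes \<phi>: "test_function \<phi>" and \<kappa>: "Re \<kappa> \<ge> 0" and e: "\<And>n. e n > 0" "\<And>n. e n \<le> 1" "e \<longlonglongrightarrow> 0"
  shows "(\<lambda>n. \<integral>y. (\<kappa>\<^sup>2 * of_real ((e n)\<^sup>2 / sig y ^ 3) + 3 * \<kappa> * of_real (e n / sig y ^ 4) + of_real (3 / sig y ^ 5))
        * exp (- (\<kappa> * of_real (e n * sig y))) / (4 * of_real pi) * \<phi> (e n *\<^sub>R y) \<partial>lborel) \<longlonglongrightarrow> \<phi> 0"
proof -
  let ?F = "\<lambda>n y. (\<kappa>\<^sup>2 * of_real ((e n)\<^sup>2 / sig y ^ 3) + 3 * \<kappa> * of_real (e n / sig y ^ 4) + of_real (3 / sig y ^ 5))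
    * exp (- (\<kappa> * of_real (e n * sig y))) / (4 * of_real pi) * \<phi> (e n *\<^sub>R y)"
  obtain B where B: "B > 0" "\<And>x. norm x > B \<Longrightarrow> \<phi> x = 0"
    using test_function_supportE[OF \<phi>] by blast
  obtain M where M: "M > 0" "\<And>x. norm (\<phi> x) \<le> M" using test_function_bounded[OF \<phi>] by blast
  have [measurable]: "\<phi> \<in> borel_measurable borel" using \<phi> by (rule test_function_measurable)
  define K where "K = ((norm \<kappa>)\<^sup>2 * (B + 1) + 3 * norm \<kappa> + 3) / (4 * pi) * M"
  have "(\<lambda>n. \<integral>y. ?F n y \<partial>lborel)
     \<longlonglongrightarrow> (\<integral>y. of_real (1 / sig y ^ 5) * (3 / (4 * of_real pi) * \<phi> 0) \<partial>lborel)"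
  proof (rule integral_dominated_convergence[where w="\<lambda>y. K * (1 / sig y ^ 4)"])
    show "integrable lborel (\<lambda>y. K * (1 / sig y ^ 4))"
      by (intro integrable_mult_right integrable_sig_4)
    show "AE y in lborel. (\<lambda>n. ?F n y)
      \<longlonglongrightarrow> of_real (1 / sig y ^ 5) * (3 / (4 * of_real pi) * \<phi> 0)"
    proof (rule AE_I2)
      fix y :: r3
      have "(\<lambda>n. e n *\<^sub>R y) \<longlonglongrightarrow> 0 *\<^sub>R y" by (intro tendsto_scaleR[OF e(3) tendsto_const])
      then have "(\<lambda>n. \<phi> (e n *\<^sub>R y)) \<longlonglongrightarrow> \<phi> (0 *\<^sub>R y)"
        using smooth_continuous[OF test_function_smooth[OF \<phi>], of UNIV]
        by (intro continuous_on_tendsto_compose[of UNIV \<phi>]) auto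
      then have "(\<lambda>n. ?F n y)
        \<longlonglongrightarrow> (\<kappa>\<^sup>2 * of_real (0\<^sup>2 / sig y ^ 3) + 3 * \<kappa> * of_real (0 / sig y ^ 4) + of_real (3 / sig y ^ 5))
          * exp (- (\<kappa> * of_real (0 * sig y))) / (4 * of_real pi) * \<phi> (0 *\<^sub>R y)"
        using sig_pos[of y] by (intro tendsto_intros e) auto
      then show "(\<lambda>n. ?F n y)
        \<longlonglongrightarrow> of_real (1 / sig y ^ 5) * (3 / (4 * of_real pi) * \<phi> 0)"
        by simp
    qed
    show "AE y in lborel. norm (?F n y) \<le> K * (1 / sig y ^ 4)" for n
    proof (rule AE_I2)
      fix y
      let ?A = "\<kappa>\<^sup>2 * of_real ((e n)\<^sup>2 / sig y ^ 3) + 3 * \<kappa> * of_real (e n / sig y ^ 4) + of_real (3 / sig y ^ 5)"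
      note s = sig_pos[of y] sig_ge_1[of y]
      show "norm (?A * exp (- (\<kappa> * of_real (e n * sig y))) / (4 * of_real pi) * \<phi> (e n *\<^sub>R y)) \<le> K * (1 / sig y ^ 4)"
      proof (cases "norm (e n *\<^sub>R y) > B")
        case True
        have "K \<ge> 0" using M B by (simp add: K_def)
        then show ?thesis using True B s by simp
      next
        case False
        have "e n * norm y \<le> B" using False e(1)[of n] by (simp add: not_less)
        moreover have "sig y \<le> 1 + norm y"
          unfolding sig_def by (rule real_le_lsqrt) (auto simp: power2_eq_square algebra_simps)
        then have "e n * sig y \<le> e n * (1 + norm y)" using e(1)[of n] by (intro mult_left_mono) auto
        \<comment> \<open>The first term decays only like 1/\<open>sig y\<close> cubed, which is not
          integrable on the whole space. On the support of the rescaled test function one factor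
          \<epsilon> \<open>sig y\<close> is bounded, which gains the missing power.\<close>
        ultimately have es: "e n * sig y \<le> B + 1" using e(2)[of n] by (simp add: algebra_simps)
        have "(e n)\<^sup>2 / sig y ^ 3 = e n * (e n * sig y) * (1 / sig y ^ 4)"
          using s by (simp add: field_simps eval_nat_numeral)
        also have "\<dots> \<le> 1 * (B + 1) * (1 / sig y ^ 4)"
          using es s e(2)[of n] less_imp_le[OF e(1)[of n]] B by (intro mult_right_mono mult_mono) auto
        finally have 1: "(e n)\<^sup>2 / sig y ^ 3 \<le> (B + 1) * (1 / sig y ^ 4)" by simp
        have 2: "e n / sig y ^ 4 \<le> 1 / sig y ^ 4"
          using s e(2)[of n] by (intro divide_right_mono) auto
        have 3: "3 / sig y ^ 5 \<le> 3 * (1 / sig y ^ 4)"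
          using s by (simp add: field_simps eval_nat_numeral)
        have "norm ?A \<le> norm (\<kappa>\<^sup>2 * of_real ((e n)\<^sup>2 / sig y ^ 3)) + norm (3 * \<kappa> * of_real (e n / sig y ^ 4)) + norm (complex_of_real (3 / sig y ^ 5))"
          by (intro norm_triangle_le add_right_mono norm_triangle_ineq)
        also have "\<dots> = (norm \<kappa>)\<^sup>2 * ((e n)\<^sup>2 / sig y ^ 3) + 3 * norm \<kappa> * (e n / sig y ^ 4) + 3 / sig y ^ 5"
          using s less_imp_le[OF e(1)[of n]] by (simp only: norm_mult norm_of_real norm_power) (simp add: abs_of_pos)
        also have "\<dots> \<le> (norm \<kappa>)\<^sup>2 * ((B + 1) * (1 / sig y ^ 4)) + 3 * norm \<kappa> * (1 / sig y ^ 4) + 3 * (1 / sig y ^ 4)"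
          by (intro add_mono mult_left_mono 1 2 3) auto
        also have "\<dots> = ((norm \<kappa>)\<^sup>2 * (B + 1) + 3 * norm \<kappa> + 3) * (1 / sig y ^ 4)"
          by (simp add: algebra_simps add_divide_distrib)
        finally have A: "norm ?A \<le> ((norm \<kappa>)\<^sup>2 * (B + 1) + 3 * norm \<kappa> + 3) * (1 / sig y ^ 4)" .
        have E: "norm (exp (- (\<kappa> * of_real (e n * sig y)))) \<le> 1"
          using \<kappa> e(1)[of n] s by simp
        have "norm (?A * exp (- (\<kappa> * of_real (e n * sig y))) / (4 * of_real pi) * \<phi> (e n *\<^sub>R y))
            = norm ?A * norm (exp (- (\<kappa> * of_real (e n * sig y)))) / (4 * pi) * norm (\<phi> (e n *\<^sub>R y))"
          by (simp only: norm_mult norm_divide norm_of_real) simp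
        also have "\<dots> \<le> (((norm \<kappa>)\<^sup>2 * (B + 1) + 3 * norm \<kappa> + 3) * (1 / sig y ^ 4)) * 1 / (4 * pi) * M"
          using A E M B s by (intro mult_mono divide_right_mono) auto
        also have "\<dots> = K * (1 / sig y ^ 4)" by (simp add: K_def)
        finally show ?thesis .
      qed
    qed
  qed measurable
  also have "(\<integral>y. complex_of_real (1 / sig y ^ 5) * (3 / (4 * of_real pi) * \<phi> 0) \<partial>lborel)
      = of_real (\<integral>y. 1 / sig y ^ 5 \<partial>lborel) * (3 / (4 * of_real pi) * \<phi> 0)"
    using integrable_sig_5 by (subst integral_mult_left_zero) (simp only: integral_complex_of_real)
  also have "\<dots> = \<phi> 0" by (simp add: integral_sig_5)
  finally show ?thesis .
qed

lemma yukawa_fundamental_0: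
  assumes \<phi>: "test_function \<phi>" and \<kappa>: "Re \<kappa> \<ge> 0"
  shows "(\<integral>x. yuk \<kappa> (norm x) * (laplacian \<phi> x - \<kappa>\<^sup>2 * \<phi> x) \<partial>lborel) = - \<phi> 0"
proof -
  define e where "e n = 1 / real (Suc n)" for n
  have e: "e n > 0" "e n \<le> 1" for n
    unfolding e_def by auto
  have e0: "e \<longlonglongrightarrow> 0"
    unfolding e_def by (intro LIMSEQ_Suc lim_1_over_n)
  have "test_function (\<lambda>x. laplacian \<phi> x + (- \<kappa>\<^sup>2) * \<phi> x)"
    by (intro test_function_add test_function_laplacian test_function_cmult \<phi>)
  then have "test_function (\<lambda>x. laplacian \<phi> x - \<kappa>\<^sup>2 * \<phi> x)" by simp
  from yukawa_lhs_limit[OF this \<kappa> e(1) e0]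
  have "(\<lambda>n. - (\<integral>x. of_real ((e n)\<^sup>2) * yuk2 \<kappa> (reg_norm (e n) x) * \<phi> x \<partial>lborel))
      \<longlonglongrightarrow> (\<integral>x. yuk \<kappa> (norm x) * (laplacian \<phi> x - \<kappa>\<^sup>2 * \<phi> x) \<partial>lborel)"
    by (simp add: yuk_reg_green[OF e(1) \<phi>])
  moreover have "(\<lambda>n. - (\<integral>x. of_real ((e n)\<^sup>2) * yuk2 \<kappa> (reg_norm (e n) x) * \<phi> x \<partial>lborel)) \<longlonglongrightarrow> - \<phi> 0"
    unfolding yuk_reg_rescale[OF e(1) \<phi>] by (intro tendsto_minus yukawa_rhs_limit \<phi> \<kappa> e e0)
  ultimately show ?thesis by (rule LIMSEQ_unique)
qed

lemma laplacian_affine: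
  assumes "smooth f"
  shows "laplacian (\<lambda>x. f (a *\<^sub>R x + b)) x = of_real (a\<^sup>2) * laplacian f (a *\<^sub>R x + b)"
proof -
  have 1: "partial_deriv i (\<lambda>x. f (a *\<^sub>R x + b)) = (\<lambda>x. of_real a * partial_deriv i f (a *\<^sub>R x + b))" for i
    using smooth_differentiable[OF assms] by (auto simp: partial_deriv_affine)
  have 2: "partial_deriv i (\<lambda>x. of_real a * partial_deriv i f (a *\<^sub>R x + b)) x
      = of_real a * (of_real a * partial_deriv i (partial_deriv i f) (a *\<^sub>R x + b))" for i
    using smooth_differentiable[OF smooth_partial[OF assms]]
    by (subst partial_deriv_cmult) (auto simp: partial_deriv_affine)
  show ?thesis
    unfolding laplacian_def 1 2 by (simp add: sum_distrib_left power2_eq_square mult.assoc)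
qed

subsection \<open>The free resolvent kernel\<close>

text \<open>The value at \<open>0\<close> is the limit, so that the Taylor expansion in \<open>\<mu>\<close> holds for every \<open>r \<ge> 0\<close>.\<close>

definition res_kernel :: "complex \<Rightarrow> real \<Rightarrow> complex" where
  "res_kernel \<mu> r = (if r = 0 then (1 + \<i>) / (8 * of_real pi * \<mu>)
     else (exp (\<i> * \<mu> * of_real r) - exp (- (\<mu> * of_real r))) / (8 * of_real pi * \<mu>\<^sup>2 * of_real r))"

lemma res_kernel_measurable [measurable]: "res_kernel \<mu> \<in> borel_measurable borel"
  unfolding res_kernel_def[abs_def] by measurable

lemma laplacian_lincomb:
  assumes f: "smooth f" and g: "smooth g"
  shows "laplacian (\<lambda>x. f x + c * g x) = (\<lambda>x. laplacian f x + c * laplacian g x)"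
proof
  fix x
  have 1: "partial_deriv i (\<lambda>x. f x + c * g x) = (\<lambda>x. partial_deriv i f x + c * partial_deriv i g x)"
    if "smooth f" "smooth g" for f g i
    using that[THEN smooth_differentiable] by (auto simp: partial_deriv_add partial_deriv_cmult)
  show "laplacian (\<lambda>x. f x + c * g x) x = laplacian f x + c * laplacian g x"
    unfolding laplacian_def 1[OF f g] 1[OF smooth_partial[OF f] smooth_partial[OF g]]
    by (simp add: sum.distrib sum_distrib_left)
qed

lemma integrable_yuk_test:
  assumes \<psi>: "test_function \<psi>" and \<kappa>: "Re \<kappa> \<ge> 0"
  shows "integrable lborel (\<lambda>x. yuk \<kappa> (norm x) * \<psi> x)"
proof -
  obtain B where B: "B > 0" "\<And>x. norm x > B \<Longrightarrow> \<psi> x = 0"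
    using test_function_supportE[OF \<psi>] by blast
  obtain M where M: "M > 0" "\<And>x. norm (\<psi> x) \<le> M" using test_function_bounded[OF \<psi>] by blast
  have [measurable]: "\<psi> \<in> borel_measurable borel" using \<psi> by (rule test_function_measurable)
  show ?thesis
  proof (rule Bochner_Integration.integrable_bound[where f="\<lambda>x. M / (4 * pi) * (indicator (cball 0 B) x / norm x)"])
    show "integrable lborel (\<lambda>x::r3. M / (4 * pi) * (indicator (cball 0 B) x / norm x))"
      by (intro integrable_mult_right integrable_inverse_norm)
    show "(\<lambda>x. yuk \<kappa> (norm x) * \<psi> x) \<in> borel_measurable lborel"
      unfolding yuk_def by measurable
    show "AE x in lborel. norm (yuk \<kappa> (norm x) * \<psi> x) \<le> norm (M / (4 * pi) * (indicator (cball 0 B) x / norm x))"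
      using AE_nonzero_r3
    proof eventually_elim
      case (elim x)
      then have "norm (yuk \<kappa> (norm x)) * norm (\<psi> x) \<le> 1 / (4 * pi * norm x) * M"
        using M(2)[of x] by (intro mult_mono yuk_bound \<kappa>) auto
      then show ?case
        using B(2)[of x] M by (cases "norm x > B") (auto simp: norm_mult indicator_def mult.commute)
    qed
  qed
qed

lemma nn_integral_sig_4_shift:
  "(\<integral>\<^sup>+y. ennreal (1 / sig (x - y) ^ 4) \<partial>lborel) = ennreal (\<integral>y. 1 / sig y ^ 4 \<partial>lborel)"
  "(\<integral>\<^sup>+y. ennreal (1 / sig (y - x) ^ 4) \<partial>lborel) = ennreal (\<integral>y. 1 / sig y ^ 4 \<partial>lborel)"
  using nn_integral_reflect_r3[of "\<lambda>y. ennreal (1 / sig y ^ 4)" x]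
    nn_integral_translate_r3[of "\<lambda>y. ennreal (1 / sig y ^ 4)" x]
    nn_integral_eq_integral[OF integrable_sig_4]
  by (simp_all add: sig_pos less_imp_le)

definition sig4_int :: real where "sig4_int = (\<integral>y. 1 / sig y ^ 4 \<partial>lborel)"

lemma sig4_int_nonneg: "0 \<le> sig4_int"
  unfolding sig4_int_def by (intro Bochner_Integration.integral_nonneg) (simp add: sig_pos less_imp_le)

context
  fixes \<mu> :: complex
  assumes quadrant: "Re \<mu> > 0" "Im \<mu> > 0"
begin

lemma mu_nonzero: "\<mu> \<noteq> 0"
  using quadrant by auto

lemma res_kernel_yuk: "r \<noteq> 0 \<Longrightarrow> res_kernel \<mu> r = (yuk (- \<i> * \<mu>) r - yuk \<mu> r) / (2 * \<mu>\<^sup>2)"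
  by (simp add: res_kernel_def yuk_def diff_divide_distrib mult_ac)

text \<open>Write \<Delta>^2 - \<mu>^4 as a product of Helmholtz operators in both orders: the
  Yukawa identity with \<kappa> = -i \<mu> is applied to \<Delta>\<phi> - \<mu>^2 \<phi>, the one
  with \<kappa> = \<mu> to \<Delta>\<phi> + \<mu>^2 \<phi>. In the difference the values of
  \<Delta>\<phi> at 0 cancel and 2 \<mu>^2 \<phi>(0) is left. Both choices of \<kappa> have positive
  real part in the first quadrant.\<close>

lemma res_kernel_fundamental_0:
  assumes \<phi>: "test_function \<phi>"
  shows "(\<integral>x. res_kernel \<mu> (norm x) * (laplacian (laplacian \<phi>) x - \<mu> ^ 4 * \<phi> x) \<partial>lborel) = \<phi> 0"
proof -
  let ?E = "yuk (- \<i> * \<mu>)" and ?F = "yuk \<mu>"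
  let ?\<theta> = "\<lambda>x. laplacian (laplacian \<phi>) x - \<mu> ^ 4 * \<phi> x"
  have L: "test_function (laplacian \<phi>)" by (intro test_function_laplacian \<phi>)
  have LL: "test_function (laplacian (laplacian \<phi>))" by (intro test_function_laplacian L)
  have lin: "test_function (\<lambda>x. laplacian \<phi> x + c * \<phi> x)" for c
    by (intro test_function_add L test_function_cmult \<phi>)
  have th: "test_function (\<lambda>x. laplacian (laplacian \<phi>) x + (- (\<mu> ^ 4)) * \<phi> x)"
    by (intro test_function_add LL test_function_cmult \<phi>)
  then have th: "test_function ?\<theta>" by simp
  have fac: "laplacian (\<lambda>x. laplacian \<phi> x + c * \<phi> x) x - c * (laplacian \<phi> x + c * \<phi> x)
      = laplacian (laplacian \<phi>) x - c\<^sup>2 * \<phi> x" for c x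
    unfolding laplacian_lincomb[OF test_function_smooth[OF L] test_function_smooth[OF \<phi>]]
    by (simp add: algebra_simps power2_eq_square)
  have "(\<integral>x. ?E (norm x) * ?\<theta> x \<partial>lborel) = - (laplacian \<phi> 0 - \<mu>\<^sup>2 * \<phi> 0)"
    using yukawa_fundamental_0[OF lin[of "- \<mu>\<^sup>2"], of "- \<i> * \<mu>"] quadrant fac[of "- \<mu>\<^sup>2"]
    by (simp add: power_mult_distrib flip: power_mult)
  moreover have "(\<integral>x. ?F (norm x) * ?\<theta> x \<partial>lborel) = - (laplacian \<phi> 0 + \<mu>\<^sup>2 * \<phi> 0)"
    using yukawa_fundamental_0[OF lin[of "\<mu>\<^sup>2"], of "\<mu>"] quadrant fac[of "\<mu>\<^sup>2"]
    by (simp flip: power_mult)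
  ultimately have "(\<integral>x. ?E (norm x) * ?\<theta> x - ?F (norm x) * ?\<theta> x \<partial>lborel) = 2 * \<mu>\<^sup>2 * \<phi> 0"
    using integrable_yuk_test[OF th, of "- \<i> * \<mu>"] integrable_yuk_test[OF th, of \<mu>] quadrant
    by (subst Bochner_Integration.integral_diff) auto
  then have eq: "(\<integral>x. (?E (norm x) * ?\<theta> x - ?F (norm x) * ?\<theta> x) / (2 * \<mu>\<^sup>2) \<partial>lborel) = \<phi> 0"
    using mu_nonzero by simp
  have [measurable]: "?\<theta> \<in> borel_measurable borel" using th by (rule test_function_measurable)
  have "(\<integral>x. res_kernel \<mu> (norm x) * ?\<theta> x \<partial>lborel)
      = (\<integral>x. (?E (norm x) * ?\<theta> x - ?F (norm x) * ?\<theta> x) / (2 * \<mu>\<^sup>2) \<partial>lborel)"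
  proof (rule integral_cong_AE)
    show "AE x in lborel. res_kernel \<mu> (norm x) * ?\<theta> x = (?E (norm x) * ?\<theta> x - ?F (norm x) * ?\<theta> x) / (2 * \<mu>\<^sup>2)"
      using AE_nonzero_r3 by eventually_elim (simp add: res_kernel_yuk left_diff_distrib diff_divide_distrib)
    show "(\<lambda>x. res_kernel \<mu> (norm x) * ?\<theta> x) \<in> borel_measurable lborel"
      unfolding res_kernel_def by measurable
    show "(\<lambda>x. (?E (norm x) * ?\<theta> x - ?F (norm x) * ?\<theta> x) / (2 * \<mu>\<^sup>2)) \<in> borel_measurable lborel"
      unfolding yuk_def by measurable
  qed
  then show ?thesis using eq by simp
qed

lemma res_kernel_fundamental:
  assumes \<phi>: "test_function \<phi>"
  shows "(\<integral>y. res_kernel \<mu> (norm (x - y)) * (laplacian (laplacian \<phi>) y - \<mu> ^ 4 * \<phi> y) \<partial>lborel) = \<phi> x"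
proof -
  have L: "test_function (laplacian \<phi>)" by (intro test_function_laplacian \<phi>)
  have [measurable]: "\<phi> \<in> borel_measurable borel" "laplacian (laplacian \<phi>) \<in> borel_measurable borel"
    by (intro test_function_measurable test_function_laplacian \<phi>)+
  have m: "(\<lambda>y. res_kernel \<mu> (norm (x - y)) * (laplacian (laplacian \<phi>) y - \<mu> ^ 4 * \<phi> y)) \<in> borel_measurable borel"
    by measurable
  have t: "test_function (\<lambda>z. \<phi> (1 *\<^sub>R z + x))" by (intro test_function_affine \<phi>) simp
  have 1: "laplacian (\<lambda>z. \<phi> (1 *\<^sub>R z + x)) = (\<lambda>z. laplacian \<phi> (1 *\<^sub>R z + x))"
    using laplacian_affine[OF test_function_smooth[OF \<phi>], of 1 x] by auto
  have 2: "laplacian (\<lambda>z. laplacian \<phi> (1 *\<^sub>R z + x)) = (\<lambda>z. laplacian (laplacian \<phi>) (1 *\<^sub>R z + x))"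
    using laplacian_affine[OF test_function_smooth[OF L], of 1 x] by auto
  show ?thesis
    using res_kernel_fundamental_0[OF t] integral_translate_r3[OF m, of x]
    unfolding 1 2 by (simp add: add.commute)
qed

text \<open>Both exponents lie in the half plane Re z \<le> -d r, where d is the smaller of Re \<mu>
  and Im \<mu> and the derivative of exp is at most exp (-d r). The mean value inequality gives this
  decay together with a factor r, which cancels the singularity 1/r of the kernel.\<close>

lemma res_kernel_decay:
  assumes "r \<ge> 0"
  shows "norm (res_kernel \<mu> r) \<le> exp (- (min (Re \<mu>) (Im \<mu>) * r)) / (4 * pi * norm \<mu>)"
proof (cases "r = 0")
  case True
  have "norm (1 + \<i>) \<le> 2" using norm_triangle_ineq[of 1 \<i>] by simp
  then have "norm (1 + \<i>) / (8 * pi * norm \<mu>) \<le> 2 / (8 * pi * norm \<mu>)"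
    by (intro divide_right_mono) auto
  then show ?thesis using True by (simp add: res_kernel_def norm_divide norm_mult)
next
  case False
  define d where "d = min (Re \<mu>) (Im \<mu>)"
  have r: "r > 0" using False assms by simp
  have "norm (exp (\<i> * \<mu> * of_real r) - exp (- (\<mu> * of_real r)))
      \<le> exp (- (d * r)) * norm (\<i> * \<mu> * of_real r - (- (\<mu> * of_real r)))"
  proof (rule field_differentiable_bound[where S="{z. Re z \<le> - (d * r)}" and f'=exp])
    show "convex {z. Re z \<le> - (d * r)}" by (rule convex_halfspace_Re_le)
    show "\<i> * \<mu> * of_real r \<in> {z. Re z \<le> - (d * r)}" "- (\<mu> * of_real r) \<in> {z. Re z \<le> - (d * r)}"
      using r by (auto simp: d_def intro!: mult_right_mono)
  qed (auto intro!: derivative_eq_intros)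
  also have "norm (\<i> * \<mu> * of_real r - (- (\<mu> * of_real r))) \<le> 2 * (norm \<mu> * r)"
    using norm_triangle_ineq[of "\<i> * \<mu> * of_real r" "\<mu> * of_real r"] r by (simp add: norm_mult mult_ac)
  finally have "norm (exp (\<i> * \<mu> * of_real r) - exp (- (\<mu> * of_real r))) \<le> exp (- (d * r)) * (2 * (norm \<mu> * r))"
    by (simp add: mult_left_mono)
  then have "norm (exp (\<i> * \<mu> * of_real r) - exp (- (\<mu> * of_real r))) / (8 * pi * norm \<mu> ^ 2 * r)
      \<le> exp (- (d * r)) * (2 * (norm \<mu> * r)) / (8 * pi * norm \<mu> ^ 2 * r)"
    using r by (intro divide_right_mono) auto
  also have "\<dots> = exp (- (d * r)) / (4 * pi * norm \<mu>)"
    using r mu_nonzero by (simp add: field_simps power2_eq_square)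
  finally show ?thesis
    using r by (simp add: res_kernel_def norm_divide norm_mult norm_power d_def)
qed

lemma res_kernel_bound_ex: "\<exists>K\<ge>0. \<forall>x. norm (res_kernel \<mu> (norm x)) \<le> K * (1 / sig x ^ 4)"
proof -
  define d where "d = min (Re \<mu>) (Im \<mu>)"
  have d: "d > 0" using quadrant by (simp add: d_def)
  \<comment> \<open>From t \<le> exp t with t = d (1 + r) / 4, raised to the fourth power. The
    fourth power is chosen because the inverse fourth power of \<open>sig\<close> is
    integrable.\<close>
  define K where "K = exp d * (4 / d) ^ 4 / (4 * pi * norm \<mu>)"
  have "norm (res_kernel \<mu> (norm x)) \<le> K * (1 / sig x ^ 4)" for x
  proof -
    define r where "r = norm x"
    have r: "r \<ge> 0" by (simp add: r_def)
    have "sig x \<le> 1 + r"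
      unfolding sig_def r_def by (rule real_le_lsqrt) (auto simp: power2_eq_square algebra_simps)
    then have s: "sig x ^ 4 \<le> (1 + r) ^ 4" using sig_pos[of x] by (intro power_mono) auto
    have "d * (1 + r) / 4 \<le> exp (d * (1 + r) / 4)"
      using exp_ge_add_one_self[of "d * (1 + r) / 4"] by linarith
    then have "(d * (1 + r) / 4) ^ 4 \<le> exp (d * (1 + r) / 4) ^ 4"
      using d r by (intro power_mono) auto
    also have "\<dots> = exp (d * (1 + r))" by (simp add: exp_of_nat_mult[symmetric])
    finally have "(d / 4) ^ 4 * (1 + r) ^ 4 \<le> exp d * exp (d * r)"
      unfolding times_divide_eq_left[symmetric] power_mult_distrib by (simp add: exp_add distrib_left)
    then have "(d / 4) ^ 4 * sig x ^ 4 \<le> exp d * exp (d * r)"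
      using s d by (meson mult_left_mono order_trans zero_le_power less_imp_le divide_nonneg_pos zero_less_numeral)
    then have "exp (- (d * r)) \<le> exp d * (4 / d) ^ 4 * (1 / sig x ^ 4)"
      using d sig_pos[of x] by (simp add: exp_minus field_simps power_divide)
    then have "exp (- (d * r)) / (4 * pi * norm \<mu>) \<le> exp d * (4 / d) ^ 4 * (1 / sig x ^ 4) / (4 * pi * norm \<mu>)"
      by (intro divide_right_mono) auto
    moreover have "norm (res_kernel \<mu> (norm x)) \<le> exp (- (d * r)) / (4 * pi * norm \<mu>)"
      using res_kernel_decay[of "norm x"] by (simp add: d_def r_def)
    ultimately show ?thesis by (simp add: K_def mult_ac)
  qed
  moreover have "K \<ge> 0" using d by (simp add: K_def)
  ultimately show ?thesis by blast
qed

definition res_bound :: real where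
  "res_bound = (SOME K. K \<ge> 0 \<and> (\<forall>x. norm (res_kernel \<mu> (norm x)) \<le> K * (1 / sig x ^ 4)))"

lemma res_bound: "0 \<le> res_bound" "norm (res_kernel \<mu> (norm x)) \<le> res_bound * (1 / sig x ^ 4)"
  using someI_ex[OF res_kernel_bound_ex] unfolding res_bound_def[symmetric] by auto

lemma res_kernel_le: "norm (res_kernel \<mu> (norm (x::r3))) \<le> res_bound"
proof -
  have "res_bound * (1 / sig x ^ 4) \<le> res_bound * 1"
    using sig_ge_1[of x] res_bound(1) by (intro mult_left_mono) auto
  then show ?thesis using res_bound(2)[of x] by simp
qed

lemma res_kernel_bounded: "kernel_bounded (\<lambda>x y. res_kernel \<mu> (norm (x - y))) (sqrt (res_bound * sig4_int) * sqrt (res_bound * sig4_int))"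
proof (rule schur_test[where a="\<lambda>x y. sqrt (res_bound * (1 / sig (x - y) ^ 4))" and b="\<lambda>x y. sqrt (res_bound * (1 / sig (x - y) ^ 4))"])
  have nn: "0 \<le> res_bound * (1 / sig z ^ 4)" for z using res_bound(1) sig_pos[of z] by simp
  show "norm (res_kernel \<mu> (norm (x - y))) \<le> sqrt (res_bound * (1 / sig (x - y) ^ 4)) * sqrt (res_bound * (1 / sig (x - y) ^ 4))" for x y
    using res_bound(2)[of "x - y"] res_bound(1) by simp
  show "(\<integral>\<^sup>+y. ennreal ((sqrt (res_bound * (1 / sig (x - y) ^ 4)))\<^sup>2) \<partial>lborel) \<le> ennreal ((sqrt (res_bound * sig4_int))\<^sup>2)" for x
    using nn res_bound(1) sig4_int_nonneg nn_integral_sig_4_shift(1)[of x]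
    by (simp add: ennreal_mult nn_integral_cmult sig4_int_def[symmetric] sig_pos less_imp_le del: times_divide_eq_right)
  show "(\<integral>\<^sup>+x. ennreal ((sqrt (res_bound * (1 / sig (x - y) ^ 4)))\<^sup>2) \<partial>lborel) \<le> ennreal ((sqrt (res_bound * sig4_int))\<^sup>2)" for y
    using nn res_bound(1) sig4_int_nonneg nn_integral_sig_4_shift(2)[of y]
    by (simp add: ennreal_mult nn_integral_cmult sig4_int_def[symmetric] sig_pos less_imp_le del: times_divide_eq_right)
qed (use res_bound(1) sig4_int_nonneg in \<open>auto simp: sig_pos less_imp_le\<close>)

text \<open>Duality moves the convolution onto the test side, where the fundamental solution
  evaluates it, so no derivative ever falls on \<open>h\<close>.\<close>

lemma free_resolvent_solves:
  fixes h \<phi>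
  assumes \<phi>: "test_function \<phi>" and h: "sq_int h"
  shows "(\<integral>x. (\<integral>y. res_kernel \<mu> (norm (x - y)) * h y \<partial>lborel) * (laplacian (laplacian \<phi>) x - \<mu> ^ 4 * \<phi> x) \<partial>lborel)
    = (\<integral>x. h x * \<phi> x \<partial>lborel)"
proof -
  have "test_function (\<lambda>x. laplacian (laplacian \<phi>) x + (- (\<mu> ^ 4)) * \<phi> x)"
    by (intro test_function_add test_function_laplacian test_function_cmult \<phi>)
  then have th: "sq_int (\<lambda>x. laplacian (laplacian \<phi>) x - \<mu> ^ 4 * \<phi> x)"
    by (simp add: test_function_sq_int)
  show ?thesis
    using kernel_duality[OF res_kernel_bounded h th] res_kernel_fundamental[OF \<phi>]
    by (simp add: mult.commute[of "_ - _"] norm_minus_commute)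
qed

end

subsection \<open>Uniqueness for the free equation\<close>

lemma onorm_gradient_le:
  fixes c :: "3 \<Rightarrow> complex"
  assumes "\<And>i. norm (c i) \<le> L"
  shows "onorm (\<lambda>h::r3. \<Sum>i\<in>UNIV. of_real (h $ i) * c i) \<le> 3 * L"
proof (rule onorm_bound)
  show "0 \<le> 3 * L" using norm_ge_zero[of "c 0"] assms[of 0] by linarith
  fix h :: r3
  have "norm (\<Sum>i\<in>UNIV. of_real (h $ i) * c i) \<le> (\<Sum>i\<in>UNIV. norm (of_real (h $ i) * c i))"
    by (rule norm_sum)
  also have "\<dots> \<le> (\<Sum>i\<in>(UNIV::3 set). L * norm h)"
  proof (rule sum_mono)
    fix i
    have "\<bar>h $ i\<bar> * norm (c i) \<le> norm h * L"
      using assms by (intro mult_mono component_le_norm_cart) auto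
    then show "norm (of_real (h $ i) * c i) \<le> L * norm h" by (simp add: norm_mult mult.commute)
  qed
  finally show "norm (\<Sum>i\<in>UNIV. of_real (h $ i) * c i) \<le> 3 * L * norm h" by simp
qed

lemma smooth_has_derivative:
  assumes "smooth f"
  shows "(f has_derivative (\<lambda>h. \<Sum>i\<in>UNIV. of_real (h $ i) * partial_deriv i f x)) (at x within S)"
proof -
  have "frechet_derivative f (at x) = (\<lambda>h. \<Sum>i\<in>UNIV. of_real (h $ i) * partial_deriv i f x)"
    using frechet_derivative_partial[OF smooth_differentiable[OF assms]] by auto
  then show ?thesis
    using smooth_differentiable[OF assms, of x] unfolding frechet_derivative_works
    by (metis has_derivative_at_withinI)
qed

lemma test_function_lipschitz:
  assumes g: "test_function g"
  obtains L where "L \<ge> 0" "\<And>x y. norm (g x - g y) \<le> L * norm (x - y)"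
proof -
  have "\<exists>M. \<forall>x. norm (partial_deriv i g x) \<le> M" for i
    using test_function_bounded[OF test_function_partial[OF g, of i]] by metis
  then obtain M where M: "\<And>i x. norm (partial_deriv i g x) \<le> M i"
    by metis
  define L where "L = Max (range M)"
  have L: "norm (partial_deriv i g x) \<le> L" for i x
    unfolding L_def by (rule order_trans[OF M]) (auto intro: Max_ge)
  have "norm (g x - g y) \<le> 3 * L * norm (x - y)" for x y
    using differentiable_bound[OF convex_UNIV smooth_has_derivative[OF test_function_smooth[OF g]] onorm_gradient_le[OF L]]
    by auto
  moreover have "3 * L \<ge> 0" using order_trans[OF norm_ge_zero L] by simp
  ultimately show ?thesis using that by blast
qed

text \<open>The constant does not depend on the base point, so the estimate can be integrated
  against the kernel in \<open>res_fun_has_derivative\<close>.\<close>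

lemma test_function_second_order:
  assumes g: "test_function g"
  obtains C where "C \<ge> 0"
    "\<And>z h. norm (g (z + h) - g z - (\<Sum>i\<in>UNIV. of_real (h $ i) * partial_deriv i g z)) \<le> C * (norm h)\<^sup>2"
proof -
  have "\<exists>L\<ge>0. \<forall>x y. norm (partial_deriv i g x - partial_deriv i g y) \<le> L * norm (x - y)" for i
    using test_function_lipschitz[OF test_function_partial[OF g, of i]] by metis
  then obtain L' where L': "\<And>i x y. norm (partial_deriv i g x - partial_deriv i g y) \<le> L' i * norm (x - y)"
    by metis
  define L where "L = Max (range L')"
  have L: "norm (partial_deriv i g x - partial_deriv i g y) \<le> \<bar>L\<bar> * norm (x - y)" for i x y
  proof -
    have "L' i \<le> L" unfolding L_def by (auto intro: Max_ge)
    then have "L' i * norm (x - y) \<le> \<bar>L\<bar> * norm (x - y)" by (intro mult_right_mono) auto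
    then show ?thesis using L'[of i x y] by linarith
  qed
  have "norm (g (z + h) - g z - (\<Sum>i\<in>UNIV. of_real (h $ i) * partial_deriv i g z)) \<le> 3 * \<bar>L\<bar> * (norm h)\<^sup>2" for z h
  proof -
    let ?D = "\<lambda>x h. \<Sum>i\<in>UNIV. of_real (h $ i) * partial_deriv i g x"
    have "norm (g (z + h) - g z - ?D z (z + h - z)) \<le> norm (z + h - z) * (3 * (\<bar>L\<bar> * norm h))"
    proof (rule differentiable_bound_linearization[where S="cball z (norm h)"])
      show "z + t *\<^sub>R (z + h - z) \<in> cball z (norm h)" if "t \<in> {0..1}" for t
        using that by (auto simp: dist_norm intro: mult_left_le_one_le)
      show "(g has_derivative ?D x) (at x within cball z (norm h))" for x
        by (rule smooth_has_derivative[OF test_function_smooth[OF g]])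
      show "onorm (?D x - ?D z) \<le> 3 * (\<bar>L\<bar> * norm h)" if "x \<in> cball z (norm h)" for x
      proof -
        have "norm (partial_deriv i g x - partial_deriv i g z) \<le> \<bar>L\<bar> * norm h" for i
          using that by (intro order_trans[OF L] mult_left_mono) (auto simp: dist_norm norm_minus_commute)
        from onorm_gradient_le[OF this]
        show ?thesis by (simp add: fun_diff_def right_diff_distrib sum_subtractf)
      qed
    qed auto
    then show ?thesis by (simp add: power2_eq_square mult_ac)
  qed
  then show ?thesis using that[of "3 * \<bar>L\<bar>"] by auto
qed

section \<open>Convolutions with the free kernel and their cutoffs\<close>

context
  fixes \<mu> :: complex
  assumes quadrant: "Re \<mu> > 0" "Im \<mu> > 0"
begin

private abbreviation G :: "r3 \<Rightarrow> complex" where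
  "G x \<equiv> res_kernel \<mu> (norm x)"

text \<open>The same integral as in \<open>kernel_op\<close>, but kept as a function rather than an
  equivalence class, so that it can be differentiated pointwise.\<close>

definition res_fun :: "(r3 \<Rightarrow> complex) \<Rightarrow> r3 \<Rightarrow> complex" where
  "res_fun h x = (\<integral>y. G (x - y) * h y \<partial>lborel)"

lemma integrable_G: "integrable lborel G"
proof (rule Bochner_Integration.integrable_bound)
  show "integrable lborel (\<lambda>x. res_bound \<mu> * (1 / sig x ^ 4))"
    by (intro integrable_mult_right integrable_sig_4)
  show "AE x in lborel. norm (G x) \<le> norm (res_bound \<mu> * (1 / sig x ^ 4))"
    using res_bound(2)[OF quadrant] res_bound(1)[OF quadrant]
    by (intro AE_I2) (simp add: sig_pos less_imp_le)
qed measurable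

text \<open>Shifts the variable \<open>x\<close> into the test function. The kernel itself is not
  differentiable at the origin, since its expansion contains the term |x|.\<close>

lemma res_fun_reflect:
  assumes [measurable]: "h \<in> borel_measurable borel"
  shows "res_fun h x = (\<integral>y. G y * h (x - y) \<partial>lborel)"
proof -
  have "(\<lambda>y. G (x - y) * h y) \<in> borel_measurable borel" by measurable
  from integral_reflect_r3[OF this, of x] show ?thesis
    by (simp add: res_fun_def)
qed

lemma integrable_G_bounded:
  assumes [measurable]: "h \<in> borel_measurable borel" and M: "\<And>x. norm (h x) \<le> M"
  shows "integrable lborel (\<lambda>y. G y * h y)"
proof (rule Bochner_Integration.integrable_bound)
  show "integrable lborel (\<lambda>x. M * norm (G x))"
    by (intro integrable_mult_right integrable_norm integrable_G)
  show "AE x in lborel. norm (G x * h x) \<le> norm (M * norm (G x))"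
  proof (rule AE_I2)
    fix x
    have "norm (G x) * norm (h x) \<le> norm (G x) * M" using M by (intro mult_left_mono) auto
    moreover have "M \<ge> 0" using order_trans[OF norm_ge_zero M] .
    ultimately show "norm (G x * h x) \<le> norm (M * norm (G x))" by (simp add: norm_mult mult.commute)
  qed
qed measurable

lemma integrable_G_test:
  assumes \<psi>: "test_function \<psi>"
  shows "integrable lborel (\<lambda>y. G y * \<psi> (x - y))"
proof -
  obtain M where M: "M > 0" "\<And>x. norm (\<psi> x) \<le> M" using test_function_bounded[OF \<psi>] by blast
  have [measurable]: "\<psi> \<in> borel_measurable borel" using \<psi> by (rule test_function_measurable)
  show ?thesis using M by (intro integrable_G_bounded) auto
qed

lemma res_fun_has_derivative:
  assumes \<psi>: "test_function \<psi>"
  shows "(res_fun \<psi> has_derivative (\<lambda>h. \<Sum>i\<in>UNIV. of_real (h $ i) * res_fun (partial_deriv i \<psi>) x)) (at x)"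
proof -
  obtain C where C: "C \<ge> 0"
    "\<And>z h. norm (\<psi> (z + h) - \<psi> z - (\<Sum>i\<in>UNIV. of_real (h $ i) * partial_deriv i \<psi> z)) \<le> C * (norm h)\<^sup>2"
    using test_function_second_order[OF \<psi>] by blast
  define N where "N = (\<integral>y. norm (G y) \<partial>lborel)"
  have p: "test_function (partial_deriv i \<psi>)" for i by (rule test_function_partial[OF \<psi>])
  let ?D = "\<lambda>h. \<Sum>i\<in>UNIV. of_real (h $ i) * res_fun (partial_deriv i \<psi>) x"
  have bound: "norm (res_fun \<psi> y - res_fun \<psi> x - ?D (y - x)) \<le> C * (norm (y - x))\<^sup>2 * N" for y
  proof -
    define h where "h = y - x"
    have D: "?D h = (\<integral>w. (\<Sum>i\<in>UNIV. G w * (of_real (h $ i) * partial_deriv i \<psi> (x - w))) \<partial>lborel)"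
      using integrable_G_test[OF p]
      by (simp add: res_fun_reflect test_function_measurable p mult.left_commute[of "G _"])
    have "res_fun \<psi> y - res_fun \<psi> x - ?D h
        = (\<integral>w. G w * \<psi> (y - w) - G w * \<psi> (x - w) - (\<Sum>i\<in>UNIV. G w * (of_real (h $ i) * partial_deriv i \<psi> (x - w))) \<partial>lborel)"
      unfolding D res_fun_reflect[OF test_function_measurable[OF \<psi>]]
      using integrable_G_test[OF p] integrable_G_test[OF \<psi>]
      by (subst Bochner_Integration.integral_diff) (auto simp: mult.left_commute[of "G _"])
    also have "\<dots> = (\<integral>w. G w * (\<psi> ((x - w) + h) - \<psi> (x - w) - (\<Sum>i\<in>UNIV. of_real (h $ i) * partial_deriv i \<psi> (x - w))) \<partial>lborel)"
      by (simp add: right_diff_distrib sum_distrib_left h_def algebra_simps)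
    finally have "norm (res_fun \<psi> y - res_fun \<psi> x - ?D h) = norm (\<integral>w. G w * (\<psi> ((x - w) + h) - \<psi> (x - w) - (\<Sum>i\<in>UNIV. of_real (h $ i) * partial_deriv i \<psi> (x - w))) \<partial>lborel)"
      by (rule arg_cong)
    also have "\<dots> \<le> (\<integral>w. norm (G w * (\<psi> ((x - w) + h) - \<psi> (x - w) - (\<Sum>i\<in>UNIV. of_real (h $ i) * partial_deriv i \<psi> (x - w)))) \<partial>lborel)"
      by (rule integral_norm_bound)
    also have "\<dots> \<le> (\<integral>w. C * (norm h)\<^sup>2 * norm (G w) \<partial>lborel)"
    proof (rule integral_mono')
      show "integrable lborel (\<lambda>w. C * (norm h)\<^sup>2 * norm (G w))"
        by (intro integrable_mult_right integrable_norm integrable_G)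
      show "norm (G w * (\<psi> ((x - w) + h) - \<psi> (x - w) - (\<Sum>i\<in>UNIV. of_real (h $ i) * partial_deriv i \<psi> (x - w))))
          \<le> C * (norm h)\<^sup>2 * norm (G w)" for w
        using mult_left_mono[OF C(2)[of "x - w" h] norm_ge_zero[of "G w"]]
        by (simp only: norm_mult mult_ac)
      show "0 \<le> C * (norm h)\<^sup>2 * norm (G w)" for w using C(1) by simp
    qed
    also have "\<dots> = C * (norm h)\<^sup>2 * N" by (simp add: N_def)
    finally show ?thesis by (simp add: h_def)
  qed
  show ?thesis
  proof (rule has_derivativeI_sandwich[of 1 _ UNIV])
    show "bounded_linear ?D"
      by (intro bounded_linear_sum bounded_linear_compose[OF bounded_linear_mult_left]
          bounded_linear_compose[OF bounded_linear_of_real] bounded_linear_vec_nth)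
    show "norm (res_fun \<psi> y - res_fun \<psi> x - ?D (y - x)) / norm (y - x) \<le> C * N * norm (y - x)"
      if "y \<noteq> x" for y
      using bound[of y] that by (simp add: pos_divide_le_eq power2_eq_square mult_ac)
    have "((\<lambda>y. C * N * norm (y - x)) \<longlongrightarrow> C * N * norm (x - x)) (at x)"
      by (intro tendsto_intros)
    then show "((\<lambda>y. C * N * norm (y - x)) \<longlongrightarrow> 0) (at x)" by simp
  qed auto
qed

lemma res_fun_partial: "test_function \<psi> \<Longrightarrow> partial_deriv i (res_fun \<psi>) = res_fun (partial_deriv i \<psi>)"
proof
  fix x
  assume "test_function \<psi>"
  then have "partial_deriv i (res_fun \<psi>) x = (\<Sum>j\<in>UNIV. of_real (axis i 1 $ j) * res_fun (partial_deriv j \<psi>) x)"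
    by (intro partial_derivI res_fun_has_derivative)
  also have "\<dots> = res_fun (partial_deriv i \<psi>) x"
    by (subst sum.remove[of _ i]) (auto simp: axis_def intro!: sum.neutral)
  finally show "partial_deriv i (res_fun \<psi>) x = res_fun (partial_deriv i \<psi>) x" .
qed

lemma res_fun_smooth:
  assumes "test_function \<psi>" shows "smooth (res_fun \<psi>)"
proof (rule smooth_coinduct[where S="res_fun ` {\<psi>. test_function \<psi>}"])
  show "res_fun \<psi> \<in> res_fun ` {\<psi>. test_function \<psi>}" using assms by simp
  show "f differentiable at x" if "f \<in> res_fun ` {\<psi>. test_function \<psi>}" for f x
    using that res_fun_has_derivative by (auto simp: differentiable_def)
  show "partial_deriv i f \<in> res_fun ` {\<psi>. test_function \<psi>}" if "f \<in> res_fun ` {\<psi>. test_function \<psi>}" for f i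
    using that by (auto simp: res_fun_partial intro!: imageI test_function_partial)
qed

lemma res_fun_lincomb:
  assumes "test_function \<psi>" "test_function \<psi>'"
  shows "res_fun (\<lambda>x. \<psi> x + c * \<psi>' x) x = res_fun \<psi> x + c * res_fun \<psi>' x"
proof -
  have [measurable]: "\<psi> \<in> borel_measurable borel" "\<psi>' \<in> borel_measurable borel"
    using assms by (auto intro: test_function_measurable)
  have "(\<integral>y. G y * \<psi> (x - y) + c * (G y * \<psi>' (x - y)) \<partial>lborel) = (\<integral>y. G y * \<psi> (x - y) \<partial>lborel) + c * (\<integral>y. G y * \<psi>' (x - y) \<partial>lborel)"
    using integrable_G_test[OF assms(1)] integrable_G_test[OF assms(2)] by simp
  then show ?thesis by (simp add: res_fun_reflect distrib_left mult.left_commute)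
qed

lemma res_fun_sq_int: "sq_int h \<Longrightarrow> sq_int (res_fun h)"
  unfolding res_fun_def[abs_def] by (rule kernel_fun_sq_int[OF res_kernel_bounded[OF quadrant]])

text \<open>The summand 0 gives the argument the affine shape that the chain rule
  \<open>partial_deriv_affine\<close> expects.\<close>

definition rescale :: "nat \<Rightarrow> (r3 \<Rightarrow> complex) \<Rightarrow> r3 \<Rightarrow> complex" where
  "rescale n X x = X ((1 / real (Suc n)) *\<^sub>R x + 0)"

lemma rescale_test: "test_function X \<Longrightarrow> test_function (rescale n X)"
  unfolding rescale_def[abs_def] by (intro test_function_affine) auto

lemma rescale_partial:
  "test_function X \<Longrightarrow> partial_deriv i (rescale n X) x = of_real (1 / real (Suc n)) * rescale n (partial_deriv i X) x"
  unfolding rescale_def[abs_def]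
  by (intro partial_deriv_affine smooth_differentiable test_function_smooth)

text \<open>Collects the terms of \<open>\<Delta>\<^sup>2 (\<chi>(x/n) u(x))\<close> in which at least one derivative falls on the cutoff.\<close>

inductive cutoff_error :: "(nat \<Rightarrow> r3 \<Rightarrow> complex) \<Rightarrow> bool" where
  base: "test_function X \<Longrightarrow> test_function \<psi> \<Longrightarrow> (\<And>n. norm (c n) \<le> 1 / real (Suc n)) \<Longrightarrow>
    cutoff_error (\<lambda>n x. c n * (rescale n X x * res_fun \<psi> x))"
| add: "cutoff_error e \<Longrightarrow> cutoff_error e' \<Longrightarrow> cutoff_error (\<lambda>n x. e n x + e' n x)"

lemma smooth_rules:
  "smooth f \<Longrightarrow> smooth g \<Longrightarrow> smooth (\<lambda>x. f x + g x)"
  "smooth f \<Longrightarrow> smooth g \<Longrightarrow> smooth (\<lambda>x. f x * g x)"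
  "smooth (\<lambda>x. c)"
  by (auto simp: smooth_def intro: C_k_add C_k_mult C_k_const)

lemma cutoff_error_smooth: "cutoff_error e \<Longrightarrow> smooth (e n)"
proof (induction rule: cutoff_error.induct)
  case (base X \<psi> c)
  then show ?case
    by (intro smooth_rules test_function_smooth[OF rescale_test] res_fun_smooth)
qed (rule smooth_rules)

lemma partial_cutoff:
  assumes X: "test_function X" and \<psi>: "test_function \<psi>"
  shows "partial_deriv i (\<lambda>x. rescale n X x * res_fun \<psi> x) x
    = rescale n X x * res_fun (partial_deriv i \<psi>) x
      + of_real (1 / real (Suc n)) * (rescale n (partial_deriv i X) x * res_fun \<psi> x)"
  using smooth_differentiable[OF test_function_smooth[OF rescale_test[OF X]]] smooth_differentiable[OF res_fun_smooth[OF \<psi>]]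
  by (subst partial_deriv_mult) (auto simp: rescale_partial[OF X] res_fun_partial[OF \<psi>])

lemma cutoff_error_partial: "cutoff_error e \<Longrightarrow> cutoff_error (\<lambda>n. partial_deriv i (e n))"
proof (induction rule: cutoff_error.induct)
  case (base X \<psi> c)
  have "partial_deriv i (\<lambda>x. c n * (rescale n X x * res_fun \<psi> x))
      = (\<lambda>x. c n * (rescale n X x * res_fun (partial_deriv i \<psi>) x)
        + (c n * of_real (1 / real (Suc n))) * (rescale n (partial_deriv i X) x * res_fun \<psi> x))" for n
  proof
    fix x
    have "(\<lambda>x. rescale n X x * res_fun \<psi> x) differentiable at x"
      by (intro smooth_differentiable smooth_rules test_function_smooth[OF rescale_test] res_fun_smooth base)
    then show "partial_deriv i (\<lambda>x. c n * (rescale n X x * res_fun \<psi> x)) x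
      = c n * (rescale n X x * res_fun (partial_deriv i \<psi>) x)
        + (c n * of_real (1 / real (Suc n))) * (rescale n (partial_deriv i X) x * res_fun \<psi> x)"
      by (simp only: partial_deriv_cmult partial_cutoff[OF base(1,2)] distrib_left mult.assoc)
  qed
  moreover have "norm (c n * of_real (1 / real (Suc n))) \<le> 1 / real (Suc n)" for n
  proof -
    have "norm (c n) * (1 / real (Suc n)) \<le> 1 * (1 / real (Suc n))"
      using base(3)[of n] by (intro mult_right_mono) (auto elim!: order_trans)
    then show ?thesis by (simp only: norm_mult norm_of_real) simp
  qed
  ultimately show ?case
    using base by (simp only:) (intro cutoff_error.intros test_function_partial)
next
  case (add e e')
  have "partial_deriv i (\<lambda>x. e n x + e' n x) = (\<lambda>x. partial_deriv i (e n) x + partial_deriv i (e' n) x)" for n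
    using add.hyps[THEN cutoff_error_smooth, THEN smooth_differentiable]
    by (auto simp: partial_deriv_add)
  then show ?case using add.IH by (simp only:) (rule cutoff_error.add)
qed

lemma cutoff_error_bound:
  "cutoff_error e \<Longrightarrow> \<exists>h. sq_int h \<and> (\<forall>n x. norm (e n x) \<le> norm (h x) / real (Suc n))"
proof (induction rule: cutoff_error.induct)
  case (base X \<psi> c)
  obtain M where M: "M > 0" "\<And>x. norm (X x) \<le> M" using test_function_bounded[OF base(1)] by blast
  have "norm (c n * (rescale n X x * res_fun \<psi> x)) \<le> norm (of_real M * res_fun \<psi> x) / real (Suc n)" for n x
  proof -
    have "norm (c n) * (norm (rescale n X x) * norm (res_fun \<psi> x)) \<le> 1 / real (Suc n) * (M * norm (res_fun \<psi> x))"
      using base(3)[of n] M by (intro mult_mono) (auto simp: rescale_def)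
    then show ?thesis using M(1) by (simp add: norm_mult)
  qed
  moreover have "sq_int (\<lambda>x. of_real M * res_fun \<psi> x)"
    using base by (intro sq_int_cmult res_fun_sq_int test_function_sq_int)
  ultimately show ?case by blast
next
  case (add e e')
  then obtain h h' where h: "sq_int h" "\<And>n x. norm (e n x) \<le> norm (h x) / real (Suc n)"
    "sq_int h'" "\<And>n x. norm (e' n x) \<le> norm (h' x) / real (Suc n)" by blast
  have no: "sq_int (\<lambda>x. complex_of_real (norm (g x)))" if "sq_int g" for g
    using that by (auto simp: sq_int_def)
  have "sq_int (\<lambda>x. complex_of_real (norm (h x)) + of_real (norm (h' x)))"
    by (intro sq_int_add no h)
  moreover have "norm (e n x + e' n x) \<le> norm (complex_of_real (norm (h x)) + of_real (norm (h' x))) / real (Suc n)" for n x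
  proof -
    have "norm (e n x + e' n x) \<le> norm (h x) / real (Suc n) + norm (h' x) / real (Suc n)"
      by (intro norm_triangle_le add_mono h)
    then show ?thesis by (simp only: of_real_add[symmetric] norm_of_real) (simp add: add_divide_distrib)
  qed
  ultimately show ?case by blast
qed

text \<open>Up to a cutoff error, \<open>s n\<close> is the cut-off convolution with \<psi>. The
  relation is stable under partial derivatives and sums, so the Leibniz expansion of \<Delta>^2
  never has to be written out: \<psi> records which operator has been applied.\<close>

definition cutoff_approx :: "(r3 \<Rightarrow> complex) \<Rightarrow> (nat \<Rightarrow> r3 \<Rightarrow> complex) \<Rightarrow> (r3 \<Rightarrow> complex) \<Rightarrow> bool" where
  "cutoff_approx X s \<psi> \<longleftrightarrow> test_function \<psi> \<and> (\<exists>e. cutoff_error e \<and> s = (\<lambda>n x. rescale n X x * res_fun \<psi> x + e n x))"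

lemma cutoff_error_zero: "cutoff_error (\<lambda>n x. 0)"
proof -
  have "test_function (\<lambda>x. 0)" by (rule test_functionI[of _ 0]) (auto intro: smooth_rules)
  from cutoff_error.base[OF this this, of "\<lambda>n. 0"] show ?thesis by simp
qed

lemma cutoff_approx_base: "test_function \<psi> \<Longrightarrow> cutoff_approx X (\<lambda>n x. rescale n X x * res_fun \<psi> x) \<psi>"
  unfolding cutoff_approx_def using cutoff_error_zero by (intro conjI exI[of _ "\<lambda>n x. 0"]) auto

lemma cutoff_approx_partial:
  assumes X: "test_function X" and s: "cutoff_approx X s \<psi>"
  shows "cutoff_approx X (\<lambda>n. partial_deriv i (s n)) (partial_deriv i \<psi>)"
proof -
  obtain e where \<psi>: "test_function \<psi>" and e: "cutoff_error e" and s: "s = (\<lambda>n x. rescale n X x * res_fun \<psi> x + e n x)"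
    using s by (auto simp: cutoff_approx_def)
  define e' where "e' n x = of_real (1 / real (Suc n)) * (rescale n (partial_deriv i X) x * res_fun \<psi> x) + partial_deriv i (e n) x" for n x
  have "cutoff_error e'"
    unfolding e'_def[abs_def]
    by (intro cutoff_error.intros test_function_partial X \<psi> cutoff_error_partial[OF e])
      (simp only: norm_of_real, simp)
  moreover have "partial_deriv i (s n) = (\<lambda>x. rescale n X x * res_fun (partial_deriv i \<psi>) x + e' n x)" for n
  proof
    fix x
    have "(\<lambda>x. rescale n X x * res_fun \<psi> x) differentiable at x"
      by (intro smooth_differentiable smooth_rules test_function_smooth[OF rescale_test] res_fun_smooth X \<psi>)
    then show "partial_deriv i (s n) x = rescale n X x * res_fun (partial_deriv i \<psi>) x + e' n x"
      using smooth_differentiable[OF cutoff_error_smooth[OF e]]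
      unfolding s e'_def by (simp only: partial_deriv_add partial_cutoff[OF X \<psi>] add.assoc)
  qed
  ultimately show ?thesis
    using \<psi> unfolding cutoff_approx_def by (auto intro!: test_function_partial)
qed

lemma cutoff_approx_add:
  assumes "cutoff_approx X s \<psi>" "cutoff_approx X s' \<psi>'"
  shows "cutoff_approx X (\<lambda>n x. s n x + s' n x) (\<lambda>x. \<psi> x + \<psi>' x)"
proof -
  obtain e e' where \<psi>: "test_function \<psi>" "test_function \<psi>'" and e: "cutoff_error e" "cutoff_error e'"
    and s: "s = (\<lambda>n x. rescale n X x * res_fun \<psi> x + e n x)" "s' = (\<lambda>n x. rescale n X x * res_fun \<psi>' x + e' n x)"
    using assms by (auto simp: cutoff_approx_def)
  have "res_fun (\<lambda>x. \<psi> x + \<psi>' x) x = res_fun \<psi> x + res_fun \<psi>' x" for x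
    using res_fun_lincomb[OF \<psi>, of 1 x] by simp
  then show ?thesis
    using \<psi> cutoff_error.add[OF e] unfolding cutoff_approx_def s
    by (auto intro!: test_function_add exI[of _ "\<lambda>n x. e n x + e' n x"] simp: algebra_simps)
qed

lemma cutoff_approx_laplacian:
  assumes "test_function X" "cutoff_approx X s \<psi>"
  shows "cutoff_approx X (\<lambda>n. laplacian (s n)) (laplacian \<psi>)"
  unfolding laplacian_def[abs_def] sum_3
  by (intro cutoff_approx_add cutoff_approx_partial assms)

text \<open>The natural test function is the convolution \<open>res_fun \<psi>\<close>, whose image
  under \<Delta>^2 - \<mu>^4 is \<psi>, but it lacks compact support. With a cutoff at scale n it
  becomes admissible, and the error is at most 1/(n + 1) times a fixed square integrable function,
  so its pairing with \<open>f\<close> vanishes in the limit.\<close>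

lemma homogeneous_solution_orthogonal:
  assumes f: "sq_int f" and \<psi>: "test_function \<psi>"
    and hom: "\<And>\<phi>. test_function \<phi> \<Longrightarrow> (\<integral>x. f x * (laplacian (laplacian \<phi>) x - \<mu> ^ 4 * \<phi> x) \<partial>lborel) = 0"
  shows "(\<integral>x. f x * \<psi> x \<partial>lborel) = 0"
proof -
  define X where "X = box_bump (\<chi> i. -1) (\<chi> i. 1) 1"
  have X: "test_function X" unfolding X_def by (intro box_bump_test_function) auto
  have X1: "norm (X x) \<le> 1" for x unfolding X_def by (rule norm_box_bump_le)
  \<comment> \<open>The cutoff is not normalised to 1 at the origin. The limit carries the factor
    \<open>X 0\<close>, which is cancelled at the end.\<close>
  have X0: "X 0 \<noteq> 0" unfolding X_def box_bump_def by (simp add: bump_0)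
  define s where "s n x = rescale n X x * res_fun \<psi> x" for n x
  have st: "test_function (s n)" for n
    unfolding s_def[abs_def] by (intro test_function_mult_smooth rescale_test X res_fun_smooth \<psi>)
  have "cutoff_approx X (\<lambda>n. laplacian (laplacian (s n))) (laplacian (laplacian \<psi>))"
    unfolding s_def[abs_def] by (intro cutoff_approx_laplacian cutoff_approx_base X \<psi>)
  then obtain e where e: "cutoff_error e"
    and L: "\<And>n x. laplacian (laplacian (s n)) x = rescale n X x * res_fun (laplacian (laplacian \<psi>)) x + e n x"
    unfolding cutoff_approx_def by metis
  have LL: "test_function (laplacian (laplacian \<psi>))" by (intro test_function_laplacian \<psi>)
  \<comment> \<open>Since convolution commutes with derivatives, the main term is the convolution of
    (\<Delta>^2 - \<mu>^4) \<psi>, which equals \<psi> by the fundamental solution.\<close>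
  have key: "laplacian (laplacian (s n)) x - \<mu> ^ 4 * s n x = rescale n X x * \<psi> x + e n x" for n x
  proof -
    have "res_fun (laplacian (laplacian \<psi>)) x - \<mu> ^ 4 * res_fun \<psi> x = \<psi> x"
      using res_fun_lincomb[OF LL \<psi>, of "- (\<mu> ^ 4)" x] res_kernel_fundamental[OF quadrant \<psi>, of x]
      by (simp add: res_fun_def)
    then show ?thesis unfolding L s_def by (simp add: algebra_simps)
  qed
  obtain h where h: "sq_int h" "\<And>n x. norm (e n x) \<le> norm (h x) / real (Suc n)"
    using cutoff_error_bound[OF e] by blast
  have [measurable]: "f \<in> borel_measurable borel" "h \<in> borel_measurable borel" "\<psi> \<in> borel_measurable borel"
    "rescale n X \<in> borel_measurable borel" "e n \<in> borel_measurable borel" for n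
    using f h \<psi> by (auto intro: sq_int_measurable test_function_measurable rescale_test X smooth_measurable cutoff_error_smooth e)
  have int_prod: "integrable lborel (\<lambda>x. f x * g x)" if "sq_int g" for g
  proof -
    have "sq_int (\<lambda>x. cnj (f x))"
    proof (rule sq_int_bound[OF f])
      have "cnj \<in> borel_measurable borel" by (intro borel_measurable_continuous_onI continuous_intros)
      then show "(\<lambda>x. cnj (f x)) \<in> borel_measurable borel" by measurable
    qed simp
    from sq_int_mult_integrable[OF this that] show ?thesis by simp
  qed
  have f\<psi>: "integrable lborel (\<lambda>x. f x * \<psi> x)" by (intro int_prod test_function_sq_int \<psi>)
  have fh: "integrable lborel (\<lambda>x. f x * h x)" by (intro int_prod h)
  have e_sq: "sq_int (e n)" for n
  proof (rule sq_int_bound[OF h(1)])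
    have "norm (h x) / real (Suc n) \<le> norm (h x)" for x
      by (simp add: divide_le_eq mult_left_le_one_le[of "norm (h x)", THEN order_trans] algebra_simps)
    then show "AE x in lborel. norm (e n x) \<le> norm (h x)" using h(2) order_trans by blast
  qed measurable
  have eq: "(\<integral>x. f x * (rescale n X x * \<psi> x) \<partial>lborel) + (\<integral>x. f x * e n x \<partial>lborel) = 0" for n
  proof -
    have "test_function (\<lambda>x. rescale n X x * \<psi> x)"
      by (intro test_function_mult_smooth rescale_test X test_function_smooth \<psi>)
    then show ?thesis
      using hom[OF st[of n]] int_prod[OF e_sq[of n]] int_prod[OF test_function_sq_int]
      unfolding key by (simp add: distrib_left)
  qed
  have lim1: "(\<lambda>n. \<integral>x. f x * (rescale n X x * \<psi> x) \<partial>lborel) \<longlonglongrightarrow> (\<integral>x. f x * (X 0 * \<psi> x) \<partial>lborel)"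
  proof (rule integral_dominated_convergence[where w="\<lambda>x. norm (f x * \<psi> x)"])
    show "AE x in lborel. (\<lambda>n. f x * (rescale n X x * \<psi> x)) \<longlonglongrightarrow> f x * (X 0 * \<psi> x)"
    proof (rule AE_I2)
      fix x :: r3
      have "(\<lambda>n. (1 / real (Suc n)) *\<^sub>R x + 0) \<longlonglongrightarrow> 0 *\<^sub>R x + 0"
        by (intro tendsto_intros LIMSEQ_Suc lim_1_over_n)
      then have "(\<lambda>n. X ((1 / real (Suc n)) *\<^sub>R x + 0)) \<longlonglongrightarrow> X (0 *\<^sub>R x + 0)"
        using smooth_continuous[OF test_function_smooth[OF X], of UNIV]
        by (intro continuous_on_tendsto_compose[of UNIV X]) auto
      then show "(\<lambda>n. f x * (rescale n X x * \<psi> x)) \<longlonglongrightarrow> f x * (X 0 * \<psi> x)"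
        unfolding rescale_def by (intro tendsto_intros) simp
    qed
    show "AE x in lborel. norm (f x * (rescale n X x * \<psi> x)) \<le> norm (f x * \<psi> x)" for n
      using X1 by (intro AE_I2) (simp add: norm_mult rescale_def mult_left_mono mult_left_le_one_le)
  qed (use f\<psi> in auto)
  have "(\<lambda>n. \<integral>x. f x * e n x \<partial>lborel) \<longlonglongrightarrow> 0"
  proof (rule Lim_null_comparison)
    show "\<forall>\<^sub>F n in sequentially. norm (\<integral>x. f x * e n x \<partial>lborel) \<le> (1 / real (Suc n)) * (\<integral>x. norm (f x * h x) \<partial>lborel)"
    proof (rule always_eventually, rule allI)
      fix n
      have "norm (\<integral>x. f x * e n x \<partial>lborel) \<le> (\<integral>x. norm (f x * e n x) \<partial>lborel)"
        by (rule integral_norm_bound)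
      also have "\<dots> \<le> (\<integral>x. (1 / real (Suc n)) * norm (f x * h x) \<partial>lborel)"
      proof (rule integral_mono)
        show "norm (f x * e n x) \<le> (1 / real (Suc n)) * norm (f x * h x)" for x
          using mult_left_mono[OF h(2)[of n x] norm_ge_zero[of "f x"]] by (simp add: norm_mult)
      qed (use int_prod[OF e_sq[of n]] fh in auto)
      also have "\<dots> = (1 / real (Suc n)) * (\<integral>x. norm (f x * h x) \<partial>lborel)" by (rule integral_mult_right_zero)
      finally show "norm (\<integral>x. f x * e n x \<partial>lborel) \<le> (1 / real (Suc n)) * (\<integral>x. norm (f x * h x) \<partial>lborel)" .
    qed
    have "(\<lambda>n. (1 / real (Suc n)) * (\<integral>x. norm (f x * h x) \<partial>lborel)) \<longlonglongrightarrow> 0 * (\<integral>x. norm (f x * h x) \<partial>lborel)"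
      by (intro tendsto_intros LIMSEQ_Suc lim_1_over_n)
    then show "(\<lambda>n. (1 / real (Suc n)) * (\<integral>x. norm (f x * h x) \<partial>lborel)) \<longlonglongrightarrow> 0" by simp
  qed
  from tendsto_add[OF lim1 this] have "(\<integral>x. f x * (X 0 * \<psi> x) \<partial>lborel) = 0"
    unfolding eq by (simp add: LIMSEQ_const_iff)
  then show ?thesis using X0 by (simp add: mult.left_commute[of _ "X 0"])
qed

lemma homogeneous_solution_zero:
  assumes "sq_int f"
    and "\<And>\<phi>. test_function \<phi> \<Longrightarrow> (\<integral>x. f x * (laplacian (laplacian \<phi>) x - \<mu> ^ 4 * \<phi> x) \<partial>lborel) = 0"
  shows "AE x in lborel. f x = 0"
  by (rule zero_of_test_integrals[OF assms(1) homogeneous_solution_orthogonal[OF assms(1) _ assms(2)]])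

end

subsection \<open>Dense domains and closures\<close>

text \<open>For \<open>sandwich_eq\<close>: the product with unbounded outer factors will turn out
  to be a bounded operator restricted to a dense domain, and closing its graph recovers the
  operator.\<close>

lemma closure_graph_restrict:
  assumes T: "bounded_op T" and dense: "closure D = UNIV"
  shows "closure {(f, T f) |f. f \<in> D} = graph_of T"
proof
  have cont: "continuous_on UNIV T"
    using T by (simp add: bounded_op_def linear_continuous_on)
  have "graph_of T = {p. snd p = T (fst p)}"
    by (auto simp: graph_of_def)
  moreover have "closed {p. snd p = T (fst p)}"
    by (intro closed_Collect_eq continuous_on_compose2[OF cont] continuous_intros) auto
  ultimately show "closure {(f, T f) |f. f \<in> D} \<subseteq> graph_of T"
    by (intro closure_minimal) (auto simp: graph_of_def)
  show "graph_of T \<subseteq> closure {(f, T f) |f. f \<in> D}"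
  proof
    fix p assume "p \<in> graph_of T"
    then obtain f where p: "p = (f, T f)" by (auto simp: graph_of_def)
    have "f \<in> closure D" using dense by simp
    then obtain F where F: "\<And>n. F n \<in> D" "F \<longlonglongrightarrow> f" by (auto simp: closure_sequential)
    have "(\<lambda>n. T (F n)) \<longlonglongrightarrow> T f"
      using F(2) cont by (intro continuous_on_tendsto_compose[OF cont]) auto
    then have "(\<lambda>n. (F n, T (F n))) \<longlonglongrightarrow> p" unfolding p by (intro tendsto_Pair F)
    then show "p \<in> closure {(f, T f) |f. f \<in> D}"
      unfolding closure_sequential using F(1) by (intro exI[of _ "\<lambda>n. (F n, T (F n))"]) auto
  qed
qed

text \<open>Setting \<open>f\<close> to 0 wherever |w| exceeds n gives an element of the domain, and
  dominated convergence brings it back to \<open>f\<close>.\<close>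

lemma mult_op_domain_dense:
  assumes [measurable]: "w \<in> borel_measurable borel"
  shows "closure {f. sq_int (\<lambda>x. complex_of_real (w x) * rep_l2 f x)} = UNIV" (is "closure ?D = UNIV")
proof -
  have "f \<in> closure ?D" for f
  proof -
    define cut where "cut n x = (if \<bar>w x\<bar> \<le> real n then rep_l2 f x else 0)" for n :: nat and x
    have [measurable]: "rep_l2 f \<in> borel_measurable borel" "cut n \<in> borel_measurable borel" for n
      unfolding cut_def by measurable
    have cut: "sq_int (cut n)" for n
      by (rule sq_int_bound[OF sq_int_rep[of f]]) (auto simp: cut_def)
    define F where "F n = to_l2 (cut n)" for n
    have "F n \<in> ?D" for n
    proof -
      have "AE x in lborel. norm (complex_of_real (w x) * rep_l2 (F n) x) \<le> norm (of_nat n * rep_l2 f x)"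
        using rep_to_l2[OF cut[of n]] unfolding F_def
        by eventually_elim (auto simp: cut_def norm_mult mult_right_mono)
      then have "sq_int (\<lambda>x. complex_of_real (w x) * rep_l2 (F n) x)"
        by (rule sq_int_bound[OF sq_int_cmult[OF sq_int_rep[of f]], rotated]) measurable
      then show ?thesis by simp
    qed
    moreover have "F \<longlonglongrightarrow> f"
    proof -
      have "(\<lambda>n. \<integral>x. (norm (cut n x - rep_l2 f x))\<^sup>2 \<partial>lborel) \<longlonglongrightarrow> (\<integral>x. (0::real) \<partial>(lborel :: r3 measure))"
      proof (rule integral_dominated_convergence[where w="\<lambda>x. (norm (rep_l2 f x))\<^sup>2"])
        show "integrable lborel (\<lambda>x. (norm (rep_l2 f x))\<^sup>2)"
          using sq_int_rep[of f] by (simp add: sq_int_def)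
        show "AE x in lborel. (\<lambda>n. (norm (cut n x - rep_l2 f x))\<^sup>2) \<longlonglongrightarrow> 0"
        proof (rule AE_I2)
          fix x
          obtain N :: nat where "\<bar>w x\<bar> \<le> real N" using real_arch_simple by blast
          then have "\<forall>\<^sub>F n in sequentially. (norm (cut n x - rep_l2 f x))\<^sup>2 = 0"
            by (intro eventually_sequentiallyI[of N]) (auto simp: cut_def)
          then show "(\<lambda>n. (norm (cut n x - rep_l2 f x))\<^sup>2) \<longlonglongrightarrow> 0" by (rule tendsto_eventually)
        qed
        show "AE x in lborel. norm ((norm (cut n x - rep_l2 f x))\<^sup>2) \<le> (norm (rep_l2 f x))\<^sup>2" for n
          by (auto simp: cut_def)
      qed auto
      moreover have "(\<integral>x. (norm (cut n x - rep_l2 f x))\<^sup>2 \<partial>lborel) = (norm (F n - f))\<^sup>2" for n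
        using norm_to_l2[OF sq_int_diff[OF cut[of n] sq_int_rep[of f]]]
        by (simp add: to_l2_diff cut F_def)
      ultimately have "(\<lambda>n. sqrt ((norm (F n - f))\<^sup>2)) \<longlonglongrightarrow> sqrt 0"
        by (intro tendsto_real_sqrt) simp
      then show ?thesis by (simp add: tendsto_norm_zero_iff LIM_zero_iff)
    qed
    ultimately show ?thesis unfolding closure_sequential by blast
  qed
  then show ?thesis by blast
qed

subsection \<open>The resolvent identity\<close>

lemma U_fun_sq [simp]: "U_fun V x * U_fun V x = 1"
  by (simp add: U_fun_def)

lemma U_fun_sq_complex [simp]: "complex_of_real (U_fun V x) * complex_of_real (U_fun V x) = 1"
  by (simp add: U_fun_def)

lemma norm_U_fun [simp]: "\<bar>U_fun V x\<bar> = 1"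
  by (simp add: U_fun_def)

lemma U_v_v: "V x = U_fun V x * (v_fun V x * v_fun V x)"
  by (auto simp: U_fun_def v_fun_def powr_add[symmetric])

lemma v_fun_nonneg: "0 \<le> v_fun V x"
  by (simp add: v_fun_def)

context
  fixes V :: "r3 \<Rightarrow> real"
  assumes V_meas [measurable]: "V \<in> borel_measurable borel"
begin

lemma U_meas: "U_fun V \<in> borel_measurable borel"
  unfolding U_fun_def[abs_def] by measurable

lemma v_meas: "v_fun V \<in> borel_measurable borel"
  unfolding v_fun_def[abs_def] by measurable

lemma w_meas: "w_fun V \<in> borel_measurable borel"
  using U_meas v_meas unfolding w_fun_def[abs_def] by measurable

lemma U_sq_int: "sq_int f \<Longrightarrow> sq_int (\<lambda>x. complex_of_real (U_fun V x) * f x)"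
proof -
  assume f: "sq_int f"
  note [measurable] = U_meas sq_int_measurable[OF f]
  show ?thesis by (rule sq_int_bound[OF f]) (auto simp: norm_mult)
qed

lemma rep_U_op: "AE x in lborel. rep_l2 (U_op V f) x = complex_of_real (U_fun V x) * rep_l2 f x"
  unfolding U_op_def by (intro rep_to_l2 U_sq_int sq_int_rep)

lemma U_op_U_op: "U_op V (U_op V f) = f"
proof (rule l2_eqI)
  show "AE x in lborel. rep_l2 (U_op V (U_op V f)) x = rep_l2 f x"
    using rep_U_op[of "U_op V f"] rep_U_op[of f]
    by eventually_elim (simp add: mult.assoc[symmetric] flip: of_real_mult)
qed

lemma bounded_op_U: "bounded_op (U_op V)"
proof (rule bounded_opI[where K=1])
  show "U_op V (f + g) = U_op V f + U_op V g" for f g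
  proof (rule l2_eqI)
    show "AE x in lborel. rep_l2 (U_op V (f + g)) x = rep_l2 (U_op V f + U_op V g) x"
      using rep_U_op[of "f + g"] rep_U_op[of f] rep_U_op[of g] rep_add[of f g] rep_add[of "U_op V f" "U_op V g"]
      by eventually_elim (simp add: distrib_left)
  qed
  show "U_op V (c *\<^sub>C f) = c *\<^sub>C U_op V f" for c f
  proof (rule l2_eqI)
    show "AE x in lborel. rep_l2 (U_op V (c *\<^sub>C f)) x = rep_l2 (c *\<^sub>C U_op V f) x"
      using rep_U_op[of "c *\<^sub>C f"] rep_U_op[of f] rep_cscale[of c f] rep_cscale[of c "U_op V f"]
      by eventually_elim simp
  qed
  show "norm (U_op V f) \<le> 1 * norm f" for f
  proof -
    have "(norm (U_op V f))\<^sup>2 = (norm f)\<^sup>2"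
      using norm_to_l2[OF U_sq_int[OF sq_int_rep[of f]]] norm_to_l2[OF sq_int_rep[of f]]
      by (simp add: U_op_def norm_mult)
    then show ?thesis by simp
  qed
qed

context
  fixes \<mu> :: complex
  assumes quadrant: "Re \<mu> > 0" "Im \<mu> > 0"
    and V_L2: "sq_int (\<lambda>x. complex_of_real (V x))"
    and v_L2: "sq_int (\<lambda>x. complex_of_real (v_fun V x))"
begin

private abbreviation g where "g x y \<equiv> res_kernel \<mu> (norm (x - y :: r3))"
private abbreviation v where "v x \<equiv> complex_of_real (v_fun V x)"
private abbreviation "R0 \<equiv> kernel_op g"
private abbreviation "vR0 \<equiv> kernel_op (\<lambda>x y. v x * g x y)"
private abbreviation "R0v \<equiv> kernel_op (\<lambda>x y. g x y * v y)"
private abbreviation "vR0v \<equiv> kernel_op (\<lambda>x y. v x * (g x y * v y))"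

section \<open>The free resolvent with factors v on either side\<close>

lemma nn_v_sq: "(\<integral>\<^sup>+x. ennreal ((v_fun V x)\<^sup>2) \<partial>lborel) = ennreal ((norm (v_l2 V))\<^sup>2)"
  using nn_norm_to_l2[OF v_L2] by (simp add: v_l2_def)

text \<open>Bounds the L2 norm of every row of the kernel: its square is at most the supremum bound
  \<open>res_bound\<close> times the integral bound \<open>res_bound * sig4_int\<close>.\<close>

definition res_l2 :: real where
  "res_l2 = sqrt (res_bound \<mu> * (res_bound \<mu> * sig4_int))"

lemma res_l2_nonneg: "0 \<le> res_l2"
  using res_bound[OF quadrant] sig4_int_nonneg by (simp add: res_l2_def)

lemma nn_g_sq:
  "(\<integral>\<^sup>+y. ennreal ((norm (g x y))\<^sup>2) \<partial>lborel) \<le> ennreal ((res_l2)\<^sup>2)"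
  "(\<integral>\<^sup>+y. ennreal ((norm (g y x))\<^sup>2) \<partial>lborel) \<le> ennreal ((res_l2)\<^sup>2)"
proof -
  note rb = res_bound[OF quadrant] res_kernel_le[OF quadrant]
  have sq: "(norm (g x y))\<^sup>2 \<le> res_bound \<mu> * (res_bound \<mu> * (1 / sig (x - y) ^ 4))" for x y
    unfolding power2_eq_square using rb(2)[of "x - y"] rb(3)[of "x - y"] rb(1) by (intro mult_mono) auto
  have "(\<integral>\<^sup>+y. ennreal ((norm (g x y))\<^sup>2) \<partial>lborel) \<le> (\<integral>\<^sup>+y. ennreal (res_bound \<mu> * (res_bound \<mu> * (1 / sig (x - y) ^ 4))) \<partial>lborel)"
    by (intro nn_integral_mono ennreal_leI sq)
  also have "\<dots> = ennreal ((res_l2)\<^sup>2)"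
    using rb(1) sig4_int_nonneg nn_integral_sig_4_shift(1)[of x]
    by (simp add: res_l2_def ennreal_mult nn_integral_cmult sig4_int_def[symmetric] sig_pos less_imp_le del: times_divide_eq_right)
  finally show "(\<integral>\<^sup>+y. ennreal ((norm (g x y))\<^sup>2) \<partial>lborel) \<le> ennreal ((res_l2)\<^sup>2)" .
  then show "(\<integral>\<^sup>+y. ennreal ((norm (g y x))\<^sup>2) \<partial>lborel) \<le> ennreal ((res_l2)\<^sup>2)"
    by (simp add: norm_minus_commute)
qed

lemma vR0_bounded: "kernel_bounded (\<lambda>x y. v x * g x y) (res_l2 * norm (v_l2 V))"
proof (rule schur_test[where a="\<lambda>x y. norm (g x y)" and b="\<lambda>x y. v_fun V x"])
  note [measurable] = v_meas
  show "(\<lambda>(x, y). v x * g x y) \<in> borel_measurable (lborel \<Otimes>\<^sub>M lborel)"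
    "(\<lambda>(x, y). norm (g x y)) \<in> borel_measurable (lborel \<Otimes>\<^sub>M lborel)"
    "(\<lambda>(x, y). v_fun V x) \<in> borel_measurable (lborel \<Otimes>\<^sub>M (lborel :: r3 measure))" by measurable
qed (use nn_g_sq nn_v_sq res_l2_nonneg in \<open>auto simp: norm_mult v_fun_nonneg mult.commute\<close>)

lemma R0v_bounded: "kernel_bounded (\<lambda>x y. g x y * v y) (norm (v_l2 V) * res_l2)"
proof (rule schur_test[where b="\<lambda>x y. norm (g x y)" and a="\<lambda>x y. v_fun V y"])
  note [measurable] = v_meas
  show "(\<lambda>(x, y). g x y * v y) \<in> borel_measurable (lborel \<Otimes>\<^sub>M lborel)"
    "(\<lambda>(x, y). norm (g x y)) \<in> borel_measurable (lborel \<Otimes>\<^sub>M lborel)"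
    "(\<lambda>(x, y). v_fun V y) \<in> borel_measurable ((lborel :: r3 measure) \<Otimes>\<^sub>M lborel)" by measurable
qed (use nn_g_sq nn_v_sq res_l2_nonneg in \<open>auto simp: norm_mult v_fun_nonneg mult.commute\<close>)

lemma vR0v_bounded: "kernel_bounded (\<lambda>x y. v x * (g x y * v y)) ((res_bound \<mu> * norm (v_l2 V)) * norm (v_l2 V))"
proof (rule schur_test[where a="\<lambda>x y. res_bound \<mu> * v_fun V y" and b="\<lambda>x y. v_fun V x"])
  note [measurable] = v_meas
  note rb = res_bound[OF quadrant] res_kernel_le[OF quadrant]
  show "(\<lambda>(x, y). v x * (g x y * v y)) \<in> borel_measurable (lborel \<Otimes>\<^sub>M lborel)"
    "(\<lambda>(x, y). res_bound \<mu> * v_fun V y) \<in> borel_measurable ((lborel :: r3 measure) \<Otimes>\<^sub>M lborel)"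
    "(\<lambda>(x, y). v_fun V x) \<in> borel_measurable (lborel \<Otimes>\<^sub>M (lborel :: r3 measure))" by measurable
  show "norm (v x * (g x y * v y)) \<le> res_bound \<mu> * v_fun V y * v_fun V x" for x y
    using mult_right_mono[OF mult_right_mono[OF rb(3)[of "x - y"] v_fun_nonneg[of V y]] v_fun_nonneg[of V x]]
    by (simp add: norm_mult v_fun_nonneg mult_ac)
  show "(\<integral>\<^sup>+y. ennreal ((res_bound \<mu> * v_fun V y)\<^sup>2) \<partial>lborel) \<le> ennreal ((res_bound \<mu> * norm (v_l2 V))\<^sup>2)"
    by (simp add: power_mult_distrib ennreal_mult nn_integral_cmult nn_v_sq)
qed (use nn_v_sq res_bound[OF quadrant] in \<open>auto simp: v_fun_nonneg\<close>)

lemmas R0_bounded = res_kernel_bounded[OF quadrant]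

lemma rep_R0: "AE x in lborel. rep_l2 (R0 h) x = (\<integral>y. g x y * rep_l2 h y \<partial>lborel)"
  by (rule rep_kernel_op[OF R0_bounded])

lemma rep_R0v: "AE x in lborel. rep_l2 (R0v h) x = (\<integral>y. g x y * (v y * rep_l2 h y) \<partial>lborel)"
  using rep_kernel_op[OF R0v_bounded, of h] by (simp add: mult.assoc)

lemma rep_vR0: "AE x in lborel. rep_l2 (vR0 h) x = v x * rep_l2 (R0 h) x"
  using rep_kernel_op[OF vR0_bounded, of h] rep_R0[of h]
  by eventually_elim (simp add: mult.assoc)

lemma rep_vR0v: "AE x in lborel. rep_l2 (vR0v h) x = v x * rep_l2 (R0v h) x"
  using rep_kernel_op[OF vR0v_bounded, of h] rep_R0v[of h]
  by eventually_elim (simp add: mult.assoc)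

text \<open>The product of v with an L2 function need not be in L2, so R0 v is introduced as a
  kernel operator of its own. It factors through R0 only where that product happens to be an element
  \<open>k\<close> of the space.\<close>

lemma R0v_eq_R0:
  assumes "AE x in lborel. rep_l2 k x = v x * rep_l2 \<psi> x"
  shows "R0v \<psi> = R0 k"
proof (rule l2_eqI)
  note [measurable] = v_meas
  have [measurable]: "rep_l2 h \<in> borel_measurable borel" for h by simp
  have "(\<integral>y. g x y * (v y * rep_l2 \<psi> y) \<partial>lborel) = (\<integral>y. g x y * rep_l2 k y \<partial>lborel)" for x
  proof (rule integral_cong_AE)
    show "AE y in lborel. g x y * (v y * rep_l2 \<psi> y) = g x y * rep_l2 k y"
      using assms by eventually_elim simp
  qed measurable
  note eq = this
  show "AE x in lborel. rep_l2 (R0v \<psi>) x = rep_l2 (R0 k) x"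
    using rep_R0v[of \<psi>] rep_R0[of k] by eventually_elim (simp add: eq)
qed

lemma cauchy_schwarz_bound:
  assumes "sq_int a" "sq_int b"
  shows "norm (\<integral>y. a y * b y \<partial>lborel) \<le> norm (to_l2 a) * norm (to_l2 b)"
proof -
  have c: "sq_int (\<lambda>x. cnj (a x))" 
  proof (rule sq_int_bound[OF assms(1)])
    have "cnj \<in> borel_measurable borel" by (intro borel_measurable_continuous_onI continuous_intros)
    moreover note [measurable] = sq_int_measurable[OF assms(1)]
    ultimately show "(\<lambda>x. cnj (a x)) \<in> borel_measurable borel" by measurable
  qed simp
  have "(norm (to_l2 (\<lambda>x. cnj (a x))))\<^sup>2 = (norm (to_l2 a))\<^sup>2"
    by (simp add: norm_to_l2[OF c] norm_to_l2[OF assms(1)])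
  then have "norm (to_l2 (\<lambda>x. cnj (a x))) = norm (to_l2 a)"
    by (rule power2_eq_imp_eq) auto
  then show ?thesis
    using norm_cinner_le[of "to_l2 (\<lambda>x. cnj (a x))" "to_l2 b"] by (simp add: cinner_to_l2 c assms)
qed

text \<open>Cauchy-Schwarz against the uniformly square integrable rows of the kernel. Multiplying
  such a function by \<open>V\<close> or by v gives an L2 function, which is how \<open>V\<close> in
  L2 is accommodated.\<close>

lemma R0_essentially_bounded: "\<exists>C. AE x in lborel. norm (rep_l2 (R0 h) x) \<le> C"
proof -
  have gx: "sq_int (g x)" for x
    using nn_g_sq(1)[of x] by (intro sq_intI) (auto simp: order.strict_trans1)
  have "norm (to_l2 (g x)) \<le> res_l2" for x
    by (intro norm_to_l2_le gx nn_g_sq res_l2_nonneg)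
  then have "norm (\<integral>y. g x y * rep_l2 h y \<partial>lborel) \<le> res_l2 * norm h" for x
    using cauchy_schwarz_bound[OF gx[of x] sq_int_rep[of h]]
    by (auto elim!: order_trans intro!: mult_right_mono)
  then show ?thesis using rep_R0[of h] by (intro exI[of _ "res_l2 * norm h"]) (auto elim!: AE_mp)
qed

lemma R0v_essentially_bounded: "\<exists>C. AE x in lborel. norm (rep_l2 (R0v h) x) \<le> C"
proof -
  note [measurable] = v_meas
  have gv: "sq_int (\<lambda>y. of_real (res_bound \<mu>) * v y)" by (rule sq_int_cmult[OF v_L2])
  have le: "norm (g x y * v y) \<le> norm (of_real (res_bound \<mu>) * v y)" for x y
    using mult_right_mono[OF res_kernel_le[OF quadrant, of "x - y"] v_fun_nonneg[of V y]] res_bound(1)[OF quadrant]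
    by (simp add: norm_mult v_fun_nonneg)
  have gx: "sq_int (\<lambda>y. g x y * v y)" for x
    by (rule sq_int_bound[OF gv]) (auto intro: le)
  define C where "C = res_bound \<mu> * norm (v_l2 V)"
  have "norm (to_l2 (\<lambda>y. g x y * v y)) \<le> C" for x
  proof (rule norm_to_l2_le[OF gx])
    have "(\<integral>\<^sup>+y. ennreal ((norm (g x y * v y))\<^sup>2) \<partial>lborel) \<le> (\<integral>\<^sup>+y. ennreal ((norm (of_real (res_bound \<mu>) * v y))\<^sup>2) \<partial>lborel)"
      by (intro nn_integral_mono ennreal_leI power_mono le) auto
    also have "\<dots> = ennreal (C\<^sup>2)"
      unfolding C_def by (simp add: norm_mult power_mult_distrib ennreal_mult nn_integral_cmult nn_v_sq)
    finally show "(\<integral>\<^sup>+y. ennreal ((norm (g x y * v y))\<^sup>2) \<partial>lborel) \<le> ennreal (C\<^sup>2)" .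
    show "0 \<le> C" using res_bound(1)[OF quadrant] by (simp add: C_def)
  qed
  then have "norm (\<integral>y. g x y * v y * rep_l2 h y \<partial>lborel) \<le> C * norm h" for x
    using cauchy_schwarz_bound[OF gx[of x] sq_int_rep[of h]]
    by (auto elim!: order_trans intro!: mult_right_mono)
  then show ?thesis using rep_R0v[of h] by (intro exI[of _ "C * norm h"]) (auto elim!: AE_mp simp: mult.assoc)
qed

lemma mult_essentially_bounded:
  assumes "sq_int a" "\<exists>C. AE x in lborel. norm (rep_l2 f x) \<le> C"
  shows "sq_int (\<lambda>x. a x * rep_l2 f x)"
proof -
  obtain C where C: "AE x in lborel. norm (rep_l2 f x) \<le> C" using assms(2) by blast
  note [measurable] = sq_int_measurable[OF assms(1)]
  have [measurable]: "rep_l2 f \<in> borel_measurable borel" by simp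
  show ?thesis
  proof (rule sq_int_bound[OF sq_int_cmult[OF assms(1), of "of_real C"]])
    show "AE x in lborel. norm (a x * rep_l2 f x) \<le> norm (complex_of_real C * a x)"
      using C
    proof eventually_elim
      case (elim x)
      then have "norm (a x) * norm (rep_l2 f x) \<le> norm (a x) * \<bar>C\<bar>" by (intro mult_left_mono) auto
      then show ?case by (simp add: norm_mult mult.commute)
    qed
  qed measurable
qed

section \<open>The bilaplacian expressed by its resolvent\<close>

lemma integrable_rep_test: "test_function \<phi> \<Longrightarrow> integrable lborel (\<lambda>x. rep_l2 f x * \<phi> x)"
proof -
  assume \<phi>: "test_function \<phi>"
  have "sq_int (\<lambda>x. cnj (rep_l2 f x))"
  proof (rule sq_int_bound[OF sq_int_rep[of f]])
    have "cnj \<in> borel_measurable borel" by (intro borel_measurable_continuous_onI continuous_intros)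
    moreover have "rep_l2 f \<in> borel_measurable borel" by simp
    ultimately show "(\<lambda>x. cnj (rep_l2 f x)) \<in> borel_measurable borel" by measurable
  qed simp
  from sq_int_mult_integrable[OF this test_function_sq_int[OF \<phi>]] show ?thesis by simp
qed

lemma test_integral_cong:
  assumes "test_function \<phi>" "AE x in lborel. rep_l2 f x = F x" "F \<in> borel_measurable borel"
  shows "(\<integral>x. rep_l2 f x * \<phi> x \<partial>lborel) = (\<integral>x. F x * \<phi> x \<partial>lborel)"
proof (rule integral_cong_AE)
  note [measurable] = assms(3) test_function_measurable[OF assms(1)]
  have [measurable]: "rep_l2 f \<in> borel_measurable borel" by simp
  show "(\<lambda>x. rep_l2 f x * \<phi> x) \<in> borel_measurable lborel" "(\<lambda>x. F x * \<phi> x) \<in> borel_measurable lborel"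
    by measurable
  show "AE x in lborel. rep_l2 f x * \<phi> x = F x * \<phi> x" using assms(2) by eventually_elim simp
qed

lemma test_integral_diff:
  assumes "test_function \<phi>"
  shows "(\<integral>x. rep_l2 (f - h) x * \<phi> x \<partial>lborel) = (\<integral>x. rep_l2 f x * \<phi> x \<partial>lborel) - (\<integral>x. rep_l2 h x * \<phi> x \<partial>lborel)"
  using integrable_rep_test[OF assms, of f] integrable_rep_test[OF assms, of h]
  by (subst test_integral_cong[OF assms rep_diff]) (auto simp: left_diff_distrib)

lemma test_integral_cscale:
  assumes "test_function \<phi>"
  shows "(\<integral>x. rep_l2 (c *\<^sub>C f) x * \<phi> x \<partial>lborel) = c * (\<integral>x. rep_l2 f x * \<phi> x \<partial>lborel)"
  by (subst test_integral_cong[OF assms rep_cscale]) (auto simp: mult.assoc)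

lemma R0_weak:
  assumes "test_function \<phi>"
  shows "(\<integral>x. rep_l2 (R0 h) x * (laplacian (laplacian \<phi>) x - \<mu> ^ 4 * \<phi> x) \<partial>lborel) = (\<integral>x. rep_l2 h x * \<phi> x \<partial>lborel)"
proof -
  have "test_function (\<lambda>x. laplacian (laplacian \<phi>) x + (- (\<mu> ^ 4)) * \<phi> x)"
    by (intro test_function_add test_function_laplacian test_function_cmult assms)
  then have th: "test_function (\<lambda>x. laplacian (laplacian \<phi>) x - \<mu> ^ 4 * \<phi> x)" by simp
  show ?thesis
    using free_resolvent_solves[OF quadrant assms sq_int_rep[of h]]
      test_integral_cong[OF th rep_R0[of h] kernel_fun_measurable[OF R0_bounded rep_measurable]]
    by simp
qed

lemma split_test:
  assumes "test_function \<phi>"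
  shows "(\<integral>x. rep_l2 f x * (laplacian (laplacian \<phi>) x - \<mu> ^ 4 * \<phi> x) \<partial>lborel)
    = (\<integral>x. rep_l2 f x * laplacian (laplacian \<phi>) x \<partial>lborel) - \<mu> ^ 4 * (\<integral>x. rep_l2 f x * \<phi> x \<partial>lborel)"
  using integrable_rep_test[OF assms, of f]
    integrable_rep_test[OF test_function_laplacian[OF test_function_laplacian[OF assms]], of f]
  by (simp add: right_diff_distrib mult.left_commute[of _ "\<mu> ^ 4"])

text \<open>Replaces the distributional operator by an equation with a bounded one. From left to
  right this is uniqueness for the homogeneous equation; from right to left it says that R0 solves
  the equation weakly.\<close>

lemma bilaplacian_iff: "(f, h) \<in> bilaplacian_op \<longleftrightarrow> f = R0 (h - \<mu> ^ 4 *\<^sub>C f)"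
proof
  assume fh: "(f, h) \<in> bilaplacian_op"
  define d where "d = f - R0 (h - \<mu> ^ 4 *\<^sub>C f)"
  have "(\<integral>x. rep_l2 d x * (laplacian (laplacian \<phi>) x - \<mu> ^ 4 * \<phi> x) \<partial>lborel) = 0"
    if \<phi>: "test_function \<phi>" for \<phi>
  proof -
    have "test_function (\<lambda>x. laplacian (laplacian \<phi>) x + (- (\<mu> ^ 4)) * \<phi> x)"
      by (intro test_function_add test_function_laplacian test_function_cmult \<phi>)
    then have th: "test_function (\<lambda>x. laplacian (laplacian \<phi>) x - \<mu> ^ 4 * \<phi> x)" by simp
    have "(\<integral>x. rep_l2 f x * laplacian (laplacian \<phi>) x \<partial>lborel) = (\<integral>x. rep_l2 h x * \<phi> x \<partial>lborel)"
      using fh \<phi> by (simp add: bilaplacian_op_def)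
    then show ?thesis
      unfolding d_def test_integral_diff[OF th] R0_weak[OF \<phi>] split_test[OF \<phi>]
        test_integral_diff[OF \<phi>] test_integral_cscale[OF \<phi>] by simp
  qed
  then have "AE x in lborel. rep_l2 d x = 0"
    by (intro homogeneous_solution_zero[OF quadrant]) auto
  then have "AE x in lborel. rep_l2 d x = rep_l2 0 x" using rep_zero by eventually_elim simp
  then have "d = 0" by (rule l2_eqI)
  then show "f = R0 (h - \<mu> ^ 4 *\<^sub>C f)" by (simp add: d_def)
next
  assume f: "f = R0 (h - \<mu> ^ 4 *\<^sub>C f)"
  show "(f, h) \<in> bilaplacian_op"
    unfolding bilaplacian_op_def
  proof (clarsimp)
    fix \<phi> assume \<phi>: "test_function \<phi>"
    have "(\<integral>x. rep_l2 f x * (laplacian (laplacian \<phi>) x - \<mu> ^ 4 * \<phi> x) \<partial>lborel) = (\<integral>x. rep_l2 (h - \<mu> ^ 4 *\<^sub>C f) x * \<phi> x \<partial>lborel)"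
      using R0_weak[OF \<phi>, of "h - \<mu> ^ 4 *\<^sub>C f"] f by simp
    then show "(\<integral>x. rep_l2 f x * laplacian (laplacian \<phi>) x \<partial>lborel) = (\<integral>x. rep_l2 h x * \<phi> x \<partial>lborel)"
      unfolding split_test[OF \<phi>] test_integral_diff[OF \<phi>] test_integral_cscale[OF \<phi>] by simp
  qed
qed

text \<open>In other words, (H - \<mu>^4) f = q means f = R0 (q - V f) with V f in the Hilbert
  space.\<close>

lemma shift_iff:
  "(f, q) \<in> op_shift (H_op V) (\<mu> ^ 4) \<longleftrightarrow>
    (\<exists>k. (f, k) \<in> mult_op V \<and> f = R0 (q - k))" (is "?L \<longleftrightarrow> ?R")
proof
  assume ?L
  then obtain h k where hk: "(f, h) \<in> bilaplacian_op" "(f, k) \<in> mult_op V" "q = h + k - \<mu> ^ 4 *\<^sub>C f"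
    by (auto simp: op_shift_def H_op_def op_sum_def)
  then have "q - k = h - \<mu> ^ 4 *\<^sub>C f" by simp
  then show ?R using hk by (auto simp: bilaplacian_iff)
next
  assume ?R
  then obtain k where k: "(f, k) \<in> mult_op V" "f = R0 (q - k)" by blast
  have "(f, q - k + \<mu> ^ 4 *\<^sub>C f) \<in> bilaplacian_op"
    unfolding bilaplacian_iff using k by simp
  moreover have "q = (q - k + \<mu> ^ 4 *\<^sub>C f) + k - \<mu> ^ 4 *\<^sub>C f" by simp
  ultimately show ?L using k(1) unfolding op_shift_def H_op_def op_sum_def by blast
qed

section \<open>The perturbed resolvent, given an inverse of U + v R0 v\<close>

context
  fixes Minv :: "l2 \<Rightarrow> l2"
  assumes Minv: "bounded_op Minv" "\<And>f. U_op V (Minv f) + vR0v (Minv f) = f" "\<And>f. Minv (U_op V f + vR0v f) = f"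
begin

text \<open>The symmetrised second resolvent identity. The intermediate vector \<psi> = M^(-1) v R0
  q will turn out to be w times the solution.\<close>

definition resolvent_op :: "l2 \<Rightarrow> l2" where
  "resolvent_op q = R0 q - R0v (Minv (vR0 q))"

lemma bounded_op_resolvent: "bounded_op resolvent_op"
  unfolding resolvent_op_def[abs_def]
  by (intro bounded_op_minus bounded_op_comp[OF bounded_op_kernel[OF R0v_bounded]] bounded_op_comp[OF Minv(1)]
      bounded_op_kernel[OF R0_bounded] bounded_op_kernel[OF vR0_bounded])

text \<open>The equation U \<psi> + v R0 v \<psi> = v R0 q for \<psi> = M^(-1) v R0 q says precisely
  that v (R0 q - R0 v \<psi>) = U \<psi>.\<close>

lemma v_resolvent:
  "AE x in lborel. v x * rep_l2 (resolvent_op q) x = complex_of_real (U_fun V x) * rep_l2 (Minv (vR0 q)) x"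
proof -
  define \<psi> where "\<psi> = Minv (vR0 q)"
  have 1: "AE x in lborel. rep_l2 (vR0 q) x = rep_l2 (U_op V \<psi>) x + rep_l2 (vR0v \<psi>) x"
    using rep_add[of "U_op V \<psi>" "vR0v \<psi>"] unfolding \<psi>_def Minv(2) .
  have 2: "AE x in lborel. rep_l2 (resolvent_op q) x = rep_l2 (R0 q) x - rep_l2 (R0v \<psi>) x"
    using rep_diff[of "R0 q" "R0v \<psi>"] unfolding resolvent_op_def \<psi>_def .
  show ?thesis
    unfolding \<psi>_def[symmetric] using 1 2 rep_vR0[of q] rep_vR0v[of \<psi>] rep_U_op[of \<psi>]
  proof eventually_elim
    case (elim x)
    have "v x * rep_l2 (resolvent_op q) x = rep_l2 (vR0 q) x - rep_l2 (vR0v \<psi>) x"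
      unfolding elim(2,3,4) by (rule right_diff_distrib)
    also have "\<dots> = rep_l2 (U_op V \<psi>) x" unfolding elim(1) by simp
    finally show ?case unfolding elim(5) .
  qed
qed

lemma resolvent_op_essentially_bounded: "\<exists>C. AE x in lborel. norm (rep_l2 (resolvent_op q) x) \<le> C"
proof -
  obtain C where C: "AE x in lborel. norm (rep_l2 (R0 q) x) \<le> C"
    using R0_essentially_bounded[of q] by (rule exE)
  obtain D where D: "AE x in lborel. norm (rep_l2 (R0v (Minv (vR0 q))) x) \<le> D"
    using R0v_essentially_bounded[of "Minv (vR0 q)"] by (rule exE)
  from C D have "AE x in lborel. norm (rep_l2 (resolvent_op q) x) \<le> C + D"
    using rep_diff[of "R0 q" "R0v (Minv (vR0 q))"]
  proof eventually_elim
    case (elim x)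
    then show ?case using norm_triangle_ineq4[of "rep_l2 (R0 q) x" "rep_l2 (R0v (Minv (vR0 q))) x"]
      by (simp add: resolvent_op_def)
  qed
  then show ?thesis by blast
qed

text \<open>With \<psi> = U v f one has V f = v \<psi>, because V = U v^2 and U^2 = 1. Multiplying f
  = R0 (q - V f) by v then gives (U + v R0 v) \<psi> = v R0 q, which determines \<psi> and with it
  f.\<close>

lemma resolvent_graph: "op_resolvent (H_op V) (\<mu> ^ 4) = graph_of resolvent_op"
proof -
  have "(f, q) \<in> op_shift (H_op V) (\<mu> ^ 4) \<longleftrightarrow> f = resolvent_op q" for f q
  proof
    assume f: "f = resolvent_op q"
    define \<psi> where "\<psi> = Minv (vR0 q)"
    have Vf: "sq_int (\<lambda>x. complex_of_real (V x) * rep_l2 f x)"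
      unfolding f by (rule mult_essentially_bounded[OF V_L2 resolvent_op_essentially_bounded])
    define k where "k = to_l2 (\<lambda>x. complex_of_real (V x) * rep_l2 f x)"
    have "(f, k) \<in> mult_op V" using Vf by (auto simp: mult_op_def k_def)
    moreover have "AE x in lborel. rep_l2 k x = v x * rep_l2 \<psi> x"
      using rep_to_l2[OF Vf] v_resolvent[of q]
    proof eventually_elim
      case (elim x)
      have "complex_of_real (V x) * rep_l2 f x = complex_of_real (U_fun V x) * v x * (v x * rep_l2 f x)"
        by (subst U_v_v[of V x]) simp
      also have "\<dots> = complex_of_real (U_fun V x * U_fun V x) * (v x * rep_l2 \<psi> x)"
        using elim(2) by (simp add: f \<psi>_def)
      finally show ?case using elim(1) by (simp add: k_def)
    qed
    then have "R0v \<psi> = R0 k" by (rule R0v_eq_R0)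
    then have "f = R0 (q - k)"
      by (simp add: f resolvent_op_def \<psi>_def bounded_op_diff[OF bounded_op_kernel[OF R0_bounded]])
    ultimately show "(f, q) \<in> op_shift (H_op V) (\<mu> ^ 4)" unfolding shift_iff by blast
  next
    assume "(f, q) \<in> op_shift (H_op V) (\<mu> ^ 4)"
    then obtain k where k: "(f, k) \<in> mult_op V" and f: "f = R0 (q - k)" unfolding shift_iff by blast
    have Vf: "sq_int (\<lambda>x. complex_of_real (V x) * rep_l2 f x)"
      and kV: "k = to_l2 (\<lambda>x. complex_of_real (V x) * rep_l2 f x)"
      using k by (auto simp: mult_op_def)
    have vf: "sq_int (\<lambda>x. v x * rep_l2 f x)"
      unfolding f by (rule mult_essentially_bounded[OF v_L2 R0_essentially_bounded])
    define \<psi> where "\<psi> = to_l2 (\<lambda>x. complex_of_real (U_fun V x) * (v x * rep_l2 f x))"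
    have rep_\<psi>: "AE x in lborel. rep_l2 \<psi> x = complex_of_real (U_fun V x) * (v x * rep_l2 f x)"
      unfolding \<psi>_def by (rule rep_to_l2[OF U_sq_int[OF vf]])
    have "AE x in lborel. rep_l2 k x = v x * rep_l2 \<psi> x"
      using rep_to_l2[OF Vf] rep_\<psi>
    proof eventually_elim
      case (elim x)
      have "complex_of_real (V x) * rep_l2 f x = v x * (complex_of_real (U_fun V x) * (v x * rep_l2 f x))"
        by (subst U_v_v[of V x]) simp
      then show ?case using elim kV by simp
    qed
    then have Rk: "R0v \<psi> = R0 k" by (rule R0v_eq_R0)
    have fR: "f = R0 q - R0v \<psi>"
      using f by (simp add: Rk bounded_op_diff[OF bounded_op_kernel[OF R0_bounded]])
    have "U_op V \<psi> + vR0v \<psi> = vR0 q"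
    proof (rule l2_eqI)
      show "AE x in lborel. rep_l2 (U_op V \<psi> + vR0v \<psi>) x = rep_l2 (vR0 q) x"
        using rep_add[of "U_op V \<psi>" "vR0v \<psi>"] rep_U_op[of \<psi>] rep_\<psi> rep_vR0v[of \<psi>] rep_vR0[of q]
          rep_diff[of "R0 q" "R0v \<psi>", folded fR]
      proof eventually_elim
        case (elim x)
        have "rep_l2 (U_op V \<psi>) x = complex_of_real (U_fun V x * U_fun V x) * (v x * rep_l2 f x)"
          using elim(2,3) by simp
        then show ?case using elim by (simp add: algebra_simps)
      qed
    qed
    then have "Minv (vR0 q) = \<psi>" using Minv(3)[of \<psi>] by simp
    then show "f = resolvent_op q" using fR by (simp add: resolvent_op_def)
  qed
  then show ?thesis by (auto simp: op_resolvent_def graph_of_def)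
qed

text \<open>Since w = v U, the operator v R0 w equals v R0 v U, that is, (U + v R0 v) U - 1 by U^2 =
  1. Applying M^(-1) leaves U - M^(-1).\<close>

lemma sandwich_resolvent:
  "\<mu> ^ 4 \<in> resolvent_set (H_op V)"
  "sandwich_eq (w_fun V) (op_resolvent (H_op V) (\<mu> ^ 4)) (\<lambda>f. U_op V f - Minv f)"
proof -
  show "\<mu> ^ 4 \<in> resolvent_set (H_op V)"
    unfolding resolvent_set_def using resolvent_graph bounded_op_resolvent by blast
  let ?D = "{f. sq_int (\<lambda>x. complex_of_real (w_fun V x) * rep_l2 f x)}"
  have B: "bounded_op (\<lambda>f. U_op V f - Minv f)"
    by (intro bounded_op_minus bounded_op_U Minv)
  have key: "Minv (vR0 (to_l2 (\<lambda>x. complex_of_real (w_fun V x) * rep_l2 f x))) = U_op V f - Minv f"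
    if f: "f \<in> ?D" for f
  proof -
    define q where "q = to_l2 (\<lambda>x. complex_of_real (w_fun V x) * rep_l2 f x)"
    have q: "AE x in lborel. rep_l2 q x = complex_of_real (w_fun V x) * rep_l2 f x"
      unfolding q_def using f by (intro rep_to_l2) simp
    have "AE x in lborel. rep_l2 q x = v x * rep_l2 (U_op V f) x"
      using q rep_U_op[of f] by eventually_elim (simp add: w_fun_def)
    then have Rq: "R0v (U_op V f) = R0 q" by (rule R0v_eq_R0)
    have "vR0v (U_op V f) = vR0 q"
    proof (rule l2_eqI)
      show "AE x in lborel. rep_l2 (vR0v (U_op V f)) x = rep_l2 (vR0 q) x"
        using rep_vR0v[of "U_op V f"] rep_vR0[of q] by eventually_elim (simp add: Rq)
    qed
    then have "vR0 q = (U_op V (U_op V f) + vR0v (U_op V f)) - f"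
      by (simp add: U_op_U_op)
    then have "Minv (vR0 q) = Minv (U_op V (U_op V f) + vR0v (U_op V f)) - Minv f"
      by (simp only: bounded_op_diff[OF Minv(1)])
    then show ?thesis by (simp add: Minv(3) q_def)
  qed
  have wR: "AE x in lborel. complex_of_real (w_fun V x) * rep_l2 (resolvent_op q) x = rep_l2 (Minv (vR0 q)) x" for q
    using v_resolvent[of q]
  proof eventually_elim
    case (elim x)
    have "complex_of_real (w_fun V x) * rep_l2 (resolvent_op q) x
        = complex_of_real (U_fun V x * U_fun V x) * rep_l2 (Minv (vR0 q)) x"
      using elim by (simp add: w_fun_def mult.assoc)
    then show ?case by simp
  qed
  \<comment> \<open>The outer factor w imposes no further restriction: w times any vector in the
    range of the resolvent is in L2. The natural domain of the product is therefore the domain of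
    the factor w applied first, which is dense.\<close>
  have wR_sq: "sq_int (\<lambda>x. complex_of_real (w_fun V x) * rep_l2 (resolvent_op q) x)"
    and wR_eq: "to_l2 (\<lambda>x. complex_of_real (w_fun V x) * rep_l2 (resolvent_op q) x) = Minv (vR0 q)" for q
  proof -
    note [measurable] = w_meas
    have [measurable]: "rep_l2 (resolvent_op q) \<in> borel_measurable borel" by simp
    show s: "sq_int (\<lambda>x. complex_of_real (w_fun V x) * rep_l2 (resolvent_op q) x)"
      by (rule sq_int_bound[OF sq_int_rep[of "Minv (vR0 q)"]]) (use wR[of q] in auto)
    show "to_l2 (\<lambda>x. complex_of_real (w_fun V x) * rep_l2 (resolvent_op q) x) = Minv (vR0 q)"
      using wR[of q] by (subst to_l2_rep[symmetric], subst to_l2_eq_iff) (auto intro: s)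
  qed
  have "mult_op (w_fun V) O graph_of resolvent_op O mult_op (w_fun V) = {(f, U_op V f - Minv f) |f. f \<in> ?D}"
    unfolding mult_op_def graph_of_def using wR_sq key by (fastforce simp: relcomp_unfold wR_eq)
  then show "sandwich_eq (w_fun V) (op_resolvent (H_op V) (\<mu> ^ 4)) (\<lambda>f. U_op V f - Minv f)"
    unfolding sandwich_eq_def resolvent_graph
    using B closure_graph_restrict[OF B mult_op_domain_dense[OF w_meas]] by simp
qed

end

end

end

subsection \<open>Expansions in powers of the spectral parameter\<close>

lemma cscale_sum: "c *\<^sub>C (\<Sum>j\<in>A. F j) = (\<Sum>j\<in>A. c *\<^sub>C F j)"
  by (induction A rule: infinite_finite_induct) (auto simp: cscale_add_right)

text \<open>Recursion on the order, instead of a list of coefficients with a remainder: sums,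
  products and inverses then need only one peeling step, and no Cauchy products of coefficients
  appear. \<open>expands_sum\<close> unfolds the recursion at the very end.\<close>

fun expands :: "complex set \<Rightarrow> nat \<Rightarrow> (complex \<Rightarrow> l2 \<Rightarrow> l2) \<Rightarrow> bool" where
  "expands D 0 F \<longleftrightarrow> (\<exists>C. \<forall>\<mu>\<in>D. bounded_op (F \<mu>) \<and> onorm (F \<mu>) \<le> C)"
| "expands D (Suc n) F \<longleftrightarrow> (\<exists>F0 F1. bounded_op F0 \<and> expands D n F1 \<and>
     (\<forall>\<mu>\<in>D. \<forall>f. F \<mu> f = F0 f + \<mu> *\<^sub>C F1 \<mu> f))"

lemma onorm_add_le: "bounded_op S \<Longrightarrow> bounded_op T \<Longrightarrow> onorm (\<lambda>f. S f + T f) \<le> onorm S + onorm T"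
  by (intro onorm_triangle bounded_op_linear)

lemma onorm_comp_le: "bounded_op S \<Longrightarrow> bounded_op T \<Longrightarrow> onorm (\<lambda>f. S (T f)) \<le> onorm S * onorm T"
  using onorm_compose[of S T] by (simp add: bounded_op_linear o_def)

lemma onorm_nonneg: "bounded_op T \<Longrightarrow> 0 \<le> onorm T"
  by (intro onorm_pos_le bounded_op_linear)

lemma expands_subset: "expands D n F \<Longrightarrow> D' \<subseteq> D \<Longrightarrow> expands D' n F"
  by (induction n arbitrary: F) (auto, blast+)

lemma expands_cong: "(\<And>\<mu> f. \<mu> \<in> D \<Longrightarrow> F \<mu> f = F' \<mu> f) \<Longrightarrow> expands D n F \<Longrightarrow> expands D n F'"
proof (cases n)
  case 0
  assume eq: "\<And>\<mu> f. \<mu> \<in> D \<Longrightarrow> F \<mu> f = F' \<mu> f" and F: "expands D n F"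
  have "F \<mu> = F' \<mu>" if "\<mu> \<in> D" for \<mu> using eq[OF that] by auto
  then show ?thesis using F 0 by auto
qed auto

context
  fixes D :: "complex set"
  assumes D: "\<forall>\<mu>\<in>D. norm \<mu> \<le> 1"
begin

lemma expands_imp_bounded:
  "expands D n F \<Longrightarrow> expands D 0 F"
proof (induction n arbitrary: F)
  case (Suc n)
  then obtain F0 F1 where F0: "bounded_op F0" and F1: "expands D n F1"
    and eq: "\<And>\<mu> f. \<mu> \<in> D \<Longrightarrow> F \<mu> f = F0 f + \<mu> *\<^sub>C F1 \<mu> f" by auto
  obtain C where C: "\<And>\<mu>. \<mu> \<in> D \<Longrightarrow> bounded_op (F1 \<mu>) \<and> onorm (F1 \<mu>) \<le> C"
    using Suc.IH[OF F1] by auto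
  have "bounded_op (F \<mu>) \<and> onorm (F \<mu>) \<le> onorm F0 + C" if "\<mu> \<in> D" for \<mu>
  proof -
    have F: "F \<mu> = (\<lambda>f. F0 f + \<mu> *\<^sub>C F1 \<mu> f)" using eq[OF that] by auto
    have b: "bounded_op (\<lambda>f. \<mu> *\<^sub>C F1 \<mu> f)" using C[OF that] by (intro bounded_op_scale) simp
    have "onorm (\<lambda>f. \<mu> *\<^sub>C F1 \<mu> f) \<le> norm \<mu> * onorm (F1 \<mu>)"
      using C[OF that] by (intro onorm_cscale_le) simp
    also have "\<dots> \<le> 1 * C"
      using C[OF that] bspec[OF D that] onorm_nonneg by (intro mult_mono) auto
    finally show ?thesis unfolding F using onorm_add_le[OF F0 b] bounded_op_plus[OF F0 b] by linarith
  qed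
  then show ?case by auto
qed simp

lemma expands_Suc_imp: "expands D (Suc n) F \<Longrightarrow> expands D n F"
proof (induction n arbitrary: F)
  case 0
  then show ?case by (rule expands_imp_bounded)
next
  case (Suc n)
  then obtain F0 F1 where "bounded_op F0" "expands D (Suc n) F1"
    "\<forall>\<mu>\<in>D. \<forall>f. F \<mu> f = F0 f + \<mu> *\<^sub>C F1 \<mu> f" by (subst (asm) expands.simps(2)) blast
  then show ?case using Suc.IH[of F1] by auto
qed

lemma expands_const: "bounded_op T \<Longrightarrow> expands D n (\<lambda>\<mu>. T)"
proof (induction n arbitrary: T)
  case (Suc n)
  then show ?case using Suc.IH[OF bounded_op_const_zero] by (auto intro!: exI[of _ T] exI[of _ "\<lambda>\<mu> f. 0"])
qed auto

lemma expands_add: "expands D n F \<Longrightarrow> expands D n H \<Longrightarrow> expands D n (\<lambda>\<mu> f. F \<mu> f + H \<mu> f)"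
proof (induction n arbitrary: F H)
  case 0
  then obtain A B where "\<And>\<mu>. \<mu> \<in> D \<Longrightarrow> bounded_op (F \<mu>) \<and> onorm (F \<mu>) \<le> A"
    "\<And>\<mu>. \<mu> \<in> D \<Longrightarrow> bounded_op (H \<mu>) \<and> onorm (H \<mu>) \<le> B" by auto
  then have "\<forall>\<mu>\<in>D. bounded_op (\<lambda>f. F \<mu> f + H \<mu> f) \<and> onorm (\<lambda>f. F \<mu> f + H \<mu> f) \<le> A + B"
    using onorm_add_le bounded_op_plus by (meson add_mono order_trans)
  then show ?case by auto
next
  case (Suc n)
  then obtain F0 F1 H0 H1 where 1: "bounded_op F0" "expands D n F1" "\<And>\<mu> f. \<mu> \<in> D \<Longrightarrow> F \<mu> f = F0 f + \<mu> *\<^sub>C F1 \<mu> f"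
    and 2: "bounded_op H0" "expands D n H1" "\<And>\<mu> f. \<mu> \<in> D \<Longrightarrow> H \<mu> f = H0 f + \<mu> *\<^sub>C H1 \<mu> f"
    by auto
  have "expands D n (\<lambda>\<mu> f. F1 \<mu> f + H1 \<mu> f)" using 1 2 by (intro Suc.IH)
  moreover have "bounded_op (\<lambda>f. F0 f + H0 f)" using 1 2 by (intro bounded_op_plus)
  ultimately show ?case
    using 1(3) 2(3)
    by (auto simp: cscale_add_right algebra_simps intro!: exI[of _ "\<lambda>f. F0 f + H0 f"] exI[of _ "\<lambda>\<mu> f. F1 \<mu> f + H1 \<mu> f"])
qed

lemma expands_mu: "expands D n F \<Longrightarrow> expands D (Suc n) (\<lambda>\<mu> f. \<mu> *\<^sub>C F \<mu> f)"
  using bounded_op_const_zero by (auto intro!: exI[of _ "\<lambda>f. 0"] exI[of _ F])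

text \<open>The product is written as F0 H0 + \<mu> (F0 H1 + F1 H) with the second factor left whole
  in the last term. That term needs \<open>H\<close> only to the lower order, so the induction
  closes.\<close>

lemma expands_comp: "expands D n F \<Longrightarrow> expands D n H \<Longrightarrow> expands D n (\<lambda>\<mu> f. F \<mu> (H \<mu> f))"
proof (induction n arbitrary: F H)
  case 0
  then obtain A B where AB: "\<And>\<mu>. \<mu> \<in> D \<Longrightarrow> bounded_op (F \<mu>) \<and> onorm (F \<mu>) \<le> A"
    "\<And>\<mu>. \<mu> \<in> D \<Longrightarrow> bounded_op (H \<mu>) \<and> onorm (H \<mu>) \<le> B" by auto
  have "onorm (\<lambda>f. F \<mu> (H \<mu> f)) \<le> \<bar>A\<bar> * \<bar>B\<bar>" if "\<mu> \<in> D" for \<mu>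
  proof -
    have "onorm (\<lambda>f. F \<mu> (H \<mu> f)) \<le> onorm (F \<mu>) * onorm (H \<mu>)"
      using AB that by (intro onorm_comp_le) auto
    also have "\<dots> \<le> \<bar>A\<bar> * \<bar>B\<bar>"
      using AB[OF that] onorm_nonneg by (intro mult_mono) (auto intro: order_trans[OF _ abs_ge_self])
    finally show ?thesis .
  qed
  then have "\<forall>\<mu>\<in>D. bounded_op (\<lambda>f. F \<mu> (H \<mu> f)) \<and> onorm (\<lambda>f. F \<mu> (H \<mu> f)) \<le> \<bar>A\<bar> * \<bar>B\<bar>"
    using AB bounded_op_comp by blast
  then show ?case unfolding expands.simps by blast
next
  case (Suc n)
  then obtain F0 F1 H0 H1 where 1: "bounded_op F0" "expands D n F1" "\<And>\<mu> f. \<mu> \<in> D \<Longrightarrow> F \<mu> f = F0 f + \<mu> *\<^sub>C F1 \<mu> f"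
    and 2: "bounded_op H0" "expands D n H1" "\<And>\<mu> f. \<mu> \<in> D \<Longrightarrow> H \<mu> f = H0 f + \<mu> *\<^sub>C H1 \<mu> f"
    by auto
  have "expands D n (\<lambda>\<mu> f. F0 (H1 \<mu> f) + F1 \<mu> (H \<mu> f))"
    using expands_add[OF Suc.IH[OF expands_const[OF 1(1)] 2(2)] Suc.IH[OF 1(2) expands_Suc_imp[OF Suc.prems(2)]]] .
  moreover have "bounded_op (\<lambda>f. F0 (H0 f))" by (rule bounded_op_comp[OF 1(1) 2(1)])
  moreover have "F \<mu> (H \<mu> f) = F0 (H0 f) + \<mu> *\<^sub>C (F0 (H1 \<mu> f) + F1 \<mu> (H \<mu> f))" if "\<mu> \<in> D" for \<mu> f
    using 1(3)[OF that, of "H \<mu> f"] 2(3)[OF that, of f]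
    by (simp add: bounded_op_add[OF 1(1)] bounded_op_cscale[OF 1(1)] cscale_add_right)
  ultimately show ?case unfolding expands.simps by blast
qed

lemma expands_const_comp: "bounded_op T \<Longrightarrow> expands D n F \<Longrightarrow> expands D n (\<lambda>\<mu> f. T (F \<mu> f))"
  by (rule expands_comp[OF expands_const])

lemma expands_diff:
  assumes "expands D n F" "expands D n H"
  shows "expands D n (\<lambda>\<mu> f. F \<mu> f - H \<mu> f)"
proof -
  have "expands D n (\<lambda>\<mu> f. F \<mu> f + (- 1) *\<^sub>C H \<mu> f)"
    by (rule expands_add[OF assms(1) expands_const_comp[OF bounded_op_scale[OF bounded_op_id] assms(2)]])
  moreover have "(- 1) *\<^sub>C h = - h" for h
    using cscale_add_left[of "-1" 1 h] by (simp add: eq_neg_iff_add_eq_0)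
  ultimately show ?thesis by simp
qed

text \<open>A bootstrap: in Li = S - \<mu> S L1 Li the factor \<mu> raises the order by one, so an
  expansion of \<open>Li\<close> to order n on the right gives one to order n + 1 on the left. The
  uniform bound starts the induction.\<close>

lemma expands_inverse:
  assumes S: "bounded_op S" "\<And>f. S (L0 f) = f"
    and L1: "expands D n L1"
    and Li: "expands D 0 Li" "\<And>\<mu> f. \<mu> \<in> D \<Longrightarrow> L0 (Li \<mu> f) + \<mu> *\<^sub>C L1 \<mu> (Li \<mu> f) = f"
  shows "expands D n Li"
    and "\<mu> \<in> D \<Longrightarrow> Li \<mu> f = S f - \<mu> *\<^sub>C S (L1 \<mu> (Li \<mu> f))"
proof -
  have eq: "Li \<mu> f = S f - \<mu> *\<^sub>C S (L1 \<mu> (Li \<mu> f))" if "\<mu> \<in> D" for \<mu> f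
  proof -
    have "S f = S (L0 (Li \<mu> f) + \<mu> *\<^sub>C L1 \<mu> (Li \<mu> f))" using Li(2)[OF that, of f] by simp
    also have "\<dots> = Li \<mu> f + \<mu> *\<^sub>C S (L1 \<mu> (Li \<mu> f))"
      by (simp only: bounded_op_add[OF S(1)] bounded_op_cscale[OF S(1)] S(2))
    finally show ?thesis by (simp add: algebra_simps)
  qed
  then show "\<mu> \<in> D \<Longrightarrow> Li \<mu> f = S f - \<mu> *\<^sub>C S (L1 \<mu> (Li \<mu> f))" .
  show "expands D n Li"
    using L1
  proof (induction n)
    case 0
    then show ?case using Li(1) by simp
  next
    case (Suc n)
    have L1: "expands D n L1" by (rule expands_Suc_imp[OF Suc.prems])
    have "expands D n (\<lambda>\<mu> f. S (L1 \<mu> (Li \<mu> f)))"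
      by (rule expands_const_comp[OF S(1) expands_comp[OF L1 Suc.IH[OF L1]]])
    then have "expands D (Suc n) (\<lambda>\<mu> f. S f - \<mu> *\<^sub>C S (L1 \<mu> (Li \<mu> f)))"
      by (rule expands_diff[OF expands_const[OF S(1)] expands_mu])
    then show ?case by (rule expands_cong[rotated]) (simp add: eq[symmetric])
  qed
qed

end

lemma expands_sum:
  "expands D n F \<Longrightarrow> \<exists>M R. (\<forall>j<n. bounded_op (M j)) \<and> expands D 0 R \<and>
    (\<forall>\<mu>\<in>D. \<forall>f. F \<mu> f = (\<Sum>j<n. \<mu> ^ j *\<^sub>C M j f) + \<mu> ^ n *\<^sub>C R \<mu> f)"
proof (induction n arbitrary: F)
  case 0
  then show ?case by (intro exI[of _ "\<lambda>j f. 0"] exI[of _ F]) simp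
next
  case (Suc n)
  then obtain F0 F1 where F0: "bounded_op F0" and F1: "expands D n F1"
    and F: "\<And>\<mu> f. \<mu> \<in> D \<Longrightarrow> F \<mu> f = F0 f + \<mu> *\<^sub>C F1 \<mu> f" by auto
  obtain M R where M: "\<And>j. j < n \<Longrightarrow> bounded_op (M j)" and R: "expands D 0 R"
    and eq: "\<And>\<mu> f. \<mu> \<in> D \<Longrightarrow> F1 \<mu> f = (\<Sum>j<n. \<mu> ^ j *\<^sub>C M j f) + \<mu> ^ n *\<^sub>C R \<mu> f"
    using Suc.IH[OF F1] by blast
  define M' where "M' j = (case j of 0 \<Rightarrow> F0 | Suc i \<Rightarrow> M i)" for j
  have "\<forall>j<Suc n. bounded_op (M' j)"
    using F0 M by (auto simp: M'_def split: nat.splits)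
  moreover have "F \<mu> f = (\<Sum>j<Suc n. \<mu> ^ j *\<^sub>C M' j f) + \<mu> ^ Suc n *\<^sub>C R \<mu> f" if "\<mu> \<in> D" for \<mu> f
    unfolding F[OF that] eq[OF that] sum.lessThan_Suc_shift
    by (simp add: M'_def cscale_add_right cscale_sum)
  ultimately show ?case using R by blast
qed

text \<open>Remainders of the Taylor expansion of the kernel: \<open>res_rem m\<close> is what is left of the kernel
  after subtracting the terms of order \<open>\<mu>\<^sup>-\<^sup>1, \<dots>, \<mu>\<^sup>m\<^sup>-\<^sup>1\<close> and dividing by \<open>\<mu>\<^sup>m\<close>.\<close>

definition exp_tail :: "nat \<Rightarrow> complex \<Rightarrow> complex" where
  "exp_tail m z = exp z - (\<Sum>k\<le>Suc m. z ^ k / fact k)"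

definition res_rem :: "nat \<Rightarrow> complex \<Rightarrow> real \<Rightarrow> complex" where
  "res_rem m \<mu> r = (if r = 0 then 0 else
     (exp_tail m (\<i> * \<mu> * of_real r) - exp_tail m (- (\<mu> * of_real r))) / (8 * of_real pi * \<mu> ^ (m + 2) * of_real r))"

text \<open>The coefficient of \<mu>^(k-2) r^(k-1) in the kernel. It is (1 + i) / (8 \<pi>) for k =
  1, the singular rank one term, and -1 / (8 \<pi>) for k = 2, the kernel of
  \<open>G0\<close>.\<close>

definition res_coeff :: "nat \<Rightarrow> complex" where
  "res_coeff k = (\<i> ^ k - (- 1) ^ k) / (8 * of_real pi * fact k)"

lemma res_rem_measurable [measurable]: "res_rem m \<mu> \<in> borel_measurable borel"
  unfolding res_rem_def[abs_def] exp_tail_def by measurable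

lemma res_kernel_rem:
  assumes "\<mu> \<noteq> 0"
  shows "res_kernel \<mu> r = res_coeff 1 / \<mu> + res_rem 0 \<mu> r"
  using assms
  by (cases "r = 0") (simp_all add: res_kernel_def res_rem_def res_coeff_def exp_tail_def field_simps power2_eq_square)

lemma res_rem_step:
  assumes "\<mu> \<noteq> 0"
  shows "res_rem m \<mu> r = res_coeff (m + 2) * of_real (r ^ (m + 1)) + \<mu> * res_rem (Suc m) \<mu> r"
proof (cases "r = 0")
  case False
  have t: "exp_tail m z = z ^ (m + 2) / fact (m + 2) + exp_tail (Suc m) z" for z
    by (simp add: exp_tail_def del: fact_Suc)
  define a where "a = exp_tail (Suc m) (\<i> * \<mu> * of_real r)"
  define b where "b = exp_tail (Suc m) (- (\<mu> * of_real r))"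
  define M where "M = \<mu> ^ (m + 2)"
  define W where "W = (of_real r :: complex) ^ (m + 1)"
  define q where "q = (fact (m + 2) :: complex)"
  have "q \<noteq> 0" unfolding q_def by (rule fact_nonzero)
  then have nz: "M \<noteq> 0" "q \<noteq> 0" "complex_of_real r \<noteq> 0" using assms False by (simp_all add: M_def)
  have pw: "(\<i> * \<mu> * of_real r) ^ (m + 2) = \<i> ^ (m + 2) * M * (W * of_real r)"
    "(- (\<mu> * of_real r)) ^ (m + 2) = (- 1) ^ (m + 2) * M * (W * of_real r)"
    by (simp_all add: M_def W_def power_mult_distrib mult_ac power_minus[of "\<mu> * _"])
  have M1: "\<mu> ^ (Suc m + 2) = \<mu> * M" by (simp add: M_def)
  have "res_rem m \<mu> r = (\<i> ^ (m + 2) * M * (W * of_real r) / q + a - ((- 1) ^ (m + 2) * M * (W * of_real r) / q + b))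
      / (8 * of_real pi * M * of_real r)"
    using False by (simp only: res_rem_def t pw a_def b_def M_def[symmetric] q_def if_False)
  also have "\<dots> = (\<i> ^ (m + 2) - (- 1) ^ (m + 2)) / (8 * of_real pi * q) * W + \<mu> * ((a - b) / (8 * of_real pi * (\<mu> * M) * of_real r))"
    using nz assms by (simp add: field_simps)
  also have "\<dots> = res_coeff (m + 2) * of_real (r ^ (m + 1)) + \<mu> * res_rem (Suc m) \<mu> r"
    using False by (simp only: res_coeff_def res_rem_def M1 a_def b_def W_def q_def if_False of_real_power)
  finally show ?thesis .
qed (simp add: res_rem_def)

text \<open>In the left half plane all derivatives of exp are bounded by 1, so the Taylor remainder
  is a plain power without exponential growth. For \<mu> in the first quadrant both arguments that
  occur lie there.\<close>

lemma exp_tail_bound: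
  assumes "Re z \<le> 0"
  shows "norm (exp_tail m z) \<le> norm z ^ (m + 2)"
proof -
  have "norm (exp z - (\<Sum>k\<le>Suc m. exp 0 * (z - 0) ^ k / fact k)) \<le> 1 * norm (z - 0) ^ Suc (Suc m) / fact (Suc m)"
    by (rule complex_Taylor[of "{z. Re z \<le> 0}" "Suc m" "\<lambda>_. exp"])
      (use assms in \<open>auto intro!: derivative_eq_intros convex_halfspace_Re_le\<close>)
  also have "\<dots> \<le> norm z ^ (m + 2) / 1"
    using mult_left_mono[OF fact_ge_1[of "Suc m", where 'a=real], of "norm z ^ Suc (Suc m)"]
    by (simp add: divide_le_eq del: fact_Suc power_Suc)
  finally show ?thesis by (simp add: exp_tail_def)
qed

text \<open>All powers of \<mu> cancel, so the bound is uniform in \<mu>. The remaining growth in r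
  is left to the weights; the constant 2 / (8 \<pi>) is estimated by 1.\<close>

lemma res_rem_bound:
  assumes "Re \<mu> > 0" "Im \<mu> > 0" "r \<ge> 0"
  shows "norm (res_rem m \<mu> r) \<le> r ^ (m + 1)"
proof (cases "r = 0")
  case False
  then have r: "r > 0" using assms by simp
  have \<mu>: "norm \<mu> > 0" using assms by auto
  have "norm (exp_tail m (\<i> * \<mu> * of_real r) - exp_tail m (- (\<mu> * of_real r)))
      \<le> norm (\<i> * \<mu> * of_real r) ^ (m + 2) + norm (- (\<mu> * of_real r)) ^ (m + 2)"
    using assms r by (intro norm_triangle_le_diff add_mono exp_tail_bound) auto
  also have "\<dots> = 2 * (norm \<mu> ^ (m + 2) * (r ^ (m + 1) * r))"
    using r by (simp add: norm_mult power_mult_distrib mult_ac)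
  finally have b: "norm (exp_tail m (\<i> * \<mu> * of_real r) - exp_tail m (- (\<mu> * of_real r)))
      \<le> 2 * (norm \<mu> ^ (m + 2) * (r ^ (m + 1) * r))" .
  have "norm (res_rem m \<mu> r) = norm (exp_tail m (\<i> * \<mu> * of_real r) - exp_tail m (- (\<mu> * of_real r)))
      / (8 * pi * norm \<mu> ^ (m + 2) * r)"
    using False r by (simp add: res_rem_def norm_divide norm_mult norm_power del: add_2_eq_Suc add_2_eq_Suc' power_Suc)
  also have "\<dots> \<le> 2 * (norm \<mu> ^ (m + 2) * (r ^ (m + 1) * r)) / (8 * pi * norm \<mu> ^ (m + 2) * r)"
    using r b by (intro divide_right_mono) auto
  also have "\<dots> = r ^ (m + 1) / (4 * pi)"
    using r \<mu> by (simp add: field_simps)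
  also have "\<dots> \<le> r ^ (m + 1)"
  proof -
    have "1 \<le> 4 * pi" using pi_gt3 by simp
    then show ?thesis using r by (simp add: divide_le_eq mult_left_mono[of 1 "4 * pi" "r ^ (m + 1)", simplified])
  qed
  finally show ?thesis .
qed (simp add: res_rem_def)

subsection \<open>Weighted kernels\<close>

definition weighted :: "(r3 \<Rightarrow> real) \<Rightarrow> (real \<Rightarrow> complex) \<Rightarrow> r3 \<Rightarrow> r3 \<Rightarrow> complex" where
  "weighted V k x y = complex_of_real (v_fun V x) * (k (norm (x - y)) * complex_of_real (v_fun V y))"

text \<open>A product bound, so that the growth of a kernel separates into one weight in
  \<open>x\<close> and one in \<open>y\<close>, as the Schur test demands.\<close>

lemma norm_diff_le_sig: "norm (x - y) \<le> 2 * (sig x * sig y)"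
proof -
  have "norm (x - y) \<le> sig x + sig y"
    using norm_triangle_ineq4[of x y] norm_le_sig[of x] norm_le_sig[of y] by linarith
  moreover have "sig x * 1 \<le> sig x * sig y" "1 * sig y \<le> sig x * sig y"
    using sig_ge_1[of x] sig_ge_1[of y] by (intro mult_mono; linarith)+
  ultimately show ?thesis by simp
qed

lemma weighted_bounded:
  assumes V [measurable]: "V \<in> borel_measurable borel" and [measurable]: "k \<in> borel_measurable borel"
    and v: "sq_int (\<lambda>x. complex_of_real (v_fun V x * sig x ^ N))"
    and k: "\<And>r. r \<ge> 0 \<Longrightarrow> norm (k r) \<le> A * r ^ j" "j \<le> N" "0 \<le> A"
  shows "kernel_bounded (weighted V k)
    ((A * 2 ^ N * norm (to_l2 (\<lambda>x. complex_of_real (v_fun V x * sig x ^ N)))) *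
      norm (to_l2 (\<lambda>x. complex_of_real (v_fun V x * sig x ^ N))))"
proof -
  note [measurable] = v_meas[OF V]
  let ?u = "\<lambda>x. v_fun V x * sig x ^ N"
  have u: "(\<integral>\<^sup>+x. ennreal ((?u x)\<^sup>2) \<partial>lborel) = ennreal ((norm (to_l2 (\<lambda>x. complex_of_real (?u x))))\<^sup>2)"
    using nn_norm_to_l2[OF v] by (simp only: norm_of_real power2_abs)
  have un: "0 \<le> ?u x" for x using sig_pos[of x] by (simp add: v_fun_nonneg)
  show ?thesis
  proof (rule schur_test[where a="\<lambda>x y. A * 2 ^ N * ?u y" and b="\<lambda>x y. ?u x"])
    show "(\<lambda>(x, y). weighted V k x y) \<in> borel_measurable (lborel \<Otimes>\<^sub>M lborel)"
      unfolding weighted_def by measurable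
    show "(\<lambda>(x, y). A * 2 ^ N * ?u y) \<in> borel_measurable ((lborel :: r3 measure) \<Otimes>\<^sub>M lborel)"
      "(\<lambda>(x, y). ?u x) \<in> borel_measurable (lborel \<Otimes>\<^sub>M (lborel :: r3 measure))" by measurable
    show "norm (weighted V k x y) \<le> A * 2 ^ N * ?u y * ?u x" for x y
    proof -
      let ?s = "2 * (sig x * sig y)"
      have "1 * 1 \<le> sig x * sig y" using sig_ge_1 by (intro mult_mono) (auto intro: order_trans[of 0 1])
      \<comment> \<open>The base is at least 1, which allows raising the exponent from
        \<open>j\<close> to \<open>N\<close>.\<close>
      then have s1: "1 \<le> ?s" by simp
      have "norm (k (norm (x - y))) \<le> A * norm (x - y) ^ j" by (rule k) simp
      also have "\<dots> \<le> A * ?s ^ j"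
        using k norm_diff_le_sig by (intro mult_left_mono power_mono) auto
      also have "\<dots> \<le> A * ?s ^ N"
        using k s1 by (intro mult_left_mono power_increasing) auto
      finally have "v_fun V x * (norm (k (norm (x - y))) * v_fun V y) \<le> v_fun V x * ((A * ?s ^ N) * v_fun V y)"
        by (intro mult_left_mono mult_right_mono v_fun_nonneg)
      then show ?thesis by (simp add: weighted_def norm_mult v_fun_nonneg power_mult_distrib mult_ac)
    qed
    show "(\<integral>\<^sup>+y. ennreal ((A * 2 ^ N * ?u y)\<^sup>2) \<partial>lborel)
        \<le> ennreal ((A * 2 ^ N * norm (to_l2 (\<lambda>x. complex_of_real (?u x))))\<^sup>2)"
    proof -
      have "(\<integral>\<^sup>+y. ennreal ((A * 2 ^ N * ?u y)\<^sup>2) \<partial>lborel) = (\<integral>\<^sup>+y. ennreal ((A * 2 ^ N)\<^sup>2) * ennreal ((?u y)\<^sup>2) \<partial>lborel)"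
        by (simp only: power_mult_distrib[of "A * 2 ^ N"] ennreal_mult zero_le_power2)
      also have "\<dots> = ennreal ((A * 2 ^ N)\<^sup>2) * (\<integral>\<^sup>+y. ennreal ((?u y)\<^sup>2) \<partial>lborel)"
        by (rule nn_integral_cmult) measurable
      also have "\<dots> = ennreal ((A * 2 ^ N * norm (to_l2 (\<lambda>x. complex_of_real (?u x))))\<^sup>2)"
        by (simp only: u power_mult_distrib[of "A * 2 ^ N"] ennreal_mult zero_le_power2)
      finally show ?thesis by simp
    qed
    show "(\<integral>\<^sup>+x. ennreal ((?u x)\<^sup>2) \<partial>lborel) \<le> ennreal ((norm (to_l2 (\<lambda>x. complex_of_real (?u x))))\<^sup>2)" for y :: r3
      using u by simp
  qed (use k un in auto)
qed

subsection \<open>The projections\<close>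

lemma alpha_P: "complex_of_real (alpha V) *\<^sub>C P_op V f = cinner (v_l2 V) f *\<^sub>C v_l2 V"
  by (cases "alpha V = 0") (auto simp: P_op_def alpha_def)

lemma bounded_op_cinner: "bounded_op (\<lambda>f. cinner u f *\<^sub>C u)"
proof (rule bounded_opI[where K="norm u * norm u"])
  show "norm (cinner u f *\<^sub>C u) \<le> norm u * norm u * norm f" for f
    using mult_right_mono[OF norm_cinner_le[of u f] norm_ge_zero[of u]] by (simp add: norm_cscale mult_ac)
qed (auto simp: cinner_add_right cinner_scale_right cscale_add_left)

lemma bounded_op_P: "bounded_op (P_op V)"
  using bounded_op_scale[OF bounded_op_cinner, of "complex_of_real (1 / alpha V)" "v_l2 V"]
  by (simp add: P_op_def[abs_def])

lemma P_P [simp]: "P_op V (P_op V f) = P_op V f"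
proof (cases "alpha V = 0")
  case False
  then show ?thesis
    by (simp add: P_op_def cinner_scale_right cinner_self alpha_def)
qed (simp add: P_op_def)

lemma bounded_op_Q: "bounded_op (Q_op V)"
  unfolding Q_op_def[abs_def] by (intro bounded_op_minus bounded_op_id bounded_op_P)

lemma P_Q [simp]: "P_op V (Q_op V f) = 0"
  by (simp add: Q_op_def bounded_op_diff[OF bounded_op_P])

lemma Q_P [simp]: "Q_op V (P_op V f) = 0"
  by (simp add: Q_op_def)

lemma Q_Q [simp]: "Q_op V (Q_op V f) = Q_op V f"
  by (simp add: Q_op_def[of V "Q_op V f"])

lemma P_plus_Q: "P_op V f + Q_op V f = f"
  by (simp add: Q_op_def)

lemma Q_mem [simp, intro]: "Q_op V f \<in> QL2 V"
  by (simp add: QL2_def)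

lemma QL2_fixed: "f \<in> QL2 V \<Longrightarrow> Q_op V f = f"
  by (auto simp: QL2_def)

section \<open>The expansion of M(\<mu>) under a moment condition on v\<close>

context
  fixes V :: "r3 \<Rightarrow> real" and n :: nat
  assumes V [measurable]: "V \<in> borel_measurable borel"
    and V_L2: "sq_int (\<lambda>x. complex_of_real (V x))"
    and v_moment: "sq_int (\<lambda>x. complex_of_real (v_fun V x * sig x ^ (n + 2)))"
    and regular: "zero_regular V"
begin

definition weight_norm :: real where
  "weight_norm = norm (to_l2 (\<lambda>x. complex_of_real (v_fun V x * sig x ^ (n + 2))))"

lemma weighted_power_bounded:
  assumes "k \<in> borel_measurable borel" "\<And>r. r \<ge> 0 \<Longrightarrow> norm (k r) \<le> A * r ^ j" "j \<le> n + 2" "0 \<le> A"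
  shows "kernel_bounded (weighted V k) ((A * 2 ^ (n + 2) * weight_norm) * weight_norm)"
  unfolding weight_norm_def by (rule weighted_bounded[OF V assms(1) v_moment assms(2-4)])

lemma v_L2: "sq_int (\<lambda>x. complex_of_real (v_fun V x))"
proof (rule sq_int_bound[OF v_moment])
  note [measurable] = v_meas[OF V]
  show "(\<lambda>x. complex_of_real (v_fun V x)) \<in> borel_measurable borel" by measurable
  have "v_fun V x * 1 \<le> v_fun V x * sig x ^ (n + 2)" for x
    by (intro mult_left_mono one_le_power sig_ge_1 v_fun_nonneg)
  then show "AE x in lborel. norm (complex_of_real (v_fun V x)) \<le> norm (complex_of_real (v_fun V x * sig x ^ (n + 2)))"
    using v_fun_nonneg sig_pos[THEN less_imp_le] by (intro AE_I2) (simp only: norm_of_real abs_mult abs_of_nonneg zero_le_power mult_1_right)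
qed

lemma rank_one: "kernel_op (weighted V (\<lambda>r. 1)) f = complex_of_real (alpha V) *\<^sub>C P_op V f"
proof -
  let ?v = "\<lambda>x. complex_of_real (v_fun V x)"
  have c: "cinner (v_l2 V) f = (\<integral>y. ?v y * rep_l2 f y \<partial>lborel)"
    using cinner_to_l2[OF v_L2 sq_int_rep[of f]] by (simp add: v_l2_def)
  have "kernel_op (weighted V (\<lambda>r. 1)) f = to_l2 (\<lambda>x. ?v x * cinner (v_l2 V) f)"
    unfolding kernel_op_def weighted_def c by (simp add: mult.assoc)
  also have "\<dots> = to_l2 (\<lambda>x. cinner (v_l2 V) f * ?v x)"
    by (subst mult.commute) (rule refl)
  also have "\<dots> = cinner (v_l2 V) f *\<^sub>C v_l2 V"
    by (simp add: to_l2_cscale v_L2 v_l2_def)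
  finally show ?thesis by (simp add: alpha_P)
qed

lemma weighted_one_bounded: "\<exists>C. kernel_bounded (weighted V (\<lambda>r. 1)) C"
  using weighted_power_bounded[of "\<lambda>r. 1" 1 0] by auto

lemma weighted_rpow_bounded: "j \<le> n + 2 \<Longrightarrow> \<exists>C. kernel_bounded (weighted V (\<lambda>r. complex_of_real (r ^ j))) C"
  using weighted_power_bounded[of "\<lambda>r. complex_of_real (r ^ j)" 1 j] by (auto simp: norm_power)

lemma weighted_rem_bounded:
  assumes "Re \<mu> > 0" "Im \<mu> > 0" "m \<le> n + 1"
  shows "kernel_bounded (weighted V (res_rem m \<mu>)) ((1 * 2 ^ (n + 2) * weight_norm) * weight_norm)"
  by (rule weighted_power_bounded[where j="m + 1"]) (use assms res_rem_bound[of \<mu>] in auto)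

lemma weighted_rem_step:
  assumes \<mu>: "Re \<mu> > 0" "Im \<mu> > 0" and m: "m \<le> n"
  shows "kernel_op (weighted V (res_rem m \<mu>)) f
    = res_coeff (m + 2) *\<^sub>C kernel_op (weighted V (\<lambda>r. complex_of_real (r ^ (m + 1)))) f
      + \<mu> *\<^sub>C kernel_op (weighted V (res_rem (Suc m) \<mu>)) f"
proof -
  obtain C where C: "kernel_bounded (weighted V (\<lambda>r. complex_of_real (r ^ (m + 1)))) C"
    using weighted_rpow_bounded[of "m + 1"] m by auto
  have "weighted V (res_rem m \<mu>) = (\<lambda>x y. res_coeff (m + 2) * weighted V (\<lambda>r. complex_of_real (r ^ (m + 1))) x y
      + \<mu> * weighted V (res_rem (Suc m) \<mu>) x y)"
  proof (intro ext)
    fix x y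
    have "\<mu> \<noteq> 0" using \<mu> by auto
    show "weighted V (res_rem m \<mu>) x y = res_coeff (m + 2) * weighted V (\<lambda>r. complex_of_real (r ^ (m + 1))) x y
      + \<mu> * weighted V (res_rem (Suc m) \<mu>) x y"
      unfolding weighted_def res_rem_step[OF \<open>\<mu> \<noteq> 0\<close>, of m] by (simp only: distrib_left distrib_right mult_ac)
  qed
  then show ?thesis
    using kernel_op_lincomb[OF C weighted_rem_bounded[OF \<mu>, of "Suc m"]] m by simp
qed

lemma vR0v_split:
  assumes \<mu>: "Re \<mu> > 0" "Im \<mu> > 0"
  shows "kernel_op (weighted V (res_kernel \<mu>)) f
    = (res_coeff 1 / \<mu> * complex_of_real (alpha V)) *\<^sub>C P_op V f + kernel_op (weighted V (res_rem 0 \<mu>)) f"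
proof -
  obtain C where C: "kernel_bounded (weighted V (\<lambda>r. 1)) C"
    using weighted_one_bounded by auto
  have "weighted V (res_kernel \<mu>) = (\<lambda>x y. (res_coeff 1 / \<mu>) * weighted V (\<lambda>r. 1) x y + 1 * weighted V (res_rem 0 \<mu>) x y)"
  proof (intro ext)
    fix x y
    have "\<mu> \<noteq> 0" using \<mu> by auto
    show "weighted V (res_kernel \<mu>) x y = (res_coeff 1 / \<mu>) * weighted V (\<lambda>r. 1) x y + 1 * weighted V (res_rem 0 \<mu>) x y"
      unfolding weighted_def res_kernel_rem[OF \<open>\<mu> \<noteq> 0\<close>] by (simp add: algebra_simps)
  qed
  then show ?thesis
    using kernel_op_lincomb[OF C weighted_rem_bounded[OF \<mu>, of 0], of "res_coeff 1 / \<mu>" 1] by (simp add: rank_one)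
qed

lemma vG0v_kernel: "vG0v_op V f = res_coeff 2 *\<^sub>C kernel_op (weighted V (\<lambda>r. complex_of_real (r ^ 1))) f"
proof -
  obtain C where C: "kernel_bounded (weighted V (\<lambda>r. complex_of_real (r ^ 1))) C"
    using weighted_rpow_bounded[of 1] by auto
  have c2: "res_coeff 2 = - (1 / (8 * of_real pi))"
    by (simp add: res_coeff_def)
  have "vG0v_op V f = to_l2 (\<lambda>x. res_coeff 2 * (\<integral>y. weighted V (\<lambda>r. complex_of_real (r ^ 1)) x y * rep_l2 f y \<partial>lborel))"
    unfolding vG0v_op_def G0_def weighted_def c2
    by (simp only: integral_mult_right_zero[symmetric]) (simp add: mult_ac)
  also have "\<dots> = res_coeff 2 *\<^sub>C kernel_op (weighted V (\<lambda>r. complex_of_real (r ^ 1))) f"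
    unfolding kernel_op_def by (intro to_l2_cscale kernel_fun_sq_int[OF C]) simp
  finally show ?thesis .
qed

lemma bounded_op_vG0v: "bounded_op (vG0v_op V)"
proof -
  obtain C where C: "kernel_bounded (weighted V (\<lambda>r. complex_of_real (r ^ 1))) C"
    using weighted_rpow_bounded[of 1] by auto
  have "vG0v_op V = (\<lambda>f. res_coeff 2 *\<^sub>C kernel_op (weighted V (\<lambda>r. complex_of_real (r ^ 1))) f)"
    using vG0v_kernel by auto
  then show ?thesis using bounded_op_scale[OF bounded_op_kernel[OF C]] by simp
qed

lemma bounded_op_M0: "bounded_op (M0_op V)"
  unfolding M0_op_def[abs_def] by (intro bounded_op_plus bounded_op_U V bounded_op_vG0v)

definition unit_quadrant :: "complex set" where
  "unit_quadrant = {\<mu>. Re \<mu> > 0 \<and> Im \<mu> > 0 \<and> norm \<mu> \<le> 1}"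

text \<open>After \<open>k\<close> steps the remainder has index m + k and grows like r^(m+k+1). The
  condition on m + k keeps this exponent within n + 2, the order of the available moment of
  v.\<close>

lemma weighted_rem_expands:
  "m + k \<le> n + 1 \<Longrightarrow> expands unit_quadrant k (\<lambda>\<mu>. kernel_op (weighted V (res_rem m \<mu>)))"
proof (induction k arbitrary: m)
  case 0
  then have "\<forall>\<mu>\<in>unit_quadrant. bounded_op (kernel_op (weighted V (res_rem m \<mu>))) \<and>
      onorm (kernel_op (weighted V (res_rem m \<mu>))) \<le> (1 * 2 ^ (n + 2) * weight_norm) * weight_norm"
    using bounded_op_kernel[OF weighted_rem_bounded] onorm_kernel_op[OF weighted_rem_bounded]
    by (auto simp: unit_quadrant_def)
  then show ?case unfolding expands.simps by blast
next
  case (Suc k)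
  obtain C where C: "kernel_bounded (weighted V (\<lambda>r. complex_of_real (r ^ (m + 1)))) C"
    using weighted_rpow_bounded[of "m + 1"] Suc.prems by auto
  have "bounded_op (\<lambda>f. res_coeff (m + 2) *\<^sub>C kernel_op (weighted V (\<lambda>r. complex_of_real (r ^ (m + 1)))) f)"
    by (intro bounded_op_scale bounded_op_kernel[OF C])
  moreover have "expands unit_quadrant k (\<lambda>\<mu>. kernel_op (weighted V (res_rem (Suc m) \<mu>)))"
    using Suc by simp
  moreover have "\<forall>\<mu>\<in>unit_quadrant. \<forall>f. kernel_op (weighted V (res_rem m \<mu>)) f
      = res_coeff (m + 2) *\<^sub>C kernel_op (weighted V (\<lambda>r. complex_of_real (r ^ (m + 1)))) f
      + \<mu> *\<^sub>C kernel_op (weighted V (res_rem (Suc m) \<mu>)) f"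
    using Suc.prems by (intro ballI allI weighted_rem_step) (auto simp: unit_quadrant_def)
  ultimately show ?case unfolding expands.simps by blast
qed

subsection \<open>Inversion of the leading part\<close>

text \<open>The operator Q m0^(-1) Q on the whole space; no left factor Q is written because the
  values of \<open>m0_inv V\<close> on \<open>QL2 V\<close> lie in \<open>QL2 V\<close>.\<close>

definition m0_inv_Q :: "l2 \<Rightarrow> l2" where
  "m0_inv_Q g = m0_inv V (Q_op V g)"

lemma m0_bij: "bij_betw (m0_op V) (QL2 V) (QL2 V)"
  using regular by (simp add: zero_regular_def)

lemma m0_inv_Q_mem: "m0_inv_Q g \<in> QL2 V"
  using m0_bij Q_mem[of V g] unfolding m0_inv_Q_def m0_inv_def
  by (metis bij_betw_imp_surj_on inv_into_into)

lemma Q_m0_inv_Q [simp]: "Q_op V (m0_inv_Q g) = m0_inv_Q g"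
  by (rule QL2_fixed[OF m0_inv_Q_mem])

lemma P_m0_inv_Q [simp]: "P_op V (m0_inv_Q g) = 0"
  by (metis P_Q Q_m0_inv_Q)

lemma m0_m0_inv_Q: "m0_op V (m0_inv_Q g) = Q_op V g"
  using m0_bij unfolding m0_inv_Q_def m0_inv_def
  by (metis Q_mem bij_betw_inv_into_right)

lemma m0_inj: "f \<in> QL2 V \<Longrightarrow> h \<in> QL2 V \<Longrightarrow> m0_op V f = m0_op V h \<Longrightarrow> f = h"
  using m0_bij by (meson bij_betw_def inj_onD)

lemma bounded_op_m0: "bounded_op (m0_op V)"
  unfolding m0_op_def[abs_def]
  by (rule bounded_op_comp[OF bounded_op_Q bounded_op_comp[OF bounded_op_M0 bounded_op_Q]])

lemma QL2_add: "f \<in> QL2 V \<Longrightarrow> h \<in> QL2 V \<Longrightarrow> f + h \<in> QL2 V"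
  using Q_mem[of V "f + h"] by (simp add: bounded_op_add[OF bounded_op_Q] QL2_fixed)

lemma QL2_cscale: "f \<in> QL2 V \<Longrightarrow> c *\<^sub>C f \<in> QL2 V"
  using Q_mem[of V "c *\<^sub>C f"] by (simp add: bounded_op_cscale[OF bounded_op_Q] QL2_fixed)

lemma bounded_op_m0_inv_Q: "bounded_op m0_inv_Q"
proof -
  obtain C where C: "\<And>f. f \<in> QL2 V \<Longrightarrow> norm (m0_inv V f) \<le> C * norm f"
    using regular by (auto simp: zero_regular_def)
  show ?thesis
  proof (rule bounded_opI[where K="\<bar>C\<bar> * onorm (Q_op V)"])
    show "m0_inv_Q (f + h) = m0_inv_Q f + m0_inv_Q h" for f h
      by (rule m0_inj)
        (simp_all add: m0_inv_Q_mem QL2_add m0_m0_inv_Q bounded_op_add[OF bounded_op_m0] bounded_op_add[OF bounded_op_Q])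
    show "m0_inv_Q (c *\<^sub>C f) = c *\<^sub>C m0_inv_Q f" for c f
      by (rule m0_inj)
        (simp_all add: m0_inv_Q_mem QL2_cscale m0_m0_inv_Q bounded_op_cscale[OF bounded_op_m0] bounded_op_cscale[OF bounded_op_Q])
    show "norm (m0_inv_Q f) \<le> \<bar>C\<bar> * onorm (Q_op V) * norm f" for f
    proof -
      have "norm (m0_inv_Q f) \<le> C * norm (Q_op V f)" unfolding m0_inv_Q_def by (intro C) simp
      also have "\<dots> \<le> \<bar>C\<bar> * norm (Q_op V f)" by (intro mult_right_mono) auto
      also have "\<dots> \<le> \<bar>C\<bar> * (onorm (Q_op V) * norm f)" by (intro mult_left_mono bounded_op_norm bounded_op_Q) auto
      finally show ?thesis by (simp add: mult.assoc)
    qed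
  qed
qed

lemma m0_inv_Q_m0: "m0_inv_Q (m0_op V f) = Q_op V f"
proof (rule m0_inj)
  have "Q_op V (m0_op V f) = m0_op V f" "m0_op V (Q_op V f) = m0_op V f" by (simp_all add: m0_op_def)
  then show "m0_op V (m0_inv_Q (m0_op V f)) = m0_op V (Q_op V f)" by (simp add: m0_m0_inv_Q)
qed (simp_all add: m0_inv_Q_mem)

private abbreviation "c \<equiv> res_coeff 1 * complex_of_real (alpha V)"

text \<open>As 1 + i is not 0, c vanishes only together with \<alpha>, and then P is 0 by the
  convention for division by 0.\<close>

lemma c_zero: "c = 0 \<Longrightarrow> P_op V f = 0"
  by (auto simp: res_coeff_def P_op_def complex_eq_iff)

text \<open>Solving \<open>lead_op f = g\<close> is back substitution: the Q component gives Q f =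
  m0^(-1) Q g, and the P component then reads c P f = P (g - M0 Q f).\<close>

definition lead_op :: "l2 \<Rightarrow> l2" where
  "lead_op f = c *\<^sub>C P_op V f + M0_op V (Q_op V f)"

text \<open>If \<open>\<alpha> = 0\<close> then \<open>c = 0\<close> and \<open>P = 0\<close>; the formula stays correct with \<open>1 / 0 = 0\<close>.\<close>

definition lead_inv :: "l2 \<Rightarrow> l2" where
  "lead_inv g = m0_inv_Q g + (1 / c) *\<^sub>C P_op V (g - M0_op V (m0_inv_Q g))"

lemma bounded_op_lead_inv: "bounded_op lead_inv"
  unfolding lead_inv_def[abs_def]
  by (intro bounded_op_plus bounded_op_scale bounded_op_m0_inv_Q
      bounded_op_comp[OF bounded_op_P] bounded_op_minus bounded_op_id bounded_op_comp[OF bounded_op_M0 bounded_op_m0_inv_Q])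

lemma bounded_op_lead_op: "bounded_op lead_op"
  unfolding lead_op_def[abs_def]
  by (intro bounded_op_plus bounded_op_scale bounded_op_P bounded_op_comp[OF bounded_op_M0 bounded_op_Q])

lemma lead_inv_lead_op: "lead_inv (lead_op f) = f"
proof -
  have "Q_op V (lead_op f) = m0_op V f"
    by (simp add: lead_op_def m0_op_def bounded_op_add[OF bounded_op_Q] bounded_op_cscale[OF bounded_op_Q])
  then have "m0_inv_Q (lead_op f) = m0_inv_Q (m0_op V f)"
    unfolding m0_inv_Q_def by (simp add: m0_op_def)
  then have m: "m0_inv_Q (lead_op f) = Q_op V f" by (simp add: m0_inv_Q_m0)
  have "lead_inv (lead_op f) = Q_op V f + (1 / c) *\<^sub>C P_op V (c *\<^sub>C P_op V f)"
    unfolding lead_inv_def m by (simp add: lead_op_def)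
  also have "\<dots> = Q_op V f + P_op V f"
    by (cases "c = 0") (auto simp: bounded_op_cscale[OF bounded_op_P] c_zero)
  finally show ?thesis by (simp add: add.commute P_plus_Q)
qed

lemma lead_op_lead_inv: "lead_op (lead_inv g) = g"
proof -
  have "P_op V (lead_inv g) = (1 / c) *\<^sub>C P_op V (g - M0_op V (m0_inv_Q g))"
    by (simp add: lead_inv_def bounded_op_add[OF bounded_op_P] bounded_op_cscale[OF bounded_op_P])
  moreover have "Q_op V (lead_inv g) = m0_inv_Q g"
    by (simp add: lead_inv_def bounded_op_add[OF bounded_op_Q] bounded_op_cscale[OF bounded_op_Q])
  ultimately have "lead_op (lead_inv g) = c *\<^sub>C (1 / c) *\<^sub>C P_op V (g - M0_op V (m0_inv_Q g)) + M0_op V (m0_inv_Q g)"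
    by (simp add: lead_op_def)
  also have "c *\<^sub>C (1 / c) *\<^sub>C P_op V (g - M0_op V (m0_inv_Q g)) = P_op V (g - M0_op V (m0_inv_Q g))"
    by (cases "c = 0") (auto simp: c_zero)
  also have "\<dots> + M0_op V (m0_inv_Q g) = P_op V g + Q_op V (M0_op V (m0_inv_Q g))"
    by (simp add: Q_op_def bounded_op_diff[OF bounded_op_P])
  also have "Q_op V (M0_op V (m0_inv_Q g)) = Q_op V g"
    using m0_m0_inv_Q[of g] by (simp add: m0_op_def)
  finally show ?thesis by (simp add: P_plus_Q)
qed

lemma Q_lead_inv: "Q_op V (lead_inv g) = m0_inv_Q g"
  by (simp add: lead_inv_def bounded_op_add[OF bounded_op_Q] bounded_op_cscale[OF bounded_op_Q])

text \<open>Composition with \<open>Q + \<mu> P\<close> cancels the singular term \<open>c P / \<mu>\<close> of \<open>M_op \<mu>\<close>.\<close>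

definition rescale_P :: "complex \<Rightarrow> l2 \<Rightarrow> l2" where
  "rescale_P \<mu> f = Q_op V f + \<mu> *\<^sub>C P_op V f"

lemma bounded_op_rescale_P: "bounded_op (rescale_P \<mu>)"
  unfolding rescale_P_def[abs_def] by (intro bounded_op_plus bounded_op_scale bounded_op_P bounded_op_Q)

lemma P_rescale_P: "P_op V (rescale_P \<mu> f) = \<mu> *\<^sub>C P_op V f"
  by (simp add: rescale_P_def bounded_op_add[OF bounded_op_P] bounded_op_cscale[OF bounded_op_P])

lemma Q_rescale_P: "Q_op V (rescale_P \<mu> f) = Q_op V f"
  by (simp add: rescale_P_def bounded_op_add[OF bounded_op_Q] bounded_op_cscale[OF bounded_op_Q])

lemma rescale_P_inverse: "\<mu> \<noteq> 0 \<Longrightarrow> rescale_P \<mu> (rescale_P (1 / \<mu>) f) = f"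
  unfolding rescale_P_def[of \<mu> "rescale_P (1 / \<mu>) f"] P_rescale_P Q_rescale_P using P_plus_Q[of V f] by (simp add: add.commute)

text \<open>The part of M(\<mu>) (Q + \<mu>P) beyond \<open>lead_op\<close>, divided by \<mu>: the
  first summand comes from M0 acting on \<mu>P, the second from the kernel beyond
  \<open>G0\<close>.\<close>

definition rest_op :: "complex \<Rightarrow> l2 \<Rightarrow> l2" where
  "rest_op \<mu> f = M0_op V (P_op V f) + kernel_op (weighted V (res_rem 1 \<mu>)) (rescale_P \<mu> f)"

lemma unit_quadrant_le: "\<forall>\<mu>\<in>unit_quadrant. norm \<mu> \<le> 1"
  by (simp add: unit_quadrant_def)

lemma rest_op_expands: "expands unit_quadrant n rest_op"
proof -
  have "expands unit_quadrant (Suc n) (\<lambda>\<mu> f. \<mu> *\<^sub>C P_op V f)"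
    by (intro expands_mu expands_const bounded_op_P unit_quadrant_le)
  then have "expands unit_quadrant n (\<lambda>\<mu> f. \<mu> *\<^sub>C P_op V f)" by (rule expands_Suc_imp[OF unit_quadrant_le])
  then have J: "expands unit_quadrant n rescale_P"
    unfolding rescale_P_def[abs_def] by (intro expands_add expands_const bounded_op_Q unit_quadrant_le)
  have N: "expands unit_quadrant n (\<lambda>\<mu>. kernel_op (weighted V (res_rem 1 \<mu>)))"
    by (rule weighted_rem_expands) simp
  show ?thesis
    unfolding rest_op_def[abs_def]
    by (rule expands_add[OF unit_quadrant_le expands_const[OF unit_quadrant_le bounded_op_comp[OF bounded_op_M0 bounded_op_P]] expands_comp[OF unit_quadrant_le N J]])
qed

section \<open>The inverse of M(\<mu>) and the expansion of the resolvent\<close>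

definition M_op :: "complex \<Rightarrow> l2 \<Rightarrow> l2" where
  "M_op \<mu> f = U_op V f + kernel_op (weighted V (res_kernel \<mu>)) f"

lemma M_rescale_P:
  assumes "\<mu> \<in> unit_quadrant"
  shows "M_op \<mu> (rescale_P \<mu> f) = lead_op f + \<mu> *\<^sub>C rest_op \<mu> f"
proof -
  have \<mu>: "Re \<mu> > 0" "Im \<mu> > 0" "\<mu> \<noteq> 0" using assms by (auto simp: unit_quadrant_def)
  have "kernel_op (weighted V (res_rem 0 \<mu>)) h = vG0v_op V h + \<mu> *\<^sub>C kernel_op (weighted V (res_rem 1 \<mu>)) h" for h
    using weighted_rem_step[OF \<mu>(1,2), of 0 h] by (simp add: vG0v_kernel numeral_2_eq_2)
  then have "M_op \<mu> (rescale_P \<mu> f) = M0_op V (rescale_P \<mu> f) + (res_coeff 1 / \<mu> * complex_of_real (alpha V)) *\<^sub>C P_op V (rescale_P \<mu> f)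
      + \<mu> *\<^sub>C kernel_op (weighted V (res_rem 1 \<mu>)) (rescale_P \<mu> f)"
    by (simp add: M_op_def vR0v_split[OF \<mu>(1,2)] M0_op_def)
  also have "(res_coeff 1 / \<mu> * complex_of_real (alpha V)) *\<^sub>C P_op V (rescale_P \<mu> f) = c *\<^sub>C P_op V f"
    using \<mu>(3) by (simp add: P_rescale_P)
  also have "M0_op V (rescale_P \<mu> f) = M0_op V (Q_op V f) + \<mu> *\<^sub>C M0_op V (P_op V f)"
    by (simp add: rescale_P_def bounded_op_add[OF bounded_op_M0] bounded_op_cscale[OF bounded_op_M0])
  finally show ?thesis by (simp add: lead_op_def rest_op_def cscale_add_right)
qed

text \<open>With L the inverse of \<open>lead_op\<close> + \<mu> \<open>rest_op\<close>, the inverse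
  of M(\<mu>) is (Q + \<mu>P) L. Its constant term is Q \<open>lead_inv\<close>, which equals Q
  m0^(-1) Q by \<open>Q_lead_inv\<close>. Factoring \<mu> out of the rest costs no order, because
  the correction to L already carries a factor \<mu>.\<close>

lemma inverse_expansion:
  "\<exists>\<mu>0 Minv F. 0 < \<mu>0 \<and> \<mu>0 \<le> 1 \<and> expands {\<mu> \<in> unit_quadrant. norm \<mu> \<le> \<mu>0} n F \<and>
    (\<forall>\<mu>\<in>{\<mu> \<in> unit_quadrant. norm \<mu> \<le> \<mu>0}. bounded_op (Minv \<mu>) \<and>
      (\<forall>f. M_op \<mu> (Minv \<mu> f) = f \<and> Minv \<mu> (M_op \<mu> f) = f \<and> Minv \<mu> f = m0_inv_Q f + \<mu> *\<^sub>C F \<mu> f))"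
proof -
  obtain B where B: "\<And>\<mu>. \<mu> \<in> unit_quadrant \<Longrightarrow> bounded_op (rest_op \<mu>) \<and> onorm (rest_op \<mu>) \<le> B"
    using expands_imp_bounded[OF unit_quadrant_le rest_op_expands] by auto
  define s where "s = onorm lead_inv"
  have s: "0 \<le> s" unfolding s_def by (rule onorm_nonneg[OF bounded_op_lead_inv])
  \<comment> \<open>Chosen so that \<mu> \<open>lead_inv\<close> \<open>rest_op\<close> has norm at
    most 1/2. The summand 1 keeps the denominator positive and \<mu>0 below 1.\<close>
  define \<mu>0 where "\<mu>0 = 1 / (2 * (s * \<bar>B\<bar> + 1))"
  have pos: "0 < s * \<bar>B\<bar> + 1" using s by (simp add: add_nonneg_pos)
  have \<mu>0: "0 < \<mu>0" "\<mu>0 \<le> 1"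
    using pos s by (auto simp: \<mu>0_def divide_le_eq)
  define D where "D = {\<mu> \<in> unit_quadrant. norm \<mu> \<le> \<mu>0}"
  have D: "\<forall>\<mu>\<in>D. norm \<mu> \<le> 1" "D \<subseteq> unit_quadrant" using \<mu>0 by (auto simp: D_def)
  have "\<exists>T. bounded_op T \<and> onorm T \<le> 2 \<and> (\<forall>f. T f + \<mu> *\<^sub>C lead_inv (rest_op \<mu> (T f)) = f) \<and> (\<forall>f. T (f + \<mu> *\<^sub>C lead_inv (rest_op \<mu> f)) = f)"
    if \<mu>: "\<mu> \<in> D" for \<mu>
  proof -
    have "bounded_op (rest_op \<mu>) \<and> onorm (rest_op \<mu>) \<le> B" using B[of \<mu>] \<mu> D(2) by blast
    then have L: "bounded_op (rest_op \<mu>)" "onorm (rest_op \<mu>) \<le> \<bar>B\<bar>" by linarith+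
    have SL: "bounded_op (\<lambda>f. lead_inv (rest_op \<mu> f))" by (rule bounded_op_comp[OF bounded_op_lead_inv L(1)])
    have A: "bounded_op (\<lambda>f. \<mu> *\<^sub>C lead_inv (rest_op \<mu> f))" by (rule bounded_op_scale[OF SL])
    have "onorm (\<lambda>f. \<mu> *\<^sub>C lead_inv (rest_op \<mu> f)) \<le> norm \<mu> * onorm (\<lambda>f. lead_inv (rest_op \<mu> f))"
      by (rule onorm_cscale_le[OF SL])
    also have "\<dots> \<le> \<mu>0 * (s * \<bar>B\<bar> + 1)"
    proof (rule mult_mono)
      have "onorm (\<lambda>f. lead_inv (rest_op \<mu> f)) \<le> s * onorm (rest_op \<mu>)"
        unfolding s_def by (rule onorm_comp_le[OF bounded_op_lead_inv L(1)])
      also have "\<dots> \<le> s * \<bar>B\<bar>" using s L by (intro mult_left_mono)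
      finally show "onorm (\<lambda>f. lead_inv (rest_op \<mu> f)) \<le> s * \<bar>B\<bar> + 1" by simp
    qed (use \<mu> \<mu>0 onorm_nonneg[OF SL] in \<open>auto simp: D_def\<close>)
    also have "\<dots> = 1 / 2" using pos by (simp add: \<mu>0_def)
    finally show ?thesis using neumann[OF A] by metis
  qed
  then obtain T where T: "\<And>\<mu>. \<mu> \<in> D \<Longrightarrow> bounded_op (T \<mu>)" "\<And>\<mu>. \<mu> \<in> D \<Longrightarrow> onorm (T \<mu>) \<le> 2"
    "\<And>\<mu> f. \<mu> \<in> D \<Longrightarrow> T \<mu> f + \<mu> *\<^sub>C lead_inv (rest_op \<mu> (T \<mu> f)) = f"
    "\<And>\<mu> f. \<mu> \<in> D \<Longrightarrow> T \<mu> (f + \<mu> *\<^sub>C lead_inv (rest_op \<mu> f)) = f"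
    by metis
  define Li where "Li \<mu> f = T \<mu> (lead_inv f)" for \<mu> f
  have Li: "bounded_op (Li \<mu>)" "onorm (Li \<mu>) \<le> 2 * s" if "\<mu> \<in> D" for \<mu>
  proof -
    show "bounded_op (Li \<mu>)" unfolding Li_def[abs_def] by (rule bounded_op_comp[OF T(1)[OF that] bounded_op_lead_inv])
    have "onorm (Li \<mu>) \<le> onorm (T \<mu>) * s"
      unfolding Li_def[abs_def] s_def by (rule onorm_comp_le[OF T(1)[OF that] bounded_op_lead_inv])
    also have "\<dots> \<le> 2 * s" using T(2)[OF that] s by (intro mult_right_mono)
    finally show "onorm (Li \<mu>) \<le> 2 * s" .
  qed
  have right: "lead_op (Li \<mu> f) + \<mu> *\<^sub>C rest_op \<mu> (Li \<mu> f) = f" if "\<mu> \<in> D" for \<mu> f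
  proof -
    have "lead_op (Li \<mu> f + \<mu> *\<^sub>C lead_inv (rest_op \<mu> (Li \<mu> f))) = lead_op (lead_inv f)"
      using T(3)[OF that, of "lead_inv f"] by (simp add: Li_def)
    then show ?thesis
      by (simp add: bounded_op_add[OF bounded_op_lead_op] bounded_op_cscale[OF bounded_op_lead_op] lead_op_lead_inv)
  qed
  have left: "Li \<mu> (lead_op f + \<mu> *\<^sub>C rest_op \<mu> f) = f" if "\<mu> \<in> D" for \<mu> f
    using T(4)[OF that, of f]
    by (simp add: Li_def bounded_op_add[OF bounded_op_lead_inv] bounded_op_cscale[OF bounded_op_lead_inv] lead_inv_lead_op)
  have Li0: "expands D 0 Li" using Li by auto
  have restD: "expands D n rest_op" by (rule expands_subset[OF rest_op_expands D(2)])
  note LiE = expands_inverse[OF D(1) bounded_op_lead_inv lead_inv_lead_op restD Li0 right]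
  define Minv where "Minv \<mu> f = rescale_P \<mu> (Li \<mu> f)" for \<mu> f
  \<comment> \<open>Both terms carry one power of \<mu> in (Q + \<mu>P) L: the first through \<mu>P,
    the second through L = \<open>lead_inv\<close> - \<mu> \<open>lead_inv\<close>
    \<open>rest_op\<close> L.\<close>
  define F where "F \<mu> f = P_op V (Li \<mu> f) - Q_op V (lead_inv (rest_op \<mu> (Li \<mu> f)))" for \<mu> f
  show ?thesis
  proof (rule exI[of _ \<mu>0], rule exI[of _ Minv], rule exI[of _ F], intro conjI ballI allI, unfold D_def[symmetric])
    fix \<mu> f assume \<mu>: "\<mu> \<in> D"
    then have \<mu>1: "\<mu> \<in> unit_quadrant" and nz: "\<mu> \<noteq> 0" using D(2) by (auto simp: unit_quadrant_def)
    show "bounded_op (Minv \<mu>)"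
      unfolding Minv_def[abs_def] by (rule bounded_op_comp[OF bounded_op_rescale_P Li(1)[OF \<mu>]])
    show "M_op \<mu> (Minv \<mu> f) = f"
      unfolding Minv_def M_rescale_P[OF \<mu>1] by (rule right[OF \<mu>])
    \<comment> \<open>The left inverse is known on the range of Q + \<mu>P only, but that factor is
      invertible with inverse Q + P/\<mu>, so every vector is reached.\<close>
    show "Minv \<mu> (M_op \<mu> f) = f"
      using left[OF \<mu>, of "rescale_P (1 / \<mu>) f"] by (simp add: Minv_def rescale_P_inverse[OF nz] flip: M_rescale_P[OF \<mu>1])
    have "Li \<mu> f = lead_inv f - \<mu> *\<^sub>C lead_inv (rest_op \<mu> (Li \<mu> f))" by (rule LiE(2)) (use \<mu> in auto)
    then have "Q_op V (Li \<mu> f) = m0_inv_Q f - \<mu> *\<^sub>C Q_op V (lead_inv (rest_op \<mu> (Li \<mu> f)))"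
      by (metis Q_lead_inv bounded_op_Q bounded_op_cscale bounded_op_diff)
    then show "Minv \<mu> f = m0_inv_Q f + \<mu> *\<^sub>C F \<mu> f"
      by (simp add: Minv_def rescale_P_def F_def cscale_diff_right)
  next
    have LiE: "expands D n Li" by (rule LiE(1))
    show "expands D n F"
      unfolding F_def[abs_def]
      by (rule expands_diff[OF D(1) expands_const_comp[OF D(1) bounded_op_P LiE]
            expands_const_comp[OF D(1) bounded_op_comp[OF bounded_op_Q bounded_op_lead_inv] expands_comp[OF D(1) restD LiE]]])
  qed (rule \<mu>0)+
qed

lemma resolvent_expansion:
  "\<exists>\<mu>0::real. \<mu>0 > 0 \<and> (\<exists>(M :: nat \<Rightarrow> l2 \<Rightarrow> l2) (R :: complex \<Rightarrow> l2 \<Rightarrow> l2).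
     (\<forall>j<n. bounded_op (M j)) \<and>
     (\<exists>C. \<forall>\<mu>. Re \<mu> > 0 \<and> Im \<mu> > 0 \<and> norm \<mu> \<le> \<mu>0 \<longrightarrow> bounded_op (R \<mu>) \<and> onorm (R \<mu>) \<le> C) \<and>
     (\<forall>\<mu>. Re \<mu> > 0 \<and> Im \<mu> > 0 \<and> norm \<mu> \<le> \<mu>0 \<longrightarrow>
        \<mu> ^ 4 \<in> resolvent_set (H_op V) \<and>
        sandwich_eq (w_fun V) (op_resolvent (H_op V) (\<mu> ^ 4))
          (\<lambda>f. U_op V f - Q_op V (m0_inv V (Q_op V f)) + (\<Sum>j<n. \<mu> ^ Suc j *\<^sub>C M j f) + \<mu> ^ Suc n *\<^sub>C R \<mu> f)))"
proof -
  obtain \<mu>0 Minv F where \<mu>0: "0 < \<mu>0" "\<mu>0 \<le> 1" and F: "expands {\<mu> \<in> unit_quadrant. norm \<mu> \<le> \<mu>0} n F"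
    and all: "\<forall>\<mu>\<in>{\<mu> \<in> unit_quadrant. norm \<mu> \<le> \<mu>0}. bounded_op (Minv \<mu>) \<and>
      (\<forall>f. M_op \<mu> (Minv \<mu> f) = f \<and> Minv \<mu> (M_op \<mu> f) = f \<and> Minv \<mu> f = m0_inv_Q f + \<mu> *\<^sub>C F \<mu> f)"
    using inverse_expansion by blast
  define D where "D = {\<mu> \<in> unit_quadrant. norm \<mu> \<le> \<mu>0}"
  have D: "\<forall>\<mu>\<in>D. norm \<mu> \<le> 1" by (auto simp: D_def unit_quadrant_def)
  have Minv: "bounded_op (Minv \<mu>)" "M_op \<mu> (Minv \<mu> f) = f" "Minv \<mu> (M_op \<mu> f) = f"
    and MF: "Minv \<mu> f = m0_inv_Q f + \<mu> *\<^sub>C F \<mu> f" if "\<mu> \<in> D" for \<mu> f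
    using all that unfolding D_def by blast+
  have D_iff: "\<mu> \<in> D \<longleftrightarrow> Re \<mu> > 0 \<and> Im \<mu> > 0 \<and> norm \<mu> \<le> \<mu>0" for \<mu>
    using \<mu>0 by (auto simp: D_def unit_quadrant_def)
  \<comment> \<open>The sandwiched resolvent is U minus the inverse of M(\<mu>), so the coefficients
    sought are those of -F.\<close>
  have neg: "expands D n (\<lambda>\<mu> f. 0 - F \<mu> f)"
    by (rule expands_diff[OF D expands_const[OF D bounded_op_const_zero] F[folded D_def]])
  obtain M R where M: "\<And>j. j < n \<Longrightarrow> bounded_op (M j)" and R: "expands D 0 R"
    and eq: "\<And>\<mu> f. \<mu> \<in> D \<Longrightarrow> 0 - F \<mu> f = (\<Sum>j<n. \<mu> ^ j *\<^sub>C M j f) + \<mu> ^ n *\<^sub>C R \<mu> f"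
    using expands_sum[OF neg] by blast
  have main: "\<mu> ^ 4 \<in> resolvent_set (H_op V) \<and>
        sandwich_eq (w_fun V) (op_resolvent (H_op V) (\<mu> ^ 4))
          (\<lambda>f. U_op V f - Q_op V (m0_inv V (Q_op V f)) + (\<Sum>j<n. \<mu> ^ Suc j *\<^sub>C M j f) + \<mu> ^ Suc n *\<^sub>C R \<mu> f)"
    if \<mu>: "\<mu> \<in> D" for \<mu>
  proof -
    have q: "Re \<mu> > 0" "Im \<mu> > 0" using \<mu> D_iff by auto
    have pointwise: "U_op V f - Minv \<mu> f = U_op V f - Q_op V (m0_inv V (Q_op V f)) + (\<Sum>j<n. \<mu> ^ Suc j *\<^sub>C M j f) + \<mu> ^ Suc n *\<^sub>C R \<mu> f" for f
    proof -
      have "U_op V f - Minv \<mu> f = U_op V f - Q_op V (m0_inv_Q f) + \<mu> *\<^sub>C (0 - F \<mu> f)"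
        using MF[OF \<mu>, of f] by (simp add: cscale_diff_right del: diff_0)
      also have "\<mu> *\<^sub>C (0 - F \<mu> f) = (\<Sum>j<n. \<mu> ^ Suc j *\<^sub>C M j f) + \<mu> ^ Suc n *\<^sub>C R \<mu> f"
        unfolding eq[OF \<mu>] by (simp add: cscale_add_right cscale_sum)
      finally show ?thesis by (simp add: m0_inv_Q_def)
    qed
    have "\<mu> ^ 4 \<in> resolvent_set (H_op V) \<and>
        sandwich_eq (w_fun V) (op_resolvent (H_op V) (\<mu> ^ 4)) (\<lambda>f. U_op V f - Minv \<mu> f)"
      using sandwich_resolvent[OF V q V_L2 v_L2 Minv(1)[OF \<mu>]]
        Minv(2,3)[OF \<mu>, unfolded M_op_def weighted_def[abs_def]] by blast
    then show ?thesis unfolding pointwise .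
  qed
  have R': "\<exists>C. \<forall>\<mu>. \<mu> \<in> D \<longrightarrow> bounded_op (R \<mu>) \<and> onorm (R \<mu>) \<le> C" using R by auto
  show ?thesis
    by (rule exI[of _ \<mu>0], rule conjI[OF \<mu>0(1)], rule exI[of _ M], rule exI[of _ R], intro conjI)
      (use M R'[unfolded D_iff] main[unfolded D_iff] in blast)+
qed

end

section \<open>From the weight condition on V to the moment of v, and the theorem\<close>

lemma japanese_sig: "japanese x = sig x"
  by (simp add: japanese_def sig_def powr_half_sqrt add_nonneg_nonneg)

theorem theorem2p6:
  shows "\<exists>\<kappa>0::real. \<kappa>0 > 0 \<and>
    (\<forall>\<kappa> \<ge> \<kappa>0. \<forall>(V :: r3 \<Rightarrow> real) (p :: int).
       V \<in> borel_measurable borel \<longrightarrow>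
       decays V \<longrightarrow>
       sq_int (\<lambda>x. complex_of_real (japanese x powr \<kappa> * V x)) \<longrightarrow>
       (\<kappa> > 2 * real_of_int p + 5 \<and> (\<forall>q::int. \<kappa> > 2 * real_of_int q + 5 \<longrightarrow> q \<le> p)) \<longrightarrow>
       zero_regular V \<longrightarrow>
       (\<exists>\<mu>0::real. \<mu>0 > 0 \<and>
         (\<exists>(M' :: int \<Rightarrow> l2 \<Rightarrow> l2) (R :: complex \<Rightarrow> l2 \<Rightarrow> l2).
            (\<forall>j\<in>{1..p - 1}. bounded_op (M' j)) \<and>
            (\<exists>C. \<forall>\<mu>. Re \<mu> > 0 \<and> Im \<mu> > 0 \<and> norm \<mu> \<le> \<mu>0 \<longrightarrow>
                bounded_op (R \<mu>) \<and> onorm (R \<mu>) \<le> C) \<and>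
            (\<forall>\<mu>. Re \<mu> > 0 \<and> Im \<mu> > 0 \<and> norm \<mu> \<le> \<mu>0 \<longrightarrow>
                \<mu> ^ 4 \<in> resolvent_set (H_op V) \<and>
                sandwich_eq (w_fun V) (op_resolvent (H_op V) (\<mu> ^ 4))
                  (\<lambda>f. U_op V f - Q_op V (m0_inv V (Q_op V f))
                     + (\<Sum>j\<in>{1..p - 1}. (\<mu> powi j) *\<^sub>C M' j f)
                     + (\<mu> powi p) *\<^sub>C R \<mu> f)))))"
proof (rule exI[of _ 8], intro conjI allI impI, goal_cases)
  case 1
  show ?case by simp
next
  case (2 \<kappa> V p)
  note \<kappa> = 2(1) and V [measurable] = 2(2) and L2 = 2(4) and p = 2(5) and reg = 2(6)
  \<comment> \<open>The threshold 8 gives \<kappa> > 7 = 2 * 1 + 5, so 1 is an admissible integer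
    and maximality yields the bound.\<close>
  have "1 \<le> p" using p \<kappa> by auto
  \<comment> \<open>The number of coefficients between the constant term and the remainder; the
    moment needed is then of order n + 2 = p + 1.\<close>
  define n where "n = nat (p - 1)"
  have pn: "p = int (Suc n)" using \<open>1 \<le> p\<close> by (simp add: n_def)
  have \<kappa>n: "\<kappa> > 2 * real n + 7" using p pn by simp
  let ?a = "\<lambda>x. sig x powr \<kappa> * \<bar>V x\<bar>"
  have sig_ge: "\<bar>V x\<bar> \<le> ?a x" for x
  proof -
    have "1 \<le> sig x powr \<kappa>" using sig_ge_1[of x] \<kappa> by (intro ge_one_powr_ge_zero) auto
    then show ?thesis using mult_right_mono[of 1 "sig x powr \<kappa>" "\<bar>V x\<bar>"] by simp
  qed
  have nL2: "norm (complex_of_real (japanese x powr \<kappa> * V x)) = ?a x" for x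
    by (simp only: norm_of_real abs_mult japanese_sig) simp
  have V_L2: "sq_int (\<lambda>x. complex_of_real (V x))"
  proof (rule sq_int_bound[OF L2])
    show "AE x in lborel. norm (complex_of_real (V x)) \<le> norm (complex_of_real (japanese x powr \<kappa> * V x))"
      unfolding nL2 using sig_ge by simp
  qed measurable
  have "integrable lborel (\<lambda>x. (norm (complex_of_real (v_fun V x * sig x ^ (n + 2))))\<^sup>2)"
  proof (rule Bochner_Integration.integrable_bound)
    show "integrable lborel (\<lambda>x. (norm (complex_of_real (japanese x powr \<kappa> * V x)))\<^sup>2 + 1 / sig x ^ 4)"
      using L2 integrable_sig_4 by (intro Bochner_Integration.integrable_add) (auto simp: sq_int_def)
    note [measurable] = v_meas[OF V]
    show "(\<lambda>x. (norm (complex_of_real (v_fun V x * sig x ^ (n + 2))))\<^sup>2) \<in> borel_measurable lborel"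
      by measurable
    have "(norm (complex_of_real (v_fun V x * sig x ^ (n + 2))))\<^sup>2 \<le> (?a x)\<^sup>2 + 1 / sig x ^ 4" for x
    proof -
      define s where "s = sig x"
      have s: "1 \<le> s" "0 < s" using sig_ge_1[of x] sig_pos[of x] by (auto simp: s_def)
      have "(norm (complex_of_real (v_fun V x * s ^ (n + 2))))\<^sup>2 = (v_fun V x * v_fun V x) * (s ^ (n + 2))\<^sup>2"
        by (simp only: norm_of_real power2_abs power_mult_distrib power2_eq_square[of "v_fun V x"])
      also have "v_fun V x * v_fun V x = \<bar>V x\<bar>"
        by (simp add: v_fun_def powr_add[symmetric])
      also have "(s ^ (n + 2))\<^sup>2 = s powr (2 * real n + 4)"
      proof -
        have "(n + 2) * 2 = 2 * n + 4" by simp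
        then have "(s ^ (n + 2))\<^sup>2 = s ^ (2 * n + 4)" by (simp only: power_mult[symmetric])
        also have "\<dots> = s powr real (2 * n + 4)" by (rule powr_realpow[OF s(2), symmetric])
        finally show ?thesis by simp
      qed
      \<comment> \<open>The full weight \<kappa> is attached to V, which is then square integrable.
        The leftover exponent 2n + 4 - \<kappa> is below -3; the bound -2 suffices, because the
        square of that power is the integrable inverse fourth power of \<open>sig\<close>.\<close>
      also have "\<bar>V x\<bar> * s powr (2 * real n + 4) = (s powr \<kappa> * \<bar>V x\<bar>) * s powr (2 * real n + 4 - \<kappa>)"
        using s by (simp add: powr_add[symmetric] mult.commute mult.left_commute)
      also have "\<dots> \<le> (s powr \<kappa> * \<bar>V x\<bar>) * (1 / s\<^sup>2)"
      proof (rule mult_left_mono)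
        have "s powr (2 * real n + 4 - \<kappa>) \<le> s powr (- 2)"
          using s \<kappa>n by (intro powr_mono) auto
        also have "\<dots> = 1 / s\<^sup>2" using s by (simp add: powr_minus_divide powr_numeral)
        finally show "s powr (2 * real n + 4 - \<kappa>) \<le> 1 / s\<^sup>2" .
      qed auto
      also have "\<dots> \<le> (s powr \<kappa> * \<bar>V x\<bar>)\<^sup>2 + (1 / s\<^sup>2)\<^sup>2"
      proof -
        have "a * b \<le> a\<^sup>2 + b\<^sup>2" if "0 \<le> a" "0 \<le> b" for a b :: real
          using sum_squares_bound[of a b] mult_nonneg_nonneg[OF that] by linarith
        from this[of "s powr \<kappa> * \<bar>V x\<bar>" "1 / s\<^sup>2"] show ?thesis by simp
      qed
      also have "(1 / s\<^sup>2)\<^sup>2 = 1 / s ^ 4" by (simp add: power_divide flip: power_mult)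
      finally show ?thesis unfolding s_def .
    qed
    then show "AE x in lborel. norm ((norm (complex_of_real (v_fun V x * sig x ^ (n + 2))))\<^sup>2)
        \<le> norm ((norm (complex_of_real (japanese x powr \<kappa> * V x)))\<^sup>2 + 1 / sig x ^ 4)"
      unfolding nL2 using sig_pos[THEN less_imp_le] by (intro AE_I2) (simp only: real_norm_def abs_of_nonneg zero_le_power2 add_nonneg_nonneg zero_le_divide_1_iff zero_le_power)
  qed
  moreover have "(\<lambda>x. complex_of_real (v_fun V x * sig x ^ (n + 2))) \<in> borel_measurable borel"
  proof -
    note [measurable] = v_meas[OF V]
    show ?thesis by measurable
  qed
  ultimately have mom: "sq_int (\<lambda>x. complex_of_real (v_fun V x * sig x ^ (n + 2)))"
    by (simp add: sq_int_def)
  obtain \<mu>0 M R where \<mu>0: "\<mu>0 > 0" and M: "\<And>j. j < n \<Longrightarrow> bounded_op (M j)"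
    and R: "\<exists>C. \<forall>\<mu>. Re \<mu> > 0 \<and> Im \<mu> > 0 \<and> norm \<mu> \<le> \<mu>0 \<longrightarrow> bounded_op (R \<mu>) \<and> onorm (R \<mu>) \<le> C"
    and main: "\<And>\<mu>. Re \<mu> > 0 \<and> Im \<mu> > 0 \<and> norm \<mu> \<le> \<mu>0 \<Longrightarrow>
        \<mu> ^ 4 \<in> resolvent_set (H_op V) \<and>
        sandwich_eq (w_fun V) (op_resolvent (H_op V) (\<mu> ^ 4))
          (\<lambda>f. U_op V f - Q_op V (m0_inv V (Q_op V f)) + (\<Sum>j<n. \<mu> ^ Suc j *\<^sub>C M j f) + \<mu> ^ Suc n *\<^sub>C R \<mu> f)"
    using resolvent_expansion[OF V V_L2 mom reg] by blast
  \<comment> \<open>\<open>M j\<close> is the coefficient of \<mu>^(j+1), whereas the coefficients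
    of the theorem are indexed by the exponent itself; hence the shift by one.\<close>
  define M' where "M' j = M (nat j - 1)" for j :: int
  have reindex: "(\<Sum>j<n. \<mu> ^ Suc j *\<^sub>C M j f) = (\<Sum>j\<in>{1..p - 1}. (\<mu> powi j) *\<^sub>C M' j f)" for \<mu> f
  proof (rule sum.reindex_bij_witness[of _ "\<lambda>j. nat j - 1" "\<lambda>j. int (Suc j)"])
    show "(\<mu> powi int (Suc j)) *\<^sub>C M' (int (Suc j)) f = \<mu> ^ Suc j *\<^sub>C M j f" for j
      unfolding power_int_of_nat M'_def nat_int by simp
  qed (auto simp: pn)
  have "\<mu> ^ Suc n = \<mu> powi p" for \<mu> :: complex unfolding pn power_int_of_nat ..
  then have main': "\<mu> ^ 4 \<in> resolvent_set (H_op V) \<and>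
        sandwich_eq (w_fun V) (op_resolvent (H_op V) (\<mu> ^ 4))
          (\<lambda>f. U_op V f - Q_op V (m0_inv V (Q_op V f)) + (\<Sum>j\<in>{1..p - 1}. (\<mu> powi j) *\<^sub>C M' j f) + (\<mu> powi p) *\<^sub>C R \<mu> f)"
    if "Re \<mu> > 0 \<and> Im \<mu> > 0 \<and> norm \<mu> \<le> \<mu>0" for \<mu>
    using main[OF that] unfolding reindex by simp
  have bM': "\<forall>j\<in>{1..p - 1}. bounded_op (M' j)" unfolding M'_def by (intro ballI M) (auto simp: pn)
  show ?case
    by (rule exI[of _ \<mu>0], rule conjI[OF \<mu>0], rule exI[of _ M'], rule exI[of _ R], intro conjI)
      (use bM' R main' in blast)+
qed

end
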